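(* Let $G$ be a finite group acting linearly on a complex vector space $V$ with basis $v_1,\ldots,v_n$, let $\mathbf{q}=(q_{ij})$ be nonzero complex scalars with $q_{ii}=1$ and $q_{ji}=q_{ij}^{-1}$, and assume that the action of $G$ on $V$ induces an action on $S_{\mathbf{q}}(V)$ by algebra automorphisms. Assume moreover that the action of $G$ on $V$ extends to an action on $\bigwedge_{\mathbf{q}}(V)$ by algebra automorphisms. Then each constant Hochschild 2-cocycle on $S_{\mathbf{q}}(V)\rtimes G$ gives rise to a quantum Drinfeld Hecke algebra; that is, if $\mu$ is a constant Hochschild 2-cocycle on $S_{\mathbf{q}}(V)\rtimes G$ and $\kappa:V\times V\to\mathbb{C}G$ is the bilinear map determined by $$\kappa(v_i,v_j)=\mu(v_i\otimes v_j)-q_{ij}\,\mu(v_j\otimes v_i)\qquad(1\le i,j\le n),$$ then $\mathcal{H}_{\mathbf{q},\kappa}$ is a quantum Drinfeld Hecke algebra.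
   Context: All tensor products are over $\mathbb{C}$. $S_{\mathbf{q}}(V)=\mathbb{C}\langle v_1,\ldots,v_n\mid v_iv_j=q_{ij}v_jv_i\ \forall i,j\rangle$ and $\bigwedge_{\mathbf{q}}(V)=\mathbb{C}\langle v_1,\ldots,v_n\mid v_iv_j=-q_{ij}v_jv_i\ \forall i,j\rangle$ are the quantum symmetric and quantum exterior algebras; $T(V)$ is the tensor algebra. For an algebra $A$ with an action of $G$ by automorphisms $a\mapsto{}^g a$, the skew group algebra $A\rtimes G$ is the free left $A$-module with basis $G$ and multiplication $(ag)(bh)=a({}^g b)\,gh$. $S_{\mathbf{q}}(V)\rtimes G$ is graded with $\deg v_i=1$, $\deg g=0$. A Hochschild 2-cocycle on an algebra $R$ is a linear map $\mu:R\otimes R\to R$ with $\mu(r\otimes s)u+\mu(rs\otimes u)=\mu(r\otimes su)+r\mu(s\otimes u)$ for all $r,s,u\in R$. A constant Hochschild 2-cocycle on $R=S_{\mathbf{q}}(V)\rtimes G$ is a Hochschild 2-cocycle that is homogeneous of degree $-2$ as a map from the graded space $R\otimes R$ to $R$; in particular $\mu(v_i\otimes v_j)\in\mathbb{C}G$. For a bilinear map $\kappa:V\times V\to\mathbb{C}G$ with $\kappa(v_i,v_j)=-q_{ij}\kappa(v_j,v_i)$ for all $i,j$, let $$\mathcal{H}_{\mathbf{q},\kappa}=T(V)\rtimes G\,/\,(v_iv_j-q_{ij}v_jv_i-\kappa(v_i,v_j)\mid 1\le i,j\le n),$$ filtered with each $v_i$ in degree $1$ and each $g\in G$ in degree $0$.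 It is called a quantum Drinfeld Hecke algebra if its associated graded algebra is isomorphic (as a graded algebra) to $S_{\mathbf{q}}(V)\rtimes G$. *)

theory Defs
  imports Complex_Main "HOL-Algebra.QuotRing" "HOL-Algebra.Module" "HOL-Algebra.Group_Action"
begin

text \<open>
  A complex algebra is represented by a record of type \<open>(complex, 'a) module\<close> of HOL-Algebra,
  that is, a (not necessarily commutative) ring record together with the scalar multiplication
  \<open>\<odot>\<close>.  A grading or filtration is a function from \<open>int\<close> to sets of elements; the parts of negative
  index are \<open>{\<zero>}\<close>.
\<close>

definition complex_alg :: "(complex, complex) module" where
  "complex_alg =
     \<lparr>carrier = UNIV, mult = (*), one = 1, zero = 0, add = (+), smult = (*)\<rparr>"

definition algebra_iso ::
    "('c, 'a, 'm) module_scheme \<Rightarrow> ('c, 'b, 'k) module_scheme \<Rightarrow> ('a \<Rightarrow> 'b) set" where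
  "algebra_iso A B =
     {\<phi> \<in> ring_iso A B. \<forall>c. \<forall>x\<in>carrier A. \<phi> (c \<odot>\<^bsub>A\<^esub> x) = c \<odot>\<^bsub>B\<^esub> \<phi> x}"

definition graded_algebra_isomorphic ::
    "('c, 'a, 'm) module_scheme \<Rightarrow> (int \<Rightarrow> 'a set)
      \<Rightarrow> ('c, 'b, 'k) module_scheme \<Rightarrow> (int \<Rightarrow> 'b set) \<Rightarrow> bool" where
  "graded_algebra_isomorphic A gA B gB \<longleftrightarrow>
     (\<exists>\<phi> \<in> algebra_iso A B. \<forall>d. \<phi> ` gA d = gB d)"

definition acts_by_automorphisms ::
    "('g, 'h) monoid_scheme \<Rightarrow> ('c, 'a, 'm) module_scheme \<Rightarrow> ('g \<Rightarrow> 'a \<Rightarrow> 'a) \<Rightarrow> bool" where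
  "acts_by_automorphisms G A \<alpha> \<longleftrightarrow>
     group_action G (carrier A) \<alpha> \<and> (\<forall>g\<in>carrier G. \<alpha> g \<in> algebra_iso A A)"


text \<open>Quotient of an algebra by a two-sided ideal, and the image in it of a family of subsets.\<close>

definition quotient_algebra ::
    "('c, 'a, 'm) module_scheme \<Rightarrow> 'a set \<Rightarrow> ('c, 'a set) module" where
  "quotient_algebra A I =
     ring.extend (A Quot I) (module.fields (\<lambda>c X. \<Union>x\<in>X. I +>\<^bsub>A\<^esub> (c \<odot>\<^bsub>A\<^esub> x)))"

definition quotient_part ::
    "('c, 'a, 'm) module_scheme \<Rightarrow> 'a set \<Rightarrow> (int \<Rightarrow> 'a set) \<Rightarrow> int \<Rightarrow> 'a set set" where
  "quotient_part A I P d = (\<lambda>x. I +>\<^bsub>A\<^esub> x) ` P d"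


text \<open>
  The associated graded algebra of an algebra filtered by \<open>F\<close>.  An element is a family \<open>x\<close> of cosets,
  almost all zero, whose entry \<open>x m\<close> belongs to \<open>F m / F (m - 1)\<close>.  The product is the extension
  of \<open>(a + F (i - 1)) (b + F (j - 1)) = a b + F (i + j - 1)\<close>; as in \<^const>\<open>rcoset_mult\<close>, the
  operations are written as unions over all representatives.
\<close>

definition associated_graded ::
    "('c, 'a, 'm) module_scheme \<Rightarrow> (int \<Rightarrow> 'a set) \<Rightarrow> ('c, nat \<Rightarrow> 'a set) module" where
  "associated_graded A F =
     \<lparr>carrier = {x. (\<forall>m. \<exists>a\<in>F (int m). x m = F (int m - 1) +>\<^bsub>A\<^esub> a)
                   \<and> finite {m. x m \<noteq> F (int m - 1)}},
      mult = (\<lambda>x y m.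
        \<Union>a\<in>Pi {..m} x. \<Union>b\<in>Pi {..m} y.
          F (int m - 1) +>\<^bsub>A\<^esub> (\<Oplus>\<^bsub>A\<^esub>i\<in>{..m}. a i \<otimes>\<^bsub>A\<^esub> b (m - i))),
      one = (\<lambda>m. F (int m - 1) +>\<^bsub>A\<^esub> (if m = 0 then \<one>\<^bsub>A\<^esub> else \<zero>\<^bsub>A\<^esub>)),
      zero = (\<lambda>m. F (int m - 1)),
      add = (\<lambda>x y m. x m <+>\<^bsub>A\<^esub> y m),
      smult = (\<lambda>c x m. \<Union>a\<in>x m. F (int m - 1) +>\<^bsub>A\<^esub> (c \<odot>\<^bsub>A\<^esub> a))\<rparr>"

definition associated_graded_part ::
    "('c, 'a, 'm) module_scheme \<Rightarrow> (int \<Rightarrow> 'a set) \<Rightarrow> int \<Rightarrow> (nat \<Rightarrow> 'a set) set" where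
  "associated_graded_part A F d =
     {x \<in> carrier (associated_graded A F). \<forall>m. int m \<noteq> d \<longrightarrow> x m = F (int m - 1)}"


text \<open>
  The free algebra on \<open>v\<^sub>1, \<dots>, v\<^sub>n\<close>, which is the tensor algebra of the space with basis
  \<open>v\<^sub>1, \<dots>, v\<^sub>n\<close>: an element gives the coefficient of each word in the letters \<open>{1..n}\<close>.
\<close>

definition free_algebra :: "nat \<Rightarrow> (complex, nat list \<Rightarrow> complex) module" where
  "free_algebra n =
     \<lparr>carrier = {f. finite {w. f w \<noteq> 0} \<and> (\<forall>w. f w \<noteq> 0 \<longrightarrow> set w \<subseteq> {1..n})},
      mult = (\<lambda>f h w. \<Sum>k\<le>length w. f (take k w) * h (drop k w)),
      one = (\<lambda>w. if w = [] then 1 else 0),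
      zero = (\<lambda>w. 0),
      add = (\<lambda>f h w. f w + h w),
      smult = (\<lambda>c f w. c * f w)\<rparr>"

definition free_gen :: "nat \<Rightarrow> nat list \<Rightarrow> complex" where
  "free_gen i = (\<lambda>w. if w = [i] then 1 else 0)"

definition free_grade :: "nat \<Rightarrow> int \<Rightarrow> (nat list \<Rightarrow> complex) set" where
  "free_grade n d =
     {f \<in> carrier (free_algebra n). \<forall>w. f w \<noteq> 0 \<longrightarrow> int (length w) = d}"

definition free_filtration :: "nat \<Rightarrow> int \<Rightarrow> (nat list \<Rightarrow> complex) set" where
  "free_filtration n d =
     {f \<in> carrier (free_algebra n). \<forall>w. f w \<noteq> 0 \<longrightarrow> int (length w) \<le> d}"


text \<open>
  The algebra generated by \<open>v\<^sub>1, \<dots>, v\<^sub>n\<close> with relations \<open>v\<^sub>i v\<^sub>j = p\<^sub>i\<^sub>j v\<^sub>j v\<^sub>i\<close>.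
  For \<open>p = q\<close> this is the quantum symmetric and for \<open>p = -q\<close> the quantum exterior algebra.
\<close>

definition q_ideal :: "nat \<Rightarrow> (nat \<Rightarrow> nat \<Rightarrow> complex) \<Rightarrow> (nat list \<Rightarrow> complex) set" where
  "q_ideal n p =
     (let T = free_algebra n in
      Idl\<^bsub>T\<^esub> {free_gen i \<otimes>\<^bsub>T\<^esub> free_gen j \<ominus>\<^bsub>T\<^esub> p i j \<odot>\<^bsub>T\<^esub> (free_gen j \<otimes>\<^bsub>T\<^esub> free_gen i)
              | i j. i \<in> {1..n} \<and> j \<in> {1..n}})"

definition q_algebra ::
    "nat \<Rightarrow> (nat \<Rightarrow> nat \<Rightarrow> complex) \<Rightarrow> (complex, (nat list \<Rightarrow> complex) set) module" where
  "q_algebra n p = quotient_algebra (free_algebra n) (q_ideal n p)"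

definition q_gen :: "nat \<Rightarrow> (nat \<Rightarrow> nat \<Rightarrow> complex) \<Rightarrow> nat \<Rightarrow> (nat list \<Rightarrow> complex) set" where
  "q_gen n p i = q_ideal n p +>\<^bsub>free_algebra n\<^esub> free_gen i"

definition q_grade ::
    "nat \<Rightarrow> (nat \<Rightarrow> nat \<Rightarrow> complex) \<Rightarrow> int \<Rightarrow> (nat list \<Rightarrow> complex) set set" where
  "q_grade n p = quotient_part (free_algebra n) (q_ideal n p) (free_grade n)"

abbreviation quantum_symmetric ::
    "nat \<Rightarrow> (nat \<Rightarrow> nat \<Rightarrow> complex) \<Rightarrow> (complex, (nat list \<Rightarrow> complex) set) module" where
  "quantum_symmetric n q \<equiv> q_algebra n q"

abbreviation quantum_exterior ::
    "nat \<Rightarrow> (nat \<Rightarrow> nat \<Rightarrow> complex) \<Rightarrow> (complex, (nat list \<Rightarrow> complex) set) module" where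
  "quantum_exterior n q \<equiv> q_algebra n (\<lambda>i j. - q i j)"


text \<open>
  The space \<open>V\<close> is a type with scalar multiplication \<open>scale\<close> (locale \<^locale>\<open>vector_space\<close>).
\<close>

definition is_basis ::
    "(complex \<Rightarrow> 'v::ab_group_add \<Rightarrow> 'v) \<Rightarrow> nat \<Rightarrow> (nat \<Rightarrow> 'v) \<Rightarrow> bool" where
  "is_basis scale n v \<longleftrightarrow>
     inj_on v {1..n} \<and> \<not> module.dependent scale (v ` {1..n})
     \<and> module.span scale (v ` {1..n}) = UNIV"

definition coord ::
    "(complex \<Rightarrow> 'v::ab_group_add \<Rightarrow> 'v) \<Rightarrow> nat \<Rightarrow> (nat \<Rightarrow> 'v) \<Rightarrow> 'v \<Rightarrow> nat \<Rightarrow> complex" where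
  "coord scale n v x i = module.representation scale (v ` {1..n}) x (v i)"

definition tensor_incl ::
    "(complex \<Rightarrow> 'v::ab_group_add \<Rightarrow> 'v) \<Rightarrow> nat \<Rightarrow> (nat \<Rightarrow> 'v) \<Rightarrow> 'v \<Rightarrow> nat list \<Rightarrow> complex" where
  "tensor_incl scale n v x = (\<lambda>w. \<Sum>i=1..n. coord scale n v x i * free_gen i w)"

text \<open>
  The diagonal action on the tensor algebra: a word \<open>w\<^sub>1 \<dots> w\<^sub>k\<close> is sent to the product of the
  vectors \<open>\<rho> g (v w\<^sub>1), \<dots>, \<rho> g (v w\<^sub>k)\<close>, in which the word \<open>u\<close> has as coefficient the product of the
  matrix entries of \<open>\<rho> g\<close>.
\<close>

definition tensor_action ::
    "(complex \<Rightarrow> 'v::ab_group_add \<Rightarrow> 'v) \<Rightarrow> nat \<Rightarrow> (nat \<Rightarrow> 'v) \<Rightarrow> ('g \<Rightarrow> 'v \<Rightarrow> 'v)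
      \<Rightarrow> 'g \<Rightarrow> (nat list \<Rightarrow> complex) \<Rightarrow> nat list \<Rightarrow> complex" where
  "tensor_action scale n v \<rho> g =
     (\<lambda>f\<in>carrier (free_algebra n). \<lambda>u.
        if set u \<subseteq> {1..n}
        then \<Sum>w | set w \<subseteq> {1..n} \<and> length w = length u.
               (\<Prod>k<length u. coord scale n v (\<rho> g (v (w ! k))) (u ! k)) * f w
        else 0)"

text \<open>
  \<open>\<alpha>\<close> is an action on \<open>q_algebra n p\<close> by algebra automorphisms that extends the action \<open>\<rho>\<close> on \<open>V\<close>.
  As \<open>V\<close> generates the algebra there is at most one such \<open>\<alpha>\<close> on the group.
\<close>

definition extends_action ::
    "('g, 'h) monoid_scheme \<Rightarrow> (complex \<Rightarrow> 'v::ab_group_add \<Rightarrow> 'v) \<Rightarrow> nat \<Rightarrow> (nat \<Rightarrow> 'v)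
      \<Rightarrow> ('g \<Rightarrow> 'v \<Rightarrow> 'v) \<Rightarrow> (nat \<Rightarrow> nat \<Rightarrow> complex)
      \<Rightarrow> ('g \<Rightarrow> (nat list \<Rightarrow> complex) set \<Rightarrow> (nat list \<Rightarrow> complex) set) \<Rightarrow> bool" where
  "extends_action G scale n v \<rho> p \<alpha> \<longleftrightarrow>
     acts_by_automorphisms G (q_algebra n p) \<alpha>
     \<and> (\<forall>g\<in>carrier G. \<forall>x.
          \<alpha> g (q_ideal n p +>\<^bsub>free_algebra n\<^esub> tensor_incl scale n v x)
          = q_ideal n p +>\<^bsub>free_algebra n\<^esub> tensor_incl scale n v (\<rho> g x))"


text \<open>
  The skew group algebra, for finite \<open>G\<close>: the function \<open>f\<close> stands for the sum of the \<open>f g \<cdot> g\<close>.  The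
  coefficient of \<open>k\<close> in a product collects the terms \<open>(a g)(b h) = a (\<alpha> g b) g h\<close> with
  \<open>h = g\<^sup>-\<^sup>1 k\<close>.
\<close>

definition skew_group_algebra ::
    "('c, 'a, 'm) module_scheme \<Rightarrow> ('g, 'h) monoid_scheme \<Rightarrow> ('g \<Rightarrow> 'a \<Rightarrow> 'a)
      \<Rightarrow> ('c, 'g \<Rightarrow> 'a) module" where
  "skew_group_algebra A G \<alpha> =
     \<lparr>carrier = carrier G \<rightarrow>\<^sub>E carrier A,
      mult = (\<lambda>f f'. \<lambda>k\<in>carrier G.
                \<Oplus>\<^bsub>A\<^esub>g\<in>carrier G. f g \<otimes>\<^bsub>A\<^esub> \<alpha> g (f' (inv\<^bsub>G\<^esub> g \<otimes>\<^bsub>G\<^esub> k))),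
      one = (\<lambda>g\<in>carrier G. if g = \<one>\<^bsub>G\<^esub> then \<one>\<^bsub>A\<^esub> else \<zero>\<^bsub>A\<^esub>),
      zero = (\<lambda>g\<in>carrier G. \<zero>\<^bsub>A\<^esub>),
      add = (\<lambda>f f'. \<lambda>g\<in>carrier G. f g \<oplus>\<^bsub>A\<^esub> f' g),
      smult = (\<lambda>c f. \<lambda>g\<in>carrier G. c \<odot>\<^bsub>A\<^esub> f g)\<rparr>"

definition skew_part ::
    "('g, 'h) monoid_scheme \<Rightarrow> (int \<Rightarrow> 'a set) \<Rightarrow> int \<Rightarrow> ('g \<Rightarrow> 'a) set" where
  "skew_part G P d = carrier G \<rightarrow>\<^sub>E P d"

definition skew_incl ::
    "('c, 'a, 'm) module_scheme \<Rightarrow> ('g, 'h) monoid_scheme \<Rightarrow> 'a \<Rightarrow> 'g \<Rightarrow> 'a" where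
  "skew_incl A G a = (\<lambda>g\<in>carrier G. if g = \<one>\<^bsub>G\<^esub> then a else \<zero>\<^bsub>A\<^esub>)"

definition group_algebra :: "('g, 'h) monoid_scheme \<Rightarrow> (complex, 'g \<Rightarrow> complex) module" where
  "group_algebra G = skew_group_algebra complex_alg G (\<lambda>g c. c)"

definition group_algebra_incl ::
    "('c, 'a, 'm) module_scheme \<Rightarrow> ('g, 'h) monoid_scheme \<Rightarrow> ('g \<Rightarrow> 'c) \<Rightarrow> 'g \<Rightarrow> 'a" where
  "group_algebra_incl A G c = (\<lambda>g\<in>carrier G. c g \<odot>\<^bsub>A\<^esub> \<one>\<^bsub>A\<^esub>)"

abbreviation quantum_symmetric_skew ::
    "('g, 'h) monoid_scheme \<Rightarrow> nat \<Rightarrow> (nat \<Rightarrow> nat \<Rightarrow> complex)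
      \<Rightarrow> ('g \<Rightarrow> (nat list \<Rightarrow> complex) set \<Rightarrow> (nat list \<Rightarrow> complex) set)
      \<Rightarrow> (complex, 'g \<Rightarrow> (nat list \<Rightarrow> complex) set) module" where
  "quantum_symmetric_skew G n q \<alpha> \<equiv> skew_group_algebra (quantum_symmetric n q) G \<alpha>"

abbreviation skew_gen ::
    "('g, 'h) monoid_scheme \<Rightarrow> nat \<Rightarrow> (nat \<Rightarrow> nat \<Rightarrow> complex) \<Rightarrow> nat
      \<Rightarrow> 'g \<Rightarrow> (nat list \<Rightarrow> complex) set" where
  "skew_gen G n q i \<equiv> skew_incl (quantum_symmetric n q) G (q_gen n q i)"


text \<open>A linear map on \<open>R \<otimes> R\<close> is given as a bilinear map on \<open>R\<close>.\<close>

definition bilinear_on :: "('c, 'a, 'm) module_scheme \<Rightarrow> ('a \<Rightarrow> 'a \<Rightarrow> 'a) \<Rightarrow> bool" where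
  "bilinear_on R \<mu> \<longleftrightarrow>
     (\<forall>r\<in>carrier R. \<forall>s\<in>carrier R. \<mu> r s \<in> carrier R)
     \<and> (\<forall>r\<in>carrier R. \<forall>s\<in>carrier R. \<forall>t\<in>carrier R.
          \<mu> (r \<oplus>\<^bsub>R\<^esub> s) t = \<mu> r t \<oplus>\<^bsub>R\<^esub> \<mu> s t \<and> \<mu> t (r \<oplus>\<^bsub>R\<^esub> s) = \<mu> t r \<oplus>\<^bsub>R\<^esub> \<mu> t s)
     \<and> (\<forall>c. \<forall>r\<in>carrier R. \<forall>s\<in>carrier R.
          \<mu> (c \<odot>\<^bsub>R\<^esub> r) s = c \<odot>\<^bsub>R\<^esub> \<mu> r s \<and> \<mu> r (c \<odot>\<^bsub>R\<^esub> s) = c \<odot>\<^bsub>R\<^esub> \<mu> r s)"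

definition hochschild_2_cocycle ::
    "('c, 'a, 'm) module_scheme \<Rightarrow> ('a \<Rightarrow> 'a \<Rightarrow> 'a) \<Rightarrow> bool" where
  "hochschild_2_cocycle R \<mu> \<longleftrightarrow>
     bilinear_on R \<mu>
     \<and> (\<forall>r\<in>carrier R. \<forall>s\<in>carrier R. \<forall>u\<in>carrier R.
          \<mu> r s \<otimes>\<^bsub>R\<^esub> u \<oplus>\<^bsub>R\<^esub> \<mu> (r \<otimes>\<^bsub>R\<^esub> s) u = \<mu> r (s \<otimes>\<^bsub>R\<^esub> u) \<oplus>\<^bsub>R\<^esub> r \<otimes>\<^bsub>R\<^esub> \<mu> s u)"

definition constant_hochschild_2_cocycle ::
    "('c, 'a, 'm) module_scheme \<Rightarrow> (int \<Rightarrow> 'a set) \<Rightarrow> ('a \<Rightarrow> 'a \<Rightarrow> 'a) \<Rightarrow> bool" where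
  "constant_hochschild_2_cocycle R gR \<mu> \<longleftrightarrow>
     hochschild_2_cocycle R \<mu>
     \<and> (\<forall>d e. \<forall>r\<in>gR d. \<forall>s\<in>gR e. \<mu> r s \<in> gR (d + e - 2))"

definition bilinear_from ::
    "(complex \<Rightarrow> 'v::ab_group_add \<Rightarrow> 'v) \<Rightarrow> (complex, 'b, 'm) module_scheme
      \<Rightarrow> ('v \<Rightarrow> 'v \<Rightarrow> 'b) \<Rightarrow> bool" where
  "bilinear_from scale M \<kappa> \<longleftrightarrow>
     (\<forall>x y. \<kappa> x y \<in> carrier M)
     \<and> (\<forall>x y z. \<kappa> (x + y) z = \<kappa> x z \<oplus>\<^bsub>M\<^esub> \<kappa> y z \<and> \<kappa> z (x + y) = \<kappa> z x \<oplus>\<^bsub>M\<^esub> \<kappa> z y)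
     \<and> (\<forall>c x y. \<kappa> (scale c x) y = c \<odot>\<^bsub>M\<^esub> \<kappa> x y \<and> \<kappa> x (scale c y) = c \<odot>\<^bsub>M\<^esub> \<kappa> x y)"


definition tensor_skew ::
    "('g, 'h) monoid_scheme \<Rightarrow> (complex \<Rightarrow> 'v::ab_group_add \<Rightarrow> 'v) \<Rightarrow> nat \<Rightarrow> (nat \<Rightarrow> 'v)
      \<Rightarrow> ('g \<Rightarrow> 'v \<Rightarrow> 'v) \<Rightarrow> (complex, 'g \<Rightarrow> nat list \<Rightarrow> complex) module" where
  "tensor_skew G scale n v \<rho> =
     skew_group_algebra (free_algebra n) G (tensor_action scale n v \<rho>)"

definition hecke_ideal ::
    "('g, 'h) monoid_scheme \<Rightarrow> (complex \<Rightarrow> 'v::ab_group_add \<Rightarrow> 'v) \<Rightarrow> nat \<Rightarrow> (nat \<Rightarrow> 'v)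
      \<Rightarrow> ('g \<Rightarrow> 'v \<Rightarrow> 'v) \<Rightarrow> (nat \<Rightarrow> nat \<Rightarrow> complex) \<Rightarrow> ('v \<Rightarrow> 'v \<Rightarrow> 'g \<Rightarrow> complex)
      \<Rightarrow> ('g \<Rightarrow> nat list \<Rightarrow> complex) set" where
  "hecke_ideal G scale n v \<rho> q \<kappa> =
     (let R = tensor_skew G scale n v \<rho>;
          x = (\<lambda>i. skew_incl (free_algebra n) G (free_gen i))
      in Idl\<^bsub>R\<^esub> {x i \<otimes>\<^bsub>R\<^esub> x j \<ominus>\<^bsub>R\<^esub> q i j \<odot>\<^bsub>R\<^esub> (x j \<otimes>\<^bsub>R\<^esub> x i)
                 \<ominus>\<^bsub>R\<^esub> group_algebra_incl (free_algebra n) G (\<kappa> (v i) (v j))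
               | i j. i \<in> {1..n} \<and> j \<in> {1..n}})"

definition hecke_algebra ::
    "('g, 'h) monoid_scheme \<Rightarrow> (complex \<Rightarrow> 'v::ab_group_add \<Rightarrow> 'v) \<Rightarrow> nat \<Rightarrow> (nat \<Rightarrow> 'v)
      \<Rightarrow> ('g \<Rightarrow> 'v \<Rightarrow> 'v) \<Rightarrow> (nat \<Rightarrow> nat \<Rightarrow> complex) \<Rightarrow> ('v \<Rightarrow> 'v \<Rightarrow> 'g \<Rightarrow> complex)
      \<Rightarrow> (complex, ('g \<Rightarrow> nat list \<Rightarrow> complex) set) module" where
  "hecke_algebra G scale n v \<rho> q \<kappa> =
     quotient_algebra (tensor_skew G scale n v \<rho>) (hecke_ideal G scale n v \<rho> q \<kappa>)"

text \<open>
  The generators \<open>v\<^sub>i\<close> have filtration degree \<open>1\<close> and the group elements degree \<open>0\<close>, so degree \<open>m\<close>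
  consists of the images of the elements whose words have length at most \<open>m\<close>.
\<close>

definition hecke_filtration ::
    "('g, 'h) monoid_scheme \<Rightarrow> (complex \<Rightarrow> 'v::ab_group_add \<Rightarrow> 'v) \<Rightarrow> nat \<Rightarrow> (nat \<Rightarrow> 'v)
      \<Rightarrow> ('g \<Rightarrow> 'v \<Rightarrow> 'v) \<Rightarrow> (nat \<Rightarrow> nat \<Rightarrow> complex) \<Rightarrow> ('v \<Rightarrow> 'v \<Rightarrow> 'g \<Rightarrow> complex)
      \<Rightarrow> int \<Rightarrow> ('g \<Rightarrow> nat list \<Rightarrow> complex) set set" where
  "hecke_filtration G scale n v \<rho> q \<kappa> =
     quotient_part (tensor_skew G scale n v \<rho>) (hecke_ideal G scale n v \<rho> q \<kappa>)
       (skew_part G (free_filtration n))"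

text \<open>\<open>\<alpha>\<close> is the action on the quantum symmetric algebra.\<close>

definition quantum_drinfeld_hecke ::
    "('g, 'h) monoid_scheme \<Rightarrow> (complex \<Rightarrow> 'v::ab_group_add \<Rightarrow> 'v) \<Rightarrow> nat \<Rightarrow> (nat \<Rightarrow> 'v)
      \<Rightarrow> ('g \<Rightarrow> 'v \<Rightarrow> 'v) \<Rightarrow> (nat \<Rightarrow> nat \<Rightarrow> complex)
      \<Rightarrow> ('g \<Rightarrow> (nat list \<Rightarrow> complex) set \<Rightarrow> (nat list \<Rightarrow> complex) set)
      \<Rightarrow> ('v \<Rightarrow> 'v \<Rightarrow> 'g \<Rightarrow> complex) \<Rightarrow> bool" where
  "quantum_drinfeld_hecke G scale n v \<rho> q \<alpha> \<kappa> \<longleftrightarrow>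
     bilinear_from scale (group_algebra G) \<kappa>
     \<and> (\<forall>i\<in>{1..n}. \<forall>j\<in>{1..n}.
          \<kappa> (v i) (v j) = (- q i j) \<odot>\<^bsub>group_algebra G\<^esub> \<kappa> (v j) (v i))
     \<and> graded_algebra_isomorphic
         (associated_graded (hecke_algebra G scale n v \<rho> q \<kappa>)
            (hecke_filtration G scale n v \<rho> q \<kappa>))
         (associated_graded_part (hecke_algebra G scale n v \<rho> q \<kappa>)
            (hecke_filtration G scale n v \<rho> q \<kappa>))
         (quantum_symmetric_skew G n q \<alpha>)
         (skew_part G (q_grade n q))"

end

theory Submission
  imports Defs
begin

text \<open>
  Let \<open>T\<close> be the free algebra, \<open>J\<close> the ideal of the relations \<open>v\<^sub>i v\<^sub>j = q\<^sub>i\<^sub>j v\<^sub>j v\<^sub>i\<close>,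
  \<open>S = T / J\<close> the quantum symmetric algebra, \<open>E = T \<rtimes> G\<close>, \<open>R = S \<rtimes> G\<close>, and \<open>I\<close> the ideal of \<open>E\<close>
  with \<open>H = E / I\<close>.  The leading terms of the generators of \<open>I\<close> generate \<open>J \<rtimes> G\<close>, so
  the associated graded algebra of \<open>H\<close> is a quotient of \<open>R\<close>.  It is equal to \<open>R\<close> as soon
  as \<open>I\<close> has no further leading terms: if \<open>f \<in> I\<close> has degree at most \<open>m\<close>, then the component
  of \<open>f\<close> of degree \<open>m\<close> has all its coefficients in \<open>J\<close>.

  The cocycle supplies two linear identities for \<open>\<kappa>\<close>.  As \<open>\<mu>\<close> lowers degrees by two,
  \<open>\<mu> (g, v) = \<mu> (v, g) = 0\<close> for \<open>g \<in> G\<close> and \<open>v \<in> V\<close>.  The cocycle identities for \<open>(g, v, w)\<close>,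
  \<open>(v, g, w)\<close> and \<open>(v, w, g)\<close>, summed along a relation of \<open>S\<close>, then say that \<open>\<kappa>\<close> is equivariant
  (\<open>K_equivariance\<close>); this makes sense because \<open>G\<close> acts on \<open>S\<close> and therefore preserves the space
  of relations.  The cocycle identities for triples of letters, summed along the element of
  \<open>Rel \<otimes> V \<inter> V \<otimes> Rel\<close> that belongs to three letters, give a Jacobi identity
  (\<open>K_jacobi_identity\<close>): the terms in which \<open>\<mu>\<close> is applied to a product add up to the value of \<open>\<mu>\<close> at a
  relation, which is zero.  There is no condition that is quadratic in \<open>\<kappa>\<close>, since the values
  of \<open>\<kappa>\<close> lie in degree 0 and cannot be straightened further.

  From these identities the theorem of Poincare, Birkhoff and Witt follows by the diamond lemma,
  used in a dual form.  A linear functional on \<open>E\<close> is a family of numbers \<open>c w g\<close>, indexed by words and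
  group elements.  If it satisfies the relation of \<open>H\<close> at every place of every word, it
  vanishes on \<open>I\<close> (\<open>pairing_hecke\<close>).  The values of \<open>c\<close> at the sorted words can be prescribed
  freely: the other values are computed by straightening the first descent, and the
  relations at the remaining places follow by induction on length and number of inversions
  (\<open>solves_sol\<close>).  Two descents without a common letter are interchangeable by equivariance
  (\<open>compat_disjoint\<close>), two descents that share a letter by the Jacobi identity (\<open>compat_overlap\<close>).

  Now let \<open>f \<in> I\<close> have degree at most \<open>m\<close>.  Modulo \<open>J\<close> its leading component is a combination of sorted
  words of length \<open>m\<close>.  The functional that is 1 at one product of a sorted word and a group
  element and 0 at all others vanishes on \<open>I\<close> and on everything of degree less than \<open>m\<close>, so it reads off a coefficient
  of this combination and shows that it is zero (\<open>lower_J\<close>).  Consequently the symbol map from \<open>E\<close> to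
  the associated graded algebra of \<open>H\<close> and the projection from \<open>E\<close> to \<open>R\<close> have the same fibres,
  and both are surjective and graded, which gives the isomorphism
  (\<open>associated_graded_isomorphic\<close>).
\<close>

section \<open>Algebras over a commutative ring of scalars\<close>

text \<open>
  The ring need not be commutative, so the axioms have to say on both sides that scalars are
  central.
\<close>

locale algebra_over = ring A for A :: "('c::comm_ring_1, 'a, 'm) module_scheme" (structure) +
  assumes smult_closed [simp, intro]: "x \<in> carrier A \<Longrightarrow> c \<odot> x \<in> carrier A"
    and smult_l_distr: "x \<in> carrier A \<Longrightarrow> (c + d) \<odot> x = c \<odot> x \<oplus> d \<odot> x"
    and smult_r_distr: "x \<in> carrier A \<Longrightarrow> y \<in> carrier A \<Longrightarrow> c \<odot> (x \<oplus> y) = c \<odot> x \<oplus> c \<odot> y"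
    and smult_smult: "x \<in> carrier A \<Longrightarrow> (c * d) \<odot> x = c \<odot> (d \<odot> x)"
    and smult_one [simp]: "x \<in> carrier A \<Longrightarrow> 1 \<odot> x = x"
    and smult_m_assoc: "x \<in> carrier A \<Longrightarrow> y \<in> carrier A \<Longrightarrow> (c \<odot> x) \<otimes> y = c \<odot> (x \<otimes> y)"
    and m_smult_assoc: "x \<in> carrier A \<Longrightarrow> y \<in> carrier A \<Longrightarrow> x \<otimes> (c \<odot> y) = c \<odot> (x \<otimes> y)"
begin

lemma smult_zero_right [simp]: "c \<odot> \<zero> = \<zero>"
proof -
  have "c \<odot> \<zero> \<oplus> c \<odot> \<zero> = c \<odot> \<zero>"
    using smult_r_distr[of \<zero> \<zero> c] by simp
  thus ?thesis using add.l_cancel_one[of "c \<odot> \<zero>" "c \<odot> \<zero>"] by simp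
qed

lemma smult_zero_left [simp]: "x \<in> carrier A \<Longrightarrow> 0 \<odot> x = \<zero>"
proof -
  assume x: "x \<in> carrier A"
  have "0 \<odot> x \<oplus> 0 \<odot> x = 0 \<odot> x" using smult_l_distr[OF x, of 0 0] by simp
  thus ?thesis using add.l_cancel_one[of "0 \<odot> x" "0 \<odot> x"] x by simp
qed

lemma smult_uminus_left: "x \<in> carrier A \<Longrightarrow> (- c) \<odot> x = \<ominus> (c \<odot> x)"
  using smult_l_distr[of x "- c" c] by (simp add: minus_equality)

lemma smult_a_minus: "x \<in> carrier A \<Longrightarrow> y \<in> carrier A \<Longrightarrow> c \<odot> (x \<ominus> y) = c \<odot> x \<ominus> c \<odot> y"
  using smult_uminus_left[of y 1] smult_uminus_left[of y c] smult_smult[of y c "- 1"]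
  by (simp add: minus_eq smult_r_distr)

lemma a_minus_eq_zeroD:
  assumes "x \<ominus> y = \<zero>" "x \<in> carrier A" "y \<in> carrier A"
  shows "x = y"
proof -
  have "x = (x \<ominus> y) \<oplus> y" using assms(2,3) by (simp add: a_minus_def a_assoc l_neg)
  thus ?thesis using assms by simp
qed

lemma minus_eq_smult: "x \<in> carrier A \<Longrightarrow> \<ominus> x = (- 1) \<odot> x"
  by (simp add: smult_uminus_left)

lemma smult_finsum:
  "finite S \<Longrightarrow> f \<in> S \<rightarrow> carrier A \<Longrightarrow> c \<odot> (\<Oplus>i\<in>S. f i) = (\<Oplus>i\<in>S. c \<odot> f i)"
  by (induction S rule: finite_induct) (auto simp: smult_r_distr Pi_def)

text \<open>
  Membership of finite sums in ideals, in filtration steps and in all other subsets that are closed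
  under addition.
\<close>

lemma finsum_closed_subset:
  assumes "finite S" "\<And>i. i \<in> S \<Longrightarrow> f i \<in> X" "X \<subseteq> carrier A" "\<zero> \<in> X"
    "\<And>x y. x \<in> X \<Longrightarrow> y \<in> X \<Longrightarrow> x \<oplus> y \<in> X"
  shows "(\<Oplus>i\<in>S. f i) \<in> X"
  using assms(1,2)
proof (induction S rule: finite_induct)
  case (insert s S)
  hence "(\<Oplus>i\<in>insert s S. f i) = f s \<oplus> (\<Oplus>i\<in>S. f i)"
    using assms(3) by (intro finsum_insert) auto
  thus ?case using insert assms(5) by auto
qed (use assms in auto)

text \<open>
  Closure under negation comes for free, because negation is multiplication by \<open>\<ominus> \<one>\<close>.
\<close>

lemma idealI':
  assumes "I \<subseteq> carrier A" "\<zero> \<in> I" "\<And>x y. x \<in> I \<Longrightarrow> y \<in> I \<Longrightarrow> x \<oplus> y \<in> I"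
    "\<And>x y. x \<in> I \<Longrightarrow> y \<in> carrier A \<Longrightarrow> x \<otimes> y \<in> I"
    "\<And>x y. x \<in> I \<Longrightarrow> y \<in> carrier A \<Longrightarrow> y \<otimes> x \<in> I"
  shows "ideal I A"
proof (rule idealI)
  show "subgroup I (add_monoid A)"
  proof (rule add.subgroupI)
    fix a assume a: "a \<in> I"
    have "a \<otimes> (\<ominus> \<one>) \<in> I" using assms a by auto
    moreover have "a \<otimes> (\<ominus> \<one>) = \<ominus> a" using a assms(1) by (auto simp: r_minus)
    ultimately show "\<ominus> a \<in> I" by simp
  qed (use assms in auto)
qed (use assms ring_axioms in auto)

text \<open>
  Scaling by \<open>c\<close> is multiplication by \<open>c \<odot> \<one>\<close>; this makes the scalar multiplication of cosets
  well defined.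
\<close>

lemma ideal_smult_closed:
  assumes "ideal I A" "x \<in> I"
  shows "c \<odot> x \<in> I"
proof -
  interpret ideal I A by fact
  have "x \<in> carrier A" using assms(2) a_subset by auto
  hence "(c \<odot> \<one>) \<otimes> x = c \<odot> x" by (simp add: smult_m_assoc)
  thus ?thesis using I_l_closed[of x "c \<odot> \<one>"] assms(2) by auto
qed

lemma finsum_swap:
  assumes "finite S" "finite U" "\<And>i j. i \<in> S \<Longrightarrow> j \<in> U \<Longrightarrow> f i j \<in> carrier A"
  shows "(\<Oplus>i\<in>S. \<Oplus>j\<in>U. f i j) = (\<Oplus>j\<in>U. \<Oplus>i\<in>S. f i j)"
  using assms(1,3)
proof (induction S rule: finite_induct)
  case empty
  thus ?case by simp
next
  case (insert s S)
  have "(\<Oplus>i\<in>insert s S. \<Oplus>j\<in>U. f i j) = (\<Oplus>j\<in>U. f s j) \<oplus> (\<Oplus>i\<in>S. \<Oplus>j\<in>U. f i j)"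
    using insert by (intro finsum_insert) (auto intro!: finsum_closed)
  also have "\<dots> = (\<Oplus>j\<in>U. f s j) \<oplus> (\<Oplus>j\<in>U. \<Oplus>i\<in>S. f i j)" using insert by simp
  also have "\<dots> = (\<Oplus>j\<in>U. f s j \<oplus> (\<Oplus>i\<in>S. f i j))"
    using insert assms(2) by (intro finsum_addf[symmetric]) (auto intro!: finsum_closed)
  also have "\<dots> = (\<Oplus>j\<in>U. \<Oplus>i\<in>insert s S. f i j)"
    using insert by (intro finsum_cong' refl finsum_insert[symmetric]) (auto intro!: finsum_closed)
  finally show ?case .
qed

end

lemma algebra_isoD:
  assumes "\<phi> \<in> algebra_iso A B"
  shows "x \<in> carrier A \<Longrightarrow> \<phi> x \<in> carrier B"
    "x \<in> carrier A \<Longrightarrow> y \<in> carrier A \<Longrightarrow> \<phi> (x \<otimes>\<^bsub>A\<^esub> y) = \<phi> x \<otimes>\<^bsub>B\<^esub> \<phi> y"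
    "x \<in> carrier A \<Longrightarrow> y \<in> carrier A \<Longrightarrow> \<phi> (x \<oplus>\<^bsub>A\<^esub> y) = \<phi> x \<oplus>\<^bsub>B\<^esub> \<phi> y"
    "\<phi> \<one>\<^bsub>A\<^esub> = \<one>\<^bsub>B\<^esub>"
    "x \<in> carrier A \<Longrightarrow> \<phi> (c \<odot>\<^bsub>A\<^esub> x) = c \<odot>\<^bsub>B\<^esub> \<phi> x"
    "bij_betw \<phi> (carrier A) (carrier B)"
  using assms by (auto simp: algebra_iso_def ring_iso_def ring_hom_def)

section \<open>Quotient algebras\<close>

lemma quotient_algebra_simps [simp]:
  "mult (quotient_algebra A I) = mult (A Quot I)"
  "one (quotient_algebra A I) = one (A Quot I)"
  "zero (quotient_algebra A I) = zero (A Quot I)"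
  "add (quotient_algebra A I) = add (A Quot I)"
  "carrier (quotient_algebra A I) = carrier (A Quot I)"
  "smult (quotient_algebra A I) = (\<lambda>c X. \<Union>x\<in>X. I +>\<^bsub>A\<^esub> (c \<odot>\<^bsub>A\<^esub> x))"
  by (simp_all add: quotient_algebra_def ring.defs module.defs)

lemma ring_cong:
  assumes "ring R" "carrier S = carrier R" "mult S = mult R" "one S = one R"
    "zero S = zero R" "add S = add R"
  shows "ring S"
proof -
  interpret R: ring R by fact
  show ?thesis
  proof (rule ringI)
    show "abelian_group S"
      by (rule abelian_groupI) (use assms R.add.m_assoc R.add.m_comm R.add.l_inv_ex in auto)
    show "Group.monoid S"
      by (rule monoidI) (use assms R.m_assoc in auto)
  qed (use assms R.l_distr R.r_distr in auto)
qed

locale algebra_ideal = algebra_over A + I: ideal I A for A (structure) and I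
begin

abbreviation Q where "Q \<equiv> quotient_algebra A I"

abbreviation proj where "proj x \<equiv> I +> x"

lemma proj_closed [simp, intro]: "x \<in> carrier A \<Longrightarrow> proj x \<in> carrier Q"
  by (auto simp: FactRing_simps)

lemma carrier_quotient: "carrier Q = proj ` carrier A"
  by (auto simp: FactRing_simps)

lemma zero_quotient: "\<zero>\<^bsub>Q\<^esub> = I" "\<zero>\<^bsub>Q\<^esub> = proj \<zero>"
  by (auto simp: FactRing_def I.a_subset)

lemma proj_mult [simp]:
  "x \<in> carrier A \<Longrightarrow> y \<in> carrier A \<Longrightarrow> proj x \<otimes>\<^bsub>Q\<^esub> proj y = proj (x \<otimes> y)"
  by (simp add: FactRing_def I.rcoset_mult_add)

lemma proj_add [simp]:
  "x \<in> carrier A \<Longrightarrow> y \<in> carrier A \<Longrightarrow> proj x \<oplus>\<^bsub>Q\<^esub> proj y = proj (x \<oplus> y)"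
  by (simp add: FactRing_def I.a_rcos_sum)

lemma proj_one: "\<one>\<^bsub>Q\<^esub> = proj \<one>"
  by (simp add: FactRing_def)

lemma proj_mem_iff:
  assumes x: "x \<in> carrier A"
  shows "y \<in> proj x \<longleftrightarrow> y \<in> carrier A \<and> y \<ominus> x \<in> I"
proof
  assume "y \<in> proj x"
  then obtain i where i: "i \<in> I" "y = i \<oplus> x"
    by (auto simp: a_r_coset_def r_coset_def)
  have "i \<in> carrier A" using i I.a_subset by auto
  hence "y \<ominus> x = i" using x i by (simp add: minus_eq a_assoc r_neg)
  thus "y \<in> carrier A \<and> y \<ominus> x \<in> I" using i x \<open>i \<in> carrier A\<close> by simp
next
  assume y: "y \<in> carrier A \<and> y \<ominus> x \<in> I"
  hence "y = (y \<ominus> x) \<oplus> x" using x by (simp add: minus_eq a_assoc l_neg)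
  thus "y \<in> proj x" using y by (auto simp: a_r_coset_def r_coset_def)
qed

lemma proj_eq_iff:
  assumes "x \<in> carrier A" "y \<in> carrier A"
  shows "proj x = proj y \<longleftrightarrow> x \<ominus> y \<in> I"
proof
  assume "proj x = proj y"
  thus "x \<ominus> y \<in> I" using I.a_rcos_self[of x] proj_mem_iff[of y x] assms by auto
next
  assume "x \<ominus> y \<in> I"
  hence "x \<in> proj y" using proj_mem_iff[of y x] assms by auto
  thus "proj x = proj y"
    using a_repr_independence[of x I y] assms I.a_subgroup by auto
qed

lemma proj_eq_zero_iff: "x \<in> carrier A \<Longrightarrow> proj x = I \<longleftrightarrow> x \<in> I"
  using proj_eq_iff[of x \<zero>] zero_quotient by (simp add: minus_eq)

lemma proj_smult [simp]:
  assumes "x \<in> carrier A"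
  shows "c \<odot>\<^bsub>Q\<^esub> proj x = proj (c \<odot> x)"
proof -
  have *: "proj (c \<odot> y) = proj (c \<odot> x)" if "y \<in> proj x" for y
  proof -
    have y: "y \<in> carrier A" "y \<ominus> x \<in> I" using proj_mem_iff that assms by auto
    have "c \<odot> y \<ominus> c \<odot> x = c \<odot> (y \<ominus> x)" using y assms by (simp add: smult_a_minus)
    thus ?thesis using y assms by (simp add: proj_eq_iff ideal_smult_closed[OF I.is_ideal])
  qed
  have "(\<Union>y\<in>proj x. proj (c \<odot> y)) = proj (c \<odot> x)"
    using I.a_rcos_self[OF assms] * by (intro UN_constant_eq ballI)
  thus ?thesis by (simp only: quotient_algebra_simps)
qed

sublocale Q: algebra_over Q
proof (rule algebra_over.intro)
  show "ring Q" by (rule ring_cong[OF I.quotient_is_ring]) auto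
  show "algebra_over_axioms Q"
    by (rule algebra_over_axioms.intro; unfold carrier_quotient)
      (auto simp del: quotient_algebra_simps
        simp: smult_l_distr smult_r_distr smult_smult smult_m_assoc m_smult_assoc)
qed

declare quotient_algebra_simps [simp del]

lemma proj_finsum:
  "finite S \<Longrightarrow> f \<in> S \<rightarrow> carrier A \<Longrightarrow> proj (\<Oplus>i\<in>S. f i) = (\<Oplus>\<^bsub>Q\<^esub>i\<in>S. proj (f i))"
  by (induction S rule: finite_induct) (auto simp: Pi_def simp flip: proj_add zero_quotient(2))

end

declare quotient_algebra_simps [simp del]

section \<open>Skew group algebras\<close>

text \<open>
  Surjectivity of maps between skew group algebras that act on each coefficient separately.
\<close>

lemma PiE_pointwise_image:
  "(\<lambda>x. \<lambda>g\<in>I. f (x g)) ` (I \<rightarrow>\<^sub>E A) = I \<rightarrow>\<^sub>E f ` A"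
proof (intro equalityI subsetI)
  fix y assume y: "y \<in> I \<rightarrow>\<^sub>E f ` A"
  hence "\<forall>g\<in>I. \<exists>a. a \<in> A \<and> y g = f a" by blast
  from bchoice[OF this] obtain a where a: "\<forall>g\<in>I. a g \<in> A \<and> y g = f (a g)" by blast
  have "y = (\<lambda>g\<in>I. f ((\<lambda>g\<in>I. a g) g))"
    using a PiE_iff[of y I "\<lambda>_. f ` A"] y by (intro extensionalityI[of y I]) auto
  moreover have "(\<lambda>g\<in>I. a g) \<in> I \<rightarrow>\<^sub>E A" using a by auto
  ultimately show "y \<in> (\<lambda>x. \<lambda>g\<in>I. f (x g)) ` (I \<rightarrow>\<^sub>E A)" by (rule image_eqI)
qed auto

locale skew_setting = algebra_over A + G: group G
  for A :: "('c::comm_ring_1, 'a, 'm) module_scheme" (structure)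
    and G :: "('g, 'h) monoid_scheme" and \<alpha> :: "'g \<Rightarrow> 'a \<Rightarrow> 'a" +
  assumes finite_group: "finite (carrier G)"
    and acts: "acts_by_automorphisms G A \<alpha>"
begin

lemma act_iso: "g \<in> carrier G \<Longrightarrow> \<alpha> g \<in> algebra_iso A A"
  using acts by (simp add: acts_by_automorphisms_def)

lemma act_closed [simp, intro]: "g \<in> carrier G \<Longrightarrow> x \<in> carrier A \<Longrightarrow> \<alpha> g x \<in> carrier A"
  using algebra_isoD(1)[OF act_iso] .

lemma act_mult:
  "g \<in> carrier G \<Longrightarrow> x \<in> carrier A \<Longrightarrow> y \<in> carrier A \<Longrightarrow> \<alpha> g (x \<otimes> y) = \<alpha> g x \<otimes> \<alpha> g y"
  using algebra_isoD(2)[OF act_iso] .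

lemma act_add:
  "g \<in> carrier G \<Longrightarrow> x \<in> carrier A \<Longrightarrow> y \<in> carrier A \<Longrightarrow> \<alpha> g (x \<oplus> y) = \<alpha> g x \<oplus> \<alpha> g y"
  using algebra_isoD(3)[OF act_iso] .

lemma act_one [simp]: "g \<in> carrier G \<Longrightarrow> \<alpha> g \<one> = \<one>"
  using algebra_isoD(4)[OF act_iso] .

lemma act_smult: "g \<in> carrier G \<Longrightarrow> x \<in> carrier A \<Longrightarrow> \<alpha> g (c \<odot> x) = c \<odot> \<alpha> g x"
  using algebra_isoD(5)[OF act_iso] .

lemma act_zero [simp]: "g \<in> carrier G \<Longrightarrow> \<alpha> g \<zero> = \<zero>"
  using act_smult[of g \<zero> 0] by simp

lemma act_id [simp]: "x \<in> carrier A \<Longrightarrow> \<alpha> \<one>\<^bsub>G\<^esub> x = x"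
  using group_action.id_eq_one[of G "carrier A" \<alpha>] acts
  by (metis acts_by_automorphisms_def restrict_apply')

lemma act_comp:
  "g \<in> carrier G \<Longrightarrow> h \<in> carrier G \<Longrightarrow> x \<in> carrier A \<Longrightarrow> \<alpha> (g \<otimes>\<^bsub>G\<^esub> h) x = \<alpha> g (\<alpha> h x)"
  using group_action.composition_rule[of G "carrier A" \<alpha>] acts
  by (simp add: acts_by_automorphisms_def)

lemma act_finsum:
  assumes "g \<in> carrier G"
  shows "finite S \<Longrightarrow> f \<in> S \<rightarrow> carrier A \<Longrightarrow> \<alpha> g (\<Oplus>i\<in>S. f i) = (\<Oplus>i\<in>S. \<alpha> g (f i))"
  by (induction S rule: finite_induct) (use assms in \<open>auto simp: act_add Pi_def\<close>)

abbreviation B where "B \<equiv> skew_group_algebra A G \<alpha>"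

definition single where
  "single a g = (\<lambda>k\<in>carrier G. if k = g then a else \<zero>)"

lemma skew_incl_eq_single: "skew_incl A G a = single a \<one>\<^bsub>G\<^esub>"
  by (simp add: skew_incl_def single_def)

lemma carrier_skew: "carrier B = carrier G \<rightarrow>\<^sub>E carrier A"
  by (simp add: skew_group_algebra_def)

lemma skew_apply [simp]: "f \<in> carrier B \<Longrightarrow> k \<in> carrier G \<Longrightarrow> f k \<in> carrier A"
  by (auto simp: carrier_skew)

lemma skew_eqI:
  assumes "f \<in> carrier B" "f' \<in> carrier B" "\<And>k. k \<in> carrier G \<Longrightarrow> f k = f' k"
  shows "f = f'"
  using assms by (auto simp: carrier_skew PiE_def intro: extensionalityI)

lemma skew_mult_apply: "k \<in> carrier G \<Longrightarrow>
    (f \<otimes>\<^bsub>B\<^esub> f') k = (\<Oplus>g\<in>carrier G. f g \<otimes> \<alpha> g (f' (inv\<^bsub>G\<^esub> g \<otimes>\<^bsub>G\<^esub> k)))"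
  by (simp add: skew_group_algebra_def)

lemma skew_add_apply [simp]: "k \<in> carrier G \<Longrightarrow> (f \<oplus>\<^bsub>B\<^esub> f') k = f k \<oplus> f' k"
  by (simp add: skew_group_algebra_def)

lemma skew_smult_apply [simp]: "k \<in> carrier G \<Longrightarrow> (c \<odot>\<^bsub>B\<^esub> f) k = c \<odot> f k"
  by (simp add: skew_group_algebra_def)

lemma skew_zero_apply [simp]: "k \<in> carrier G \<Longrightarrow> \<zero>\<^bsub>B\<^esub> k = \<zero>"
  by (simp add: skew_group_algebra_def)

lemma skew_one_eq: "\<one>\<^bsub>B\<^esub> = single \<one> \<one>\<^bsub>G\<^esub>"
  by (simp add: skew_group_algebra_def single_def)

lemma single_apply: "k \<in> carrier G \<Longrightarrow> single a g k = (if k = g then a else \<zero>)"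
  by (simp add: single_def)

lemma single_closed [simp, intro]: "a \<in> carrier A \<Longrightarrow> single a g \<in> carrier B"
  by (auto simp: single_def carrier_skew)

lemma skew_mult_closed [simp, intro]:
  "f \<in> carrier B \<Longrightarrow> f' \<in> carrier B \<Longrightarrow> f \<otimes>\<^bsub>B\<^esub> f' \<in> carrier B"
  by (auto simp: carrier_skew skew_group_algebra_def PiE_iff intro!: finsum_closed)

lemma skew_add_closed [simp, intro]:
  "f \<in> carrier B \<Longrightarrow> f' \<in> carrier B \<Longrightarrow> f \<oplus>\<^bsub>B\<^esub> f' \<in> carrier B"
  by (auto simp: carrier_skew skew_group_algebra_def PiE_iff)

lemma skew_smult_closed [simp, intro]:
  "f \<in> carrier B \<Longrightarrow> c \<odot>\<^bsub>B\<^esub> f \<in> carrier B"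
  by (auto simp: carrier_skew skew_group_algebra_def PiE_iff)

lemma skew_zero_closed [simp, intro]: "\<zero>\<^bsub>B\<^esub> \<in> carrier B"
  by (auto simp: carrier_skew skew_group_algebra_def)

lemma skew_one_closed [simp, intro]: "\<one>\<^bsub>B\<^esub> \<in> carrier B"
  by (auto simp: skew_one_eq)

lemma single_mult_apply:
  assumes "a \<in> carrier A" "g \<in> carrier G" "f \<in> carrier B" "k \<in> carrier G"
  shows "(single a g \<otimes>\<^bsub>B\<^esub> f) k = a \<otimes> \<alpha> g (f (inv\<^bsub>G\<^esub> g \<otimes>\<^bsub>G\<^esub> k))"
proof -
  have "(single a g \<otimes>\<^bsub>B\<^esub> f) k
      = (\<Oplus>h\<in>carrier G. if g = h then a \<otimes> \<alpha> h (f (inv\<^bsub>G\<^esub> h \<otimes>\<^bsub>G\<^esub> k)) else \<zero>)"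
    unfolding skew_mult_apply[OF assms(4)]
    using assms by (intro finsum_cong') (auto simp: single_apply)
  also have "\<dots> = a \<otimes> \<alpha> g (f (inv\<^bsub>G\<^esub> g \<otimes>\<^bsub>G\<^esub> k))"
    using assms finite_group
    by (intro finsum_singleton[of g "carrier G" "\<lambda>h. a \<otimes> \<alpha> h (f (inv\<^bsub>G\<^esub> h \<otimes>\<^bsub>G\<^esub> k))"]) auto
  finally show ?thesis .
qed

lemma mult_single_apply:
  assumes "b \<in> carrier A" "h \<in> carrier G" "f \<in> carrier B" "k \<in> carrier G"
  shows "(f \<otimes>\<^bsub>B\<^esub> single b h) k = f (k \<otimes>\<^bsub>G\<^esub> inv\<^bsub>G\<^esub> h) \<otimes> \<alpha> (k \<otimes>\<^bsub>G\<^esub> inv\<^bsub>G\<^esub> h) b"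
proof -
  have eq: "inv\<^bsub>G\<^esub> g \<otimes>\<^bsub>G\<^esub> k = h \<longleftrightarrow> k \<otimes>\<^bsub>G\<^esub> inv\<^bsub>G\<^esub> h = g" if "g \<in> carrier G" for g
    using that assms by (metis G.inv_solve_left G.inv_solve_right)
  have "(f \<otimes>\<^bsub>B\<^esub> single b h) k
      = (\<Oplus>g\<in>carrier G. if k \<otimes>\<^bsub>G\<^esub> inv\<^bsub>G\<^esub> h = g then f g \<otimes> \<alpha> g b else \<zero>)"
    unfolding skew_mult_apply[OF assms(4)]
    using assms by (intro finsum_cong') (auto simp: single_apply eq)
  also have "\<dots> = f (k \<otimes>\<^bsub>G\<^esub> inv\<^bsub>G\<^esub> h) \<otimes> \<alpha> (k \<otimes>\<^bsub>G\<^esub> inv\<^bsub>G\<^esub> h) b"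
    using assms finite_group
    by (intro finsum_singleton[of "k \<otimes>\<^bsub>G\<^esub> inv\<^bsub>G\<^esub> h" "carrier G" "\<lambda>g. f g \<otimes> \<alpha> g b"]) auto
  finally show ?thesis .
qed

lemma single_mult_single:
  assumes "a \<in> carrier A" "b \<in> carrier A" "g \<in> carrier G" "h \<in> carrier G"
  shows "single a g \<otimes>\<^bsub>B\<^esub> single b h = single (a \<otimes> \<alpha> g b) (g \<otimes>\<^bsub>G\<^esub> h)"
proof (rule skew_eqI)
  fix k assume k: "k \<in> carrier G"
  have eq: "inv\<^bsub>G\<^esub> g \<otimes>\<^bsub>G\<^esub> k = h \<longleftrightarrow> k = g \<otimes>\<^bsub>G\<^esub> h"
    using assms k by (metis G.inv_solve_left)
  show "(single a g \<otimes>\<^bsub>B\<^esub> single b h) k = single (a \<otimes> \<alpha> g b) (g \<otimes>\<^bsub>G\<^esub> h) k"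
    using assms k by (simp add: single_mult_apply single_apply eq)
qed (use assms in auto)

text \<open>
  Both sides are the same double sum over \<open>h\<close> and \<open>g\<close>, where \<open>g\<close> stands for the product of the
  first two group elements; on the right it arises from the inner sum by the substitution
  \<open>g \<rightarrow> h g\<close>.
\<close>

lemma skew_assoc:
  assumes f: "f \<in> carrier B" "f' \<in> carrier B" "f'' \<in> carrier B"
  shows "f \<otimes>\<^bsub>B\<^esub> f' \<otimes>\<^bsub>B\<^esub> f'' = f \<otimes>\<^bsub>B\<^esub> (f' \<otimes>\<^bsub>B\<^esub> f'')"
proof (rule skew_eqI)
  fix k assume k: "k \<in> carrier G"
  define F where "F h g = f h \<otimes> (\<alpha> h (f' (inv\<^bsub>G\<^esub> h \<otimes>\<^bsub>G\<^esub> g)) \<otimes> \<alpha> g (f'' (inv\<^bsub>G\<^esub> g \<otimes>\<^bsub>G\<^esub> k)))" for h g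
  have Fc: "F h g \<in> carrier A" if "h \<in> carrier G" "g \<in> carrier G" for h g
    using that k f by (auto simp: F_def)
  have "(f \<otimes>\<^bsub>B\<^esub> f' \<otimes>\<^bsub>B\<^esub> f'') k = (\<Oplus>g\<in>carrier G. \<Oplus>h\<in>carrier G. F h g)"
    unfolding skew_mult_apply[OF k]
  proof (intro finsum_cong' refl)
    fix g assume g: "g \<in> carrier G"
    show "(f \<otimes>\<^bsub>B\<^esub> f') g \<otimes> \<alpha> g (f'' (inv\<^bsub>G\<^esub> g \<otimes>\<^bsub>G\<^esub> k)) = (\<Oplus>h\<in>carrier G. F h g)"
      unfolding skew_mult_apply[OF g] F_def
      using f g k finite_group by (subst finsum_ldistr) (auto intro!: finsum_cong' simp: m_assoc)
  qed (auto intro!: finsum_closed Fc)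
  also have "\<dots> = (\<Oplus>h\<in>carrier G. \<Oplus>g\<in>carrier G. F h g)"
    using finite_group Fc by (intro finsum_swap) auto
  also have "\<dots> = (f \<otimes>\<^bsub>B\<^esub> (f' \<otimes>\<^bsub>B\<^esub> f'')) k"
    unfolding skew_mult_apply[OF k]
  proof (intro finsum_cong' refl)
    fix h assume h: "h \<in> carrier G"
    have hk: "inv\<^bsub>G\<^esub> h \<otimes>\<^bsub>G\<^esub> k \<in> carrier G" using h k by auto
    have inj: "inj_on (\<lambda>g. h \<otimes>\<^bsub>G\<^esub> g) (carrier G)" using h by (simp add: inj_on_def)
    have im: "(\<lambda>g. h \<otimes>\<^bsub>G\<^esub> g) ` carrier G = carrier G"
      using h by (rule G.surj_const_mult)
    have "(\<Oplus>g\<in>carrier G. F h g) = (\<Oplus>g\<in>(\<lambda>g. h \<otimes>\<^bsub>G\<^esub> g) ` carrier G. F h g)"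
      by (simp add: im)
    also have "\<dots> = (\<Oplus>g\<in>carrier G. F h (h \<otimes>\<^bsub>G\<^esub> g))"
      using Fc h by (intro finsum_reindex inj) auto
    also have "\<dots> = f h \<otimes> \<alpha> h (\<Oplus>g\<in>carrier G. f' g \<otimes> \<alpha> g (f'' (inv\<^bsub>G\<^esub> g \<otimes>\<^bsub>G\<^esub> (inv\<^bsub>G\<^esub> h \<otimes>\<^bsub>G\<^esub> k))))"
      using f h k finite_group
      by (subst act_finsum, simp, simp, simp, subst finsum_rdistr)
        (auto intro!: finsum_cong' simp: F_def act_mult act_comp G.inv_mult_group G.m_assoc
          G.inv_solve_left[symmetric] simp flip: G.m_assoc[of "inv\<^bsub>G\<^esub> h" h])
    also have "\<dots> = f h \<otimes> \<alpha> h ((f' \<otimes>\<^bsub>B\<^esub> f'') (inv\<^bsub>G\<^esub> h \<otimes>\<^bsub>G\<^esub> k))"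
      by (simp add: skew_mult_apply[OF hk])
    finally show "(\<Oplus>g\<in>carrier G. F h g) = f h \<otimes> \<alpha> h ((f' \<otimes>\<^bsub>B\<^esub> f'') (inv\<^bsub>G\<^esub> h \<otimes>\<^bsub>G\<^esub> k))" .
  qed (use f k in auto)
  finally show "(f \<otimes>\<^bsub>B\<^esub> f' \<otimes>\<^bsub>B\<^esub> f'') k = (f \<otimes>\<^bsub>B\<^esub> (f' \<otimes>\<^bsub>B\<^esub> f'')) k" .
qed (use f in auto)

lemma skew_algebra_over: "algebra_over B"
proof (rule algebra_over.intro)
  show "ring B"
  proof (rule ringI)
    show "abelian_group B"
    proof (rule abelian_groupI)
      fix x assume x: "x \<in> carrier B"
      show "\<exists>y\<in>carrier B. y \<oplus>\<^bsub>B\<^esub> x = \<zero>\<^bsub>B\<^esub>"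
        by (rule bexI[of _ "(- 1) \<odot>\<^bsub>B\<^esub> x"], rule skew_eqI)
          (use x in \<open>auto simp: l_neg simp flip: minus_eq_smult\<close>)
    qed (auto intro!: skew_eqI simp: a_ac)
    show "Group.monoid B"
    proof (rule monoidI)
      fix x assume x: "x \<in> carrier B"
      show "\<one>\<^bsub>B\<^esub> \<otimes>\<^bsub>B\<^esub> x = x"
        by (rule skew_eqI) (use x in \<open>auto simp: skew_one_eq single_mult_apply\<close>)
      show "x \<otimes>\<^bsub>B\<^esub> \<one>\<^bsub>B\<^esub> = x"
        by (rule skew_eqI) (use x in \<open>auto simp: skew_one_eq mult_single_apply\<close>)
    qed (auto simp: skew_assoc)
    fix x y z assume x: "x \<in> carrier B" "y \<in> carrier B" "z \<in> carrier B"
    show "(x \<oplus>\<^bsub>B\<^esub> y) \<otimes>\<^bsub>B\<^esub> z = x \<otimes>\<^bsub>B\<^esub> z \<oplus>\<^bsub>B\<^esub> y \<otimes>\<^bsub>B\<^esub> z"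
    proof (rule skew_eqI)
      fix k assume k: "k \<in> carrier G"
      show "((x \<oplus>\<^bsub>B\<^esub> y) \<otimes>\<^bsub>B\<^esub> z) k = (x \<otimes>\<^bsub>B\<^esub> z \<oplus>\<^bsub>B\<^esub> y \<otimes>\<^bsub>B\<^esub> z) k"
        unfolding skew_add_apply[OF k] skew_mult_apply[OF k] using x k
        by (intro trans[OF finsum_cong'[OF refl] finsum_addf]) (auto simp: l_distr)
    qed (use x in auto)
    show "z \<otimes>\<^bsub>B\<^esub> (x \<oplus>\<^bsub>B\<^esub> y) = z \<otimes>\<^bsub>B\<^esub> x \<oplus>\<^bsub>B\<^esub> z \<otimes>\<^bsub>B\<^esub> y"
    proof (rule skew_eqI)
      fix k assume k: "k \<in> carrier G"
      show "(z \<otimes>\<^bsub>B\<^esub> (x \<oplus>\<^bsub>B\<^esub> y)) k = (z \<otimes>\<^bsub>B\<^esub> x \<oplus>\<^bsub>B\<^esub> z \<otimes>\<^bsub>B\<^esub> y) k"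
        unfolding skew_add_apply[OF k] skew_mult_apply[OF k] using x k
        by (intro trans[OF finsum_cong'[OF refl] finsum_addf]) (auto simp: r_distr act_add)
    qed (use x in auto)
  qed
  show "algebra_over_axioms B"
  proof (rule algebra_over_axioms.intro)
    fix x y c assume x: "x \<in> carrier B" "y \<in> carrier B"
    show "(c \<odot>\<^bsub>B\<^esub> x) \<otimes>\<^bsub>B\<^esub> y = c \<odot>\<^bsub>B\<^esub> (x \<otimes>\<^bsub>B\<^esub> y)"
    proof (rule skew_eqI)
      fix k assume k: "k \<in> carrier G"
      show "((c \<odot>\<^bsub>B\<^esub> x) \<otimes>\<^bsub>B\<^esub> y) k = (c \<odot>\<^bsub>B\<^esub> (x \<otimes>\<^bsub>B\<^esub> y)) k"
        unfolding skew_smult_apply[OF k] skew_mult_apply[OF k] using x k finite_group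
        by (subst smult_finsum) (auto intro!: finsum_cong' simp: smult_m_assoc)
    qed (use x in auto)
    show "x \<otimes>\<^bsub>B\<^esub> (c \<odot>\<^bsub>B\<^esub> y) = c \<odot>\<^bsub>B\<^esub> (x \<otimes>\<^bsub>B\<^esub> y)"
    proof (rule skew_eqI)
      fix k assume k: "k \<in> carrier G"
      show "(x \<otimes>\<^bsub>B\<^esub> (c \<odot>\<^bsub>B\<^esub> y)) k = (c \<odot>\<^bsub>B\<^esub> (x \<otimes>\<^bsub>B\<^esub> y)) k"
        unfolding skew_smult_apply[OF k] skew_mult_apply[OF k] using x k finite_group
        by (subst smult_finsum) (auto intro!: finsum_cong' simp: m_smult_assoc act_smult)
    qed (use x in auto)
  qed (auto intro!: skew_eqI simp: smult_l_distr smult_r_distr smult_smult)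
qed

sublocale B: algebra_over B by (rule skew_algebra_over)

lemma skew_minus_apply [simp]:
  "f \<in> carrier B \<Longrightarrow> k \<in> carrier G \<Longrightarrow> (\<ominus>\<^bsub>B\<^esub> f) k = \<ominus> (f k)"
  by (simp add: B.minus_eq_smult minus_eq_smult)

lemma skew_a_minus_apply [simp]:
  "f \<in> carrier B \<Longrightarrow> f' \<in> carrier B \<Longrightarrow> k \<in> carrier G \<Longrightarrow> (f \<ominus>\<^bsub>B\<^esub> f') k = f k \<ominus> f' k"
  by (simp add: a_minus_def)

lemma skew_finsum_apply:
  assumes "k \<in> carrier G"
  shows "finite S \<Longrightarrow> f \<in> S \<rightarrow> carrier B \<Longrightarrow> (\<Oplus>\<^bsub>B\<^esub>i\<in>S. f i) k = (\<Oplus>i\<in>S. f i k)"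
  by (induction S rule: finite_induct) (use assms in \<open>auto simp: Pi_def\<close>)

lemma skew_eq_finsum_single:
  assumes f: "f \<in> carrier B"
  shows "f = (\<Oplus>\<^bsub>B\<^esub>g\<in>carrier G. single (f g) g)"
proof (rule skew_eqI)
  fix k assume k: "k \<in> carrier G"
  have "(\<Oplus>\<^bsub>B\<^esub>g\<in>carrier G. single (f g) g) k = (\<Oplus>g\<in>carrier G. if k = g then f g else \<zero>)"
    using f k finite_group by (subst skew_finsum_apply) (auto intro!: finsum_cong' simp: single_apply)
  also have "\<dots> = f k" using f k finite_group by (intro finsum_singleton) auto
  finally show "f k = (\<Oplus>\<^bsub>B\<^esub>g\<in>carrier G. single (f g) g) k" by simp
qed (use f in \<open>auto intro!: B.finsum_closed\<close>)

lemma single_add: "x \<in> carrier A \<Longrightarrow> y \<in> carrier A \<Longrightarrow> single (x \<oplus> y) g = single x g \<oplus>\<^bsub>B\<^esub> single y g"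
  by (rule skew_eqI) (auto simp: single_apply)

lemma single_smult: "x \<in> carrier A \<Longrightarrow> single (c \<odot> x) g = c \<odot>\<^bsub>B\<^esub> single x g"
  by (rule skew_eqI) (auto simp: single_apply)

lemma single_zero: "single \<zero> g = \<zero>\<^bsub>B\<^esub>"
  by (rule skew_eqI) (auto simp: single_apply)

lemma single_finsum:
  "finite S \<Longrightarrow> f \<in> S \<rightarrow> carrier A \<Longrightarrow> single (\<Oplus>i\<in>S. f i) g = (\<Oplus>\<^bsub>B\<^esub>i\<in>S. single (f i) g)"
  by (induction S rule: finite_induct) (auto simp: single_zero single_add Pi_def)

lemma single_a_minus:
  "x \<in> carrier A \<Longrightarrow> y \<in> carrier A
    \<Longrightarrow> single (x \<ominus> y) g = single x g \<ominus>\<^bsub>B\<^esub> single y g"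
  by (rule skew_eqI) (auto simp: single_apply minus_eq)

end

section \<open>The associated graded algebra of a quotient\<close>

text \<open>
  A grading is given by its projections \<open>cmp m\<close> to the components.  In this form the leading
  component of an element is available as a term.
\<close>

locale graded_over = algebra_over A for A :: "('c::comm_ring_1, 'a, 'm) module_scheme" (structure) +
  fixes cmp :: "nat \<Rightarrow> 'a \<Rightarrow> 'a"
  assumes cmp_closed [simp, intro]: "x \<in> carrier A \<Longrightarrow> cmp m x \<in> carrier A"
    and cmp_add: "x \<in> carrier A \<Longrightarrow> y \<in> carrier A \<Longrightarrow> cmp m (x \<oplus> y) = cmp m x \<oplus> cmp m y"
    and cmp_smult: "x \<in> carrier A \<Longrightarrow> cmp m (c \<odot> x) = c \<odot> cmp m x"
    and cmp_cmp: "x \<in> carrier A \<Longrightarrow> cmp m (cmp k x) = (if m = k then cmp m x else \<zero>)"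
    and cmp_finite: "x \<in> carrier A \<Longrightarrow> finite {m. cmp m x \<noteq> \<zero>}"
    and cmp_mult: "x \<in> carrier A \<Longrightarrow> y \<in> carrier A
      \<Longrightarrow> cmp m (x \<otimes> y) = (\<Oplus>i\<in>{..m}. cmp i x \<otimes> cmp (m - i) y)"
    and cmp_one: "cmp m \<one> = (if m = 0 then \<one> else \<zero>)"
begin

definition filt :: "int \<Rightarrow> 'a set" where
  "filt d = {x \<in> carrier A. \<forall>m. int m > d \<longrightarrow> cmp m x = \<zero>}"

definition grad :: "int \<Rightarrow> 'a set" where
  "grad d = {x \<in> carrier A. \<forall>m. int m \<noteq> d \<longrightarrow> cmp m x = \<zero>}"

lemma cmp_zero [simp]: "cmp m \<zero> = \<zero>"
  using cmp_smult[of \<zero> m 0] by simp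

lemma cmp_minus: "x \<in> carrier A \<Longrightarrow> cmp m (\<ominus> x) = \<ominus> cmp m x"
  by (simp add: minus_eq_smult cmp_smult)

lemma cmp_a_minus: "x \<in> carrier A \<Longrightarrow> y \<in> carrier A \<Longrightarrow> cmp m (x \<ominus> y) = cmp m x \<ominus> cmp m y"
  by (simp add: a_minus_def cmp_add cmp_minus)

lemma cmp_finsum:
  "finite S \<Longrightarrow> f \<in> S \<rightarrow> carrier A \<Longrightarrow> cmp m (\<Oplus>i\<in>S. f i) = (\<Oplus>i\<in>S. cmp m (f i))"
  by (induction S rule: finite_induct) (auto simp: cmp_add Pi_def)

lemma filt_closed [dest]: "x \<in> filt d \<Longrightarrow> x \<in> carrier A" by (auto simp: filt_def)

lemma filt_add: "x \<in> filt d \<Longrightarrow> y \<in> filt d \<Longrightarrow> x \<oplus> y \<in> filt d"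
  by (auto simp: filt_def cmp_add)

lemma filt_smult: "x \<in> filt d \<Longrightarrow> c \<odot> x \<in> filt d"
  by (auto simp: filt_def cmp_smult)

lemma filt_zero [simp]: "\<zero> \<in> filt d" by (auto simp: filt_def)

lemma cmp_in_filt: "x \<in> carrier A \<Longrightarrow> int m \<le> d \<Longrightarrow> cmp m x \<in> filt d"
  by (auto simp: filt_def cmp_cmp)

lemma filt_minus_cmp: "x \<in> filt (int m) \<Longrightarrow> x \<ominus> cmp m x \<in> filt (int m - 1)"
proof -
  assume x: "x \<in> filt (int m)"
  hence c: "x \<in> carrier A" by auto
  have "cmp k (x \<ominus> cmp m x) = \<zero>" if "int k > int m - 1" for k
  proof -
    have "cmp k (x \<ominus> cmp m x) = cmp k x \<ominus> cmp k (cmp m x)" using c by (simp add: cmp_a_minus)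
    thus ?thesis using x c that
      by (cases "k = m") (auto simp: cmp_cmp filt_def minus_eq r_neg)
  qed
  thus ?thesis using c by (auto simp: filt_def)
qed

lemma filt_mult:
  assumes "x \<in> filt a" "y \<in> filt b"
  shows "x \<otimes> y \<in> filt (a + b)"
proof -
  have c: "x \<in> carrier A" "y \<in> carrier A" using assms by auto
  have "cmp m (x \<otimes> y) = \<zero>" if m: "int m > a + b" for m
  proof -
    have "cmp i x \<otimes> cmp (m - i) y = \<zero>" if "i \<le> m" for i
    proof (cases "int i > a")
      case True thus ?thesis using assms c by (auto simp: filt_def)
    next
      case False
      hence "int (m - i) > b" using m that by linarith
      thus ?thesis using assms c by (auto simp: filt_def)
    qed
    hence "(\<Oplus>i\<in>{..m}. cmp i x \<otimes> cmp (m - i) y) = \<zero>"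
      by (intro trans[OF finsum_cong'[of _ _ "\<lambda>_. \<zero>"] finsum_zero]) auto
    thus ?thesis using c by (simp add: cmp_mult)
  qed
  thus ?thesis using c by (auto simp: filt_def)
qed

end

locale graded_ideal = graded_over A cmp + algebra_ideal A I
  for A :: "('c::comm_ring_1, 'a, 'm) module_scheme" (structure)
    and cmp :: "nat \<Rightarrow> 'a \<Rightarrow> 'a" and I :: "'a set"
begin

text \<open>
  The preimage \<open>I + F\<^sub>d\<close> of the \<open>d\<close>-th filtration step of the quotient.  All questions about cosets
  of cosets in the associated graded algebra become membership in this set.
\<close>

definition lower :: "int \<Rightarrow> 'a set" where
  "lower d = {x \<in> carrier A. \<exists>l\<in>filt d. x \<ominus> l \<in> I}"

lemma lower_closed [dest]: "x \<in> lower d \<Longrightarrow> x \<in> carrier A" by (auto simp: lower_def)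

lemma lower_iff: "x \<in> lower d \<longleftrightarrow> (\<exists>i\<in>I. \<exists>l\<in>filt d. x = i \<oplus> l)"
proof
  assume "x \<in> lower d"
  then obtain l where l: "l \<in> filt d" "x \<ominus> l \<in> I" and x: "x \<in> carrier A" by (auto simp: lower_def)
  have "x = (x \<ominus> l) \<oplus> l" using x filt_closed[OF l(1)] by (simp add: a_minus_def a_assoc l_neg)
  thus "\<exists>i\<in>I. \<exists>l\<in>filt d. x = i \<oplus> l" using l by blast
next
  assume "\<exists>i\<in>I. \<exists>l\<in>filt d. x = i \<oplus> l"
  then obtain i l where il: "i \<in> I" "l \<in> filt d" "x = i \<oplus> l" by blast
  have c: "i \<in> carrier A" "l \<in> carrier A" using il I.a_subset by auto
  hence "x \<ominus> l = i" using il by (simp add: a_minus_def a_assoc r_neg)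
  hence "x \<ominus> l \<in> I" "x \<in> carrier A" using il c by simp_all
  thus "x \<in> lower d" using il(2) unfolding lower_def by blast
qed

lemma ideal_subset_lower: "x \<in> I \<Longrightarrow> x \<in> lower d"
  unfolding lower_iff using I.a_subset by (intro bexI[of _ x] bexI[of _ \<zero>]) auto

lemma filt_subset_lower: "x \<in> filt d \<Longrightarrow> x \<in> lower d"
  unfolding lower_iff by (intro bexI[of _ x] bexI[of _ \<zero>]) auto

lemma lower_zero [simp]: "\<zero> \<in> lower d" by (simp add: filt_subset_lower)

lemma lower_add: assumes "x \<in> lower d" "y \<in> lower d" shows "x \<oplus> y \<in> lower d"
proof -
  obtain i l i' l' where *: "i \<in> I" "i' \<in> I" "l \<in> filt d" "l' \<in> filt d" "x = i \<oplus> l" "y = i' \<oplus> l'"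
    using assms unfolding lower_iff by blast
  have c: "i \<in> carrier A" "l \<in> carrier A" "i' \<in> carrier A" "l' \<in> carrier A"
    using * I.a_subset by auto
  have "x \<oplus> y = (i \<oplus> i') \<oplus> (l \<oplus> l')" using * c by (simp add: a_ac)
  thus ?thesis unfolding lower_iff using * filt_add I.a_closed by blast
qed

lemma lower_smult: assumes "x \<in> lower d" shows "c \<odot> x \<in> lower d"
proof -
  obtain i l where *: "i \<in> I" "l \<in> filt d" "x = i \<oplus> l"
    using assms unfolding lower_iff by blast
  have c: "i \<in> carrier A" "l \<in> carrier A" using * I.a_subset by auto
  have "c \<odot> x = c \<odot> i \<oplus> c \<odot> l" using * c by (simp add: smult_r_distr)
  thus ?thesis unfolding lower_iff using * filt_smult ideal_smult_closed[OF I.is_ideal] by blast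
qed

lemma lower_minus: "x \<in> lower d \<Longrightarrow> \<ominus> x \<in> lower d"
  using lower_smult[of x d "- 1"] by (simp add: minus_eq_smult lower_closed)

lemma lower_a_minus: "x \<in> lower d \<Longrightarrow> y \<in> lower d \<Longrightarrow> x \<ominus> y \<in> lower d"
  by (simp add: a_minus_def lower_add lower_minus)

lemma lower_mult_filt: assumes "x \<in> lower a" "y \<in> filt b" shows "x \<otimes> y \<in> lower (a + b)"
proof -
  obtain i l where *: "i \<in> I" "l \<in> filt a" "x = i \<oplus> l"
    using assms unfolding lower_iff by blast
  have c: "i \<in> carrier A" "l \<in> carrier A" "y \<in> carrier A" using * assms I.a_subset by auto
  have "x \<otimes> y = i \<otimes> y \<oplus> l \<otimes> y" using * c by (simp add: l_distr)
  thus ?thesis unfolding lower_iff using * c filt_mult assms I.I_r_closed by blast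
qed

lemma filt_mult_lower: assumes "x \<in> filt a" "y \<in> lower b" shows "x \<otimes> y \<in> lower (a + b)"
proof -
  obtain i l where *: "i \<in> I" "l \<in> filt b" "y = i \<oplus> l"
    using assms unfolding lower_iff by blast
  have c: "i \<in> carrier A" "l \<in> carrier A" "x \<in> carrier A" using * assms I.a_subset by auto
  have "x \<otimes> y = x \<otimes> i \<oplus> x \<otimes> l" using * c by (simp add: r_distr)
  thus ?thesis unfolding lower_iff using * c filt_mult assms I.I_l_closed by blast
qed

lemma minus_telescope:
  assumes "x \<in> carrier A" "y \<in> carrier A" "z \<in> carrier A"
  shows "(x \<ominus> y) \<oplus> (y \<ominus> z) = x \<ominus> z"
  using assms by (simp add: a_minus_def a_assoc r_neg1)

lemma minus_swap:
  assumes "x \<in> carrier A" "y \<in> carrier A"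
  shows "y \<ominus> x = \<ominus> (x \<ominus> y)"
  using assms by (simp add: a_minus_def minus_add a_comm)

abbreviation FH where "FH \<equiv> quotient_part A I filt"

abbreviation gr where "gr \<equiv> associated_graded Q FH"

text \<open>
  The class in \<open>F\<^sub>m / F\<^bsub>m-1\<^esub>\<close> of the image of an element.
\<close>

definition cls :: "nat \<Rightarrow> 'a \<Rightarrow> 'a set set" where
  "cls m x = FH (int m - 1) +>\<^bsub>Q\<^esub> proj x"

lemma FH_eq: "FH d = proj ` filt d" by (simp add: quotient_part_def)

lemma mem_cls_iff:
  assumes x: "x \<in> carrier A"
  shows "Y \<in> cls m x \<longleftrightarrow> (\<exists>z\<in>carrier A. Y = proj z \<and> z \<ominus> x \<in> lower (int m - 1))"
proof
  assume "Y \<in> cls m x"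
  then obtain l where l: "l \<in> filt (int m - 1)" "Y = proj l \<oplus>\<^bsub>Q\<^esub> proj x"
    by (auto simp: cls_def FH_eq a_r_coset_def r_coset_def)
  hence lc: "l \<in> carrier A" by auto
  hence "(l \<oplus> x) \<ominus> x = l" using x by (simp add: a_minus_def a_assoc r_neg)
  thus "\<exists>z\<in>carrier A. Y = proj z \<and> z \<ominus> x \<in> lower (int m - 1)"
    using l lc x by (intro bexI[of _ "l \<oplus> x"]) (auto intro: filt_subset_lower)
next
  assume "\<exists>z\<in>carrier A. Y = proj z \<and> z \<ominus> x \<in> lower (int m - 1)"
  then obtain z i l where *: "z \<in> carrier A" "Y = proj z" "i \<in> I" "l \<in> filt (int m - 1)" "z \<ominus> x = i \<oplus> l"
    unfolding lower_iff by blast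
  have c: "i \<in> carrier A" "l \<in> carrier A" using * I.a_subset by auto
  have "z = (z \<ominus> x) \<oplus> x" using *(1) x by (simp add: a_minus_def a_assoc l_neg)
  also have "\<dots> = i \<oplus> l \<oplus> x" by (simp only: *(5))
  also have "\<dots> = i \<oplus> (l \<oplus> x)" using c x by (simp add: a_assoc)
  finally have "z = i \<oplus> (l \<oplus> x)" .
  hence "z \<ominus> (l \<oplus> x) = i" using c x by (simp add: a_minus_def a_assoc r_neg)
  hence "proj z = proj (l \<oplus> x)" using * c x by (subst proj_eq_iff) auto
  hence "Y = proj l \<oplus>\<^bsub>Q\<^esub> proj x" using * c x by simp
  thus "Y \<in> cls m x" using * by (auto simp: cls_def FH_eq a_r_coset_def r_coset_def)
qed

lemma cls_self: "x \<in> carrier A \<Longrightarrow> proj x \<in> cls m x"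
  by (subst mem_cls_iff) (auto intro!: bexI[of _ x] simp: a_minus_def r_neg)

lemma cls_eq_iff:
  assumes "x \<in> carrier A" "y \<in> carrier A"
  shows "cls m x = cls m y \<longleftrightarrow> x \<ominus> y \<in> lower (int m - 1)"
proof
  assume "cls m x = cls m y"
  then obtain z where z: "z \<in> carrier A" "proj x = proj z" "z \<ominus> y \<in> lower (int m - 1)"
    using cls_self[of x m] assms mem_cls_iff[of y "proj x" m] by auto
  have "x \<ominus> z \<in> lower (int m - 1)"
    using z assms by (intro ideal_subset_lower) (simp add: proj_eq_iff)
  hence "(x \<ominus> z) \<oplus> (z \<ominus> y) \<in> lower (int m - 1)" using z lower_add by blast
  moreover have "(x \<ominus> z) \<oplus> (z \<ominus> y) = x \<ominus> y" using z assms by (intro minus_telescope)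
  ultimately show "x \<ominus> y \<in> lower (int m - 1)" by simp
next
  assume xy: "x \<ominus> y \<in> lower (int m - 1)"
  have "z \<ominus> x \<in> lower (int m - 1) \<longleftrightarrow> z \<ominus> y \<in> lower (int m - 1)" if z: "z \<in> carrier A" for z
  proof -
    have "z \<ominus> y = (z \<ominus> x) \<oplus> (x \<ominus> y)" "z \<ominus> x = (z \<ominus> y) \<oplus> (y \<ominus> x)"
      using z assms by (simp_all add: minus_telescope)
    moreover have "y \<ominus> x \<in> lower (int m - 1)"
      using assms minus_swap[of x y] lower_minus[OF xy] by simp
    ultimately show ?thesis using xy lower_add by metis
  qed
  thus "cls m x = cls m y" using assms by (auto simp: mem_cls_iff)
qed

lemma cls_zero: "cls m \<zero> = FH (int m - 1)"
proof -
  have "FH (int m - 1) \<subseteq> carrier Q" by (auto simp: FH_eq)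
  hence "FH (int m - 1) +>\<^bsub>Q\<^esub> \<zero>\<^bsub>Q\<^esub> = FH (int m - 1)" by (rule Q.a_coset_add_zero)
  thus ?thesis by (simp add: cls_def flip: zero_quotient(2))
qed

text \<open>
  The symbol map, which sends the component of degree \<open>m\<close> of an element to its class in degree \<open>m\<close>.  It
  is the composition of the identification of a graded algebra with its associated
  graded algebra and the map induced by the projection.
\<close>

definition symb :: "'a \<Rightarrow> nat \<Rightarrow> 'a set set" where
  "symb f = (\<lambda>m. cls m (cmp m f))"

lemma symb_closed: assumes "f \<in> carrier A" shows "symb f \<in> carrier gr"
proof -
  have "symb f m \<noteq> FH (int m - 1) \<Longrightarrow> cmp m f \<noteq> \<zero>" for m
    using cls_zero by (metis symb_def)
  hence "{m. symb f m \<noteq> FH (int m - 1)} \<subseteq> {m. cmp m f \<noteq> \<zero>}" by blast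
  hence "finite {m. symb f m \<noteq> FH (int m - 1)}"
    using cmp_finite[OF assms] finite_subset by blast
  moreover have "\<exists>a\<in>FH (int m). symb f m = FH (int m - 1) +>\<^bsub>Q\<^esub> a" for m
    by (rule bexI[of _ "proj (cmp m f)"]) (auto simp: FH_eq symb_def cls_def cmp_in_filt assms)
  ultimately show ?thesis by (auto simp: associated_graded_def)
qed

lemma cls_add:
  assumes "x \<in> carrier A" "y \<in> carrier A"
  shows "cls m x <+>\<^bsub>Q\<^esub> cls m y = cls m (x \<oplus> y)"
proof (intro equalityI subsetI)
  fix Y assume "Y \<in> cls m x <+>\<^bsub>Q\<^esub> cls m y"
  then obtain z w where *: "z \<in> carrier A" "w \<in> carrier A" "Y = proj z \<oplus>\<^bsub>Q\<^esub> proj w"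
    "z \<ominus> x \<in> lower (int m - 1)" "w \<ominus> y \<in> lower (int m - 1)"
    using assms by (auto simp: set_add_def' mem_cls_iff)
  have "(z \<oplus> w) \<ominus> (x \<oplus> y) = (z \<ominus> x) \<oplus> (w \<ominus> y)"
    using * assms by (simp add: a_minus_def minus_add a_ac)
  thus "Y \<in> cls m (x \<oplus> y)" using * assms lower_add by (auto simp: mem_cls_iff)
next
  fix Y assume "Y \<in> cls m (x \<oplus> y)"
  then obtain z where *: "z \<in> carrier A" "Y = proj z" "z \<ominus> (x \<oplus> y) \<in> lower (int m - 1)"
    using assms by (auto simp: mem_cls_iff)
  have e: "z = (z \<ominus> y) \<oplus> y" using *(1) assms by (simp add: a_minus_def a_assoc l_neg)
  have e': "(z \<ominus> y) \<ominus> x = z \<ominus> (x \<oplus> y)"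
    using * assms by (simp add: a_minus_def minus_add a_ac)
  have "Y = proj (z \<ominus> y) \<oplus>\<^bsub>Q\<^esub> proj y" using * e assms by simp
  moreover have "proj (z \<ominus> y) \<in> cls m x"
    using * e' assms by (auto simp: mem_cls_iff intro!: bexI[of _ "z \<ominus> y"])
  ultimately show "Y \<in> cls m x <+>\<^bsub>Q\<^esub> cls m y"
    using cls_self[of y m] assms by (auto simp: set_add_def')
qed

lemma symb_add:
  assumes "f \<in> carrier A" "h \<in> carrier A"
  shows "symb (f \<oplus> h) = symb f \<oplus>\<^bsub>gr\<^esub> symb h"
  using assms by (auto simp: associated_graded_def symb_def cls_add cmp_add)

lemma cls_smult:
  assumes x: "x \<in> carrier A"
  shows "(\<Union>a\<in>cls m x. FH (int m - 1) +>\<^bsub>Q\<^esub> (c \<odot>\<^bsub>Q\<^esub> a)) = cls m (c \<odot> x)"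
proof (rule UN_constant_eq[OF cls_self[OF x]], intro ballI)
  fix Y assume "Y \<in> cls m x"
  then obtain z where *: "z \<in> carrier A" "Y = proj z" "z \<ominus> x \<in> lower (int m - 1)"
    using x by (auto simp: mem_cls_iff)
  have "c \<odot> z \<ominus> c \<odot> x \<in> lower (int m - 1)"
    using lower_smult[OF *(3), of c] * x by (simp add: smult_a_minus)
  thus "FH (int m - 1) +>\<^bsub>Q\<^esub> (c \<odot>\<^bsub>Q\<^esub> Y) = cls m (c \<odot> x)"
    using * x by (simp add: cls_eq_iff flip: cls_def)
qed

lemma symb_smult:
  assumes "f \<in> carrier A"
  shows "symb (c \<odot> f) = c \<odot>\<^bsub>gr\<^esub> symb f"
  using assms by (auto simp: associated_graded_def symb_def cls_smult cmp_smult)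

lemma symb_one: "symb \<one> = \<one>\<^bsub>gr\<^esub>"
proof
  fix m show "symb \<one> m = \<one>\<^bsub>gr\<^esub> m"
    by (cases "m = 0") (simp_all add: associated_graded_def symb_def cmp_one cls_def proj_one
        flip: zero_quotient(2))
qed

text \<open>
  Any choice of representatives gives the same product: replacing a representative changes
  it by an element of \<open>I + F\<^bsub>i-1\<^esub>\<close>, and a product with such a factor lies in \<open>I + F\<^bsub>m-1\<^esub>\<close>.
\<close>

lemma symb_mult:
  assumes f: "f \<in> carrier A" and h: "h \<in> carrier A"
  shows "symb (f \<otimes> h) = symb f \<otimes>\<^bsub>gr\<^esub> symb h"
proof
  fix m
  have key: "FH (int m - 1) +>\<^bsub>Q\<^esub> (\<Oplus>\<^bsub>Q\<^esub>i\<in>{..m}. a i \<otimes>\<^bsub>Q\<^esub> b (m - i)) = symb (f \<otimes> h) m"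
    if a: "a \<in> Pi {..m} (symb f)" and b: "b \<in> Pi {..m} (symb h)" for a b
  proof -
    have "\<forall>i\<in>{..m}. \<exists>z\<in>carrier A. a i = proj z \<and> z \<ominus> cmp i f \<in> lower (int i - 1)"
      using a f by (auto simp: symb_def mem_cls_iff Pi_def)
    then obtain z where z: "\<And>i. i \<le> m \<Longrightarrow> z i \<in> carrier A" "\<And>i. i \<le> m \<Longrightarrow> a i = proj (z i)"
      "\<And>i. i \<le> m \<Longrightarrow> z i \<ominus> cmp i f \<in> lower (int i - 1)" by (metis atMost_iff)
    have "\<forall>i\<in>{..m}. \<exists>z\<in>carrier A. b i = proj z \<and> z \<ominus> cmp i h \<in> lower (int i - 1)"
      using b h by (auto simp: symb_def mem_cls_iff Pi_def)
    then obtain w where w: "\<And>i. i \<le> m \<Longrightarrow> w i \<in> carrier A" "\<And>i. i \<le> m \<Longrightarrow> b i = proj (w i)"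
      "\<And>i. i \<le> m \<Longrightarrow> w i \<ominus> cmp i h \<in> lower (int i - 1)" by (metis atMost_iff)
    \<comment> \<open>One factor is changed at a time: \<open>z w - f h = (z - f) w + f (w - h)\<close>.\<close>
    have one: "z i \<otimes> w (m - i) \<ominus> cmp i f \<otimes> cmp (m - i) h \<in> lower (int m - 1)" if "i \<le> m" for i
    proof -
      let ?z = "z i" and ?w = "w (m - i)" and ?f = "cmp i f" and ?h = "cmp (m - i) h"
      have c: "?z \<in> carrier A" "?w \<in> carrier A" "?f \<in> carrier A" "?h \<in> carrier A"
        using z w f h that by auto
      have "?w = (?w \<ominus> ?h) \<oplus> ?h" using c by (simp add: a_minus_def a_assoc l_neg)
      moreover have "?w \<ominus> ?h \<in> lower (int (m - i))"
        using w(3)[of "m - i"] unfolding lower_def filt_def by force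
      moreover have "?h \<in> lower (int (m - i))" using h by (intro filt_subset_lower cmp_in_filt) auto
      ultimately have "?w \<in> lower (int (m - i))" by (metis lower_add)
      then obtain j l where jl: "j \<in> I" "l \<in> filt (int (m - i))" "?w = j \<oplus> l"
        unfolding lower_iff by blast
      have jc: "j \<in> carrier A" "l \<in> carrier A" using jl I.a_subset by auto
      have "(?z \<ominus> ?f) \<otimes> l \<in> lower (int i - 1 + int (m - i))"
        using z(3) that jl by (intro lower_mult_filt) auto
      moreover have "(?z \<ominus> ?f) \<otimes> j \<in> lower (int m - 1)"
        using jl c by (intro ideal_subset_lower I.I_l_closed) auto
      moreover have "?f \<otimes> (?w \<ominus> ?h) \<in> lower (int i + (int (m - i) - 1))"
        using w(3)[of "m - i"] that f by (intro filt_mult_lower cmp_in_filt) auto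
      ultimately have "((?z \<ominus> ?f) \<otimes> j \<oplus> (?z \<ominus> ?f) \<otimes> l) \<oplus> ?f \<otimes> (?w \<ominus> ?h) \<in> lower (int m - 1)"
        using that by (intro lower_add) (simp_all add: of_nat_diff)
      moreover have "((?z \<ominus> ?f) \<otimes> j \<oplus> (?z \<ominus> ?f) \<otimes> l) = (?z \<ominus> ?f) \<otimes> ?w"
        using c jc jl by (simp add: r_distr)
      moreover have "(?z \<ominus> ?f) \<otimes> ?w \<oplus> ?f \<otimes> (?w \<ominus> ?h) = ?z \<otimes> ?w \<ominus> ?f \<otimes> ?h"
        using c by (simp add: a_minus_def l_distr r_distr l_minus r_minus a_assoc)
          (simp add: a_assoc[symmetric] l_neg)
      ultimately show ?thesis by simp
    qed
    have "(\<Oplus>\<^bsub>Q\<^esub>i\<in>{..m}. a i \<otimes>\<^bsub>Q\<^esub> b (m - i)) = (\<Oplus>\<^bsub>Q\<^esub>i\<in>{..m}. proj (z i \<otimes> w (m - i)))"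
      using z w by (intro Q.finsum_cong') auto
    also have "\<dots> = proj (\<Oplus>i\<in>{..m}. z i \<otimes> w (m - i))"
      using z w by (intro proj_finsum[symmetric]) auto
    finally have e: "FH (int m - 1) +>\<^bsub>Q\<^esub> (\<Oplus>\<^bsub>Q\<^esub>i\<in>{..m}. a i \<otimes>\<^bsub>Q\<^esub> b (m - i))
        = cls m (\<Oplus>i\<in>{..m}. z i \<otimes> w (m - i))" by (simp add: cls_def)
    have "(\<Oplus>i\<in>{..m}. z i \<otimes> w (m - i)) \<ominus> (\<Oplus>i\<in>{..m}. cmp i f \<otimes> cmp (m - i) h)
        = (\<Oplus>i\<in>{..m}. z i \<otimes> w (m - i)) \<oplus> (\<Oplus>i\<in>{..m}. (- 1) \<odot> (cmp i f \<otimes> cmp (m - i) h))"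
      using f h by (subst smult_finsum[symmetric])
        (auto simp: a_minus_def minus_eq_smult intro!: finsum_closed)
    also have "\<dots> = (\<Oplus>i\<in>{..m}. z i \<otimes> w (m - i) \<ominus> cmp i f \<otimes> cmp (m - i) h)"
      using z w f h by (subst finsum_addf[symmetric])
        (auto simp: a_minus_def minus_eq_smult intro!: finsum_cong')
    also have "\<dots> \<in> lower (int m - 1)"
      using one lower_add by (intro finsum_closed_subset) auto
    finally show ?thesis
      unfolding e using z w f h by (simp add: symb_def cmp_mult cls_eq_iff finsum_closed Pi_def)
  qed
  have "(\<lambda>i. proj (cmp i f)) \<in> Pi {..m} (symb f)" "(\<lambda>i. proj (cmp i h)) \<in> Pi {..m} (symb h)"
    using f h by (auto simp: symb_def cls_self)
  hence "(\<Union>a\<in>Pi {..m} (symb f). \<Union>b\<in>Pi {..m} (symb h).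
      FH (int m - 1) +>\<^bsub>Q\<^esub> (\<Oplus>\<^bsub>Q\<^esub>i\<in>{..m}. a i \<otimes>\<^bsub>Q\<^esub> b (m - i))) = symb (f \<otimes> h) m"
    using key by (intro UN_constant_eq ballI) auto
  thus "symb (f \<otimes> h) m = (symb f \<otimes>\<^bsub>gr\<^esub> symb h) m"
    by (simp add: associated_graded_def)
qed

text \<open>
  A class of degree \<open>m\<close> is represented by a homogeneous element of degree \<open>m\<close>; the representatives of
  the nonzero entries add up to a preimage.  That zero entries are lifted to zero is what
  makes the map surjective in each degree.
\<close>

lemma symb_surj:
  assumes "x \<in> carrier gr"
  obtains f where "f \<in> carrier A" "symb f = x" "\<And>m. x m = FH (int m - 1) \<Longrightarrow> cmp m f = \<zero>"
proof -
  let ?S = "{m. x m \<noteq> FH (int m - 1)}"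
  have fin: "finite ?S" using assms by (simp add: associated_graded_def)
  have "\<exists>h\<in>carrier A. x m = cls m h \<and> cmp m h = h" for m
  proof -
    obtain a where "a \<in> FH (int m)" "x m = FH (int m - 1) +>\<^bsub>Q\<^esub> a"
      using assms by (auto simp: associated_graded_def)
    then obtain l where l: "l \<in> filt (int m)" "x m = cls m l" by (auto simp: FH_eq cls_def)
    hence lc: "l \<in> carrier A" by auto
    have "cls m l = cls m (cmp m l)"
      using lc filt_minus_cmp[OF l(1)] by (simp add: cls_eq_iff filt_subset_lower)
    thus ?thesis using l lc by (intro bexI[of _ "cmp m l"]) (auto simp: cmp_cmp)
  qed
  then obtain h where h: "\<And>m. h m \<in> carrier A" "\<And>m. x m = cls m (h m)" "\<And>m. cmp m (h m) = h m"
    by metis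
  define f where "f = (\<Oplus>m\<in>?S. h m)"
  have fc: "f \<in> carrier A" using h by (auto simp: f_def intro!: finsum_closed)
  have ch: "cmp m (h k) = (if m = k then h k else \<zero>)" for m k
    using cmp_cmp[OF h(1)[of k], of m k] h(3)[of k] by auto
  have sol: "cmp m f = (if m \<in> ?S then h m else \<zero>)" for m
  proof -
    have "cmp m f = (\<Oplus>k\<in>?S. cmp m (h k))"
      unfolding f_def using h fin by (subst cmp_finsum) auto
    also have "\<dots> = (\<Oplus>k\<in>?S. if m = k then h k else \<zero>)"
      using h(1) by (intro finsum_cong' refl) (simp_all add: ch)
    also have "\<dots> = (if m \<in> ?S then h m else \<zero>)"
    proof (cases "m \<in> ?S")
      case True
      thus ?thesis using fin h by (subst finsum_singleton) auto
    next
      case False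
      thus ?thesis by (subst finsum_cong'[of _ _ "\<lambda>_. \<zero>"]) auto
    qed
    finally show ?thesis .
  qed
  have "symb f = x" using h(2) cls_zero by (auto simp: symb_def sol fun_eq_iff)
  thus ?thesis using that[OF fc] sol by auto
qed

lemma symb_eq_iff:
  assumes "f \<in> carrier A" "h \<in> carrier A"
  shows "symb f = symb h \<longleftrightarrow> (\<forall>m. cmp m (f \<ominus> h) \<in> lower (int m - 1))"
  using assms by (auto simp: fun_eq_iff symb_def cls_eq_iff cmp_a_minus)

lemma symb_image_grad: "symb ` grad d = associated_graded_part Q FH d"
proof (intro equalityI subsetI)
  fix x assume "x \<in> symb ` grad d"
  then obtain f where f: "f \<in> grad d" "x = symb f" by blast
  hence "x m = FH (int m - 1)" if "int m \<noteq> d" for m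
    using that by (simp add: symb_def cls_zero grad_def)
  thus "x \<in> associated_graded_part Q FH d"
    using f by (simp add: associated_graded_part_def grad_def symb_closed)
next
  fix x assume x: "x \<in> associated_graded_part Q FH d"
  then obtain f where "f \<in> carrier A" "symb f = x" "\<And>m. x m = FH (int m - 1) \<Longrightarrow> cmp m f = \<zero>"
    using symb_surj[of x] by (auto simp: associated_graded_part_def)
  thus "x \<in> symb ` grad d"
    using x by (intro image_eqI[of _ _ f]) (auto simp: associated_graded_part_def grad_def)
qed

text \<open>
  If the associated graded algebra of \<open>A / I\<close> and another algebra \<open>B\<close> are both images of \<open>A\<close>
  under surjective homomorphisms with the same fibres, they are isomorphic.
\<close>

theorem associated_graded_isomorphic:
  assumes pi: "\<pi> \<in> ring_hom A B" "\<pi> ` carrier A = carrier B"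
    and smult: "\<And>c x. x \<in> carrier A \<Longrightarrow> \<pi> (c \<odot> x) = c \<odot>\<^bsub>B\<^esub> \<pi> x"
    and kernel: "\<And>f h. f \<in> carrier A \<Longrightarrow> h \<in> carrier A \<Longrightarrow>
      \<pi> f = \<pi> h \<longleftrightarrow> (\<forall>m. cmp m (f \<ominus> h) \<in> lower (int m - 1))"
    and grades: "\<And>d. \<pi> ` grad d = gB d"
  shows "graded_algebra_isomorphic gr (associated_graded_part Q FH) B gB"
proof -
  define \<phi> where "\<phi> x = \<pi> (SOME f. f \<in> carrier A \<and> symb f = x)" for x
  have \<phi>: "\<phi> (symb f) = \<pi> f" if "f \<in> carrier A" for f
  proof -
    define f' where "f' = (SOME f'. f' \<in> carrier A \<and> symb f' = symb f)"
    have "\<exists>f'. f' \<in> carrier A \<and> symb f' = symb f" using that by blast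
    from someI_ex[OF this] have f': "f' \<in> carrier A" "symb f' = symb f"
      by (simp_all add: f'_def)
    have "\<pi> f' = \<pi> f"
      using f'(2) unfolding kernel[OF f'(1) that] symb_eq_iff[OF f'(1) that] .
    thus ?thesis by (simp add: \<phi>_def f'_def)
  qed
  have surj: "\<exists>f\<in>carrier A. x = symb f" if "x \<in> carrier gr" for x
    using symb_surj[OF that] by metis
  have "\<phi> \<in> ring_hom gr B"
  proof (rule ring_hom_memI)
    fix x y assume xy: "x \<in> carrier gr" "y \<in> carrier gr"
    then obtain f h where fh: "f \<in> carrier A" "h \<in> carrier A" "x = symb f" "y = symb h"
      using surj by metis
    show "\<phi> (x \<otimes>\<^bsub>gr\<^esub> y) = \<phi> x \<otimes>\<^bsub>B\<^esub> \<phi> y" "\<phi> (x \<oplus>\<^bsub>gr\<^esub> y) = \<phi> x \<oplus>\<^bsub>B\<^esub> \<phi> y"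
      using fh ring_hom_mult[OF pi(1)] ring_hom_add[OF pi(1)]
      by (simp_all add: \<phi> flip: symb_mult symb_add)
  next
    fix x assume "x \<in> carrier gr"
    thus "\<phi> x \<in> carrier B" using surj \<phi> pi(2) by blast
  qed (use ring_hom_one[OF pi(1)] in \<open>simp add: \<phi> flip: symb_one\<close>)
  moreover have "bij_betw \<phi> (carrier gr) (carrier B)"
  proof (rule bij_betw_imageI)
    show "inj_on \<phi> (carrier gr)"
    proof (rule inj_onI)
      fix x y assume "x \<in> carrier gr" "y \<in> carrier gr" and e: "\<phi> x = \<phi> y"
      then obtain f h where "f \<in> carrier A" "h \<in> carrier A" "x = symb f" "y = symb h"
        using surj by metis
      thus "x = y" using e \<phi> kernel symb_eq_iff by metis
    qed
    have "carrier gr = symb ` carrier A" using surj symb_closed by auto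
    thus "\<phi> ` carrier gr = carrier B" by (simp add: image_image \<phi> pi(2))
  qed
  moreover have "\<phi> (c \<odot>\<^bsub>gr\<^esub> x) = c \<odot>\<^bsub>B\<^esub> \<phi> x" if x: "x \<in> carrier gr" for c x
    using surj[OF x] by (auto simp: \<phi> smult simp flip: symb_smult)
  ultimately have "\<phi> \<in> algebra_iso gr B" by (auto simp: algebra_iso_def ring_iso_def)
  moreover have "\<phi> ` associated_graded_part Q FH d = gB d" for d
  proof -
    have "\<phi> ` symb ` grad d = \<pi> ` grad d"
      unfolding image_image by (intro image_cong refl \<phi>) (auto simp: grad_def)
    thus ?thesis by (simp add: symb_image_grad grades)
  qed
  ultimately show ?thesis unfolding graded_algebra_isomorphic_def by blast
qed

end

section \<open>The free algebra\<close>

text \<open>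
  The product of the free algebra without its carrier.  Splitting off the first letter
  (\<open>conv_Cons\<close>) turns the sum over all factorizations of a word into a recursion, and the laws of
  the algebra are proved by induction on the word.
\<close>

definition conv :: "(nat list \<Rightarrow> complex) \<Rightarrow> (nat list \<Rightarrow> complex) \<Rightarrow> nat list \<Rightarrow> complex" where
  "conv f h w = (\<Sum>k\<le>length w. f (take k w) * h (drop k w))"

lemma conv_Nil [simp]: "conv f h [] = f [] * h []"
  by (simp add: conv_def)

lemma conv_Cons [simp]: "conv f h (x # w) = f [] * h (x # w) + conv (\<lambda>u. f (x # u)) h w"
  by (simp add: conv_def sum.atMost_Suc_shift del: sum.atMost_Suc)

lemma conv_zero_left [simp]: "conv (\<lambda>_. 0) h w = 0"
  by (simp add: conv_def)

lemma conv_add_left: "conv (\<lambda>u. f u + f' u) h w = conv f h w + conv f' h w"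
  by (simp add: conv_def algebra_simps sum.distrib)

lemma conv_add_right: "conv f (\<lambda>u. h u + h' u) w = conv f h w + conv f h' w"
  by (simp add: conv_def algebra_simps sum.distrib)

lemma conv_smult_left: "conv (\<lambda>u. c * f u) h w = c * conv f h w"
  by (simp add: conv_def algebra_simps sum_distrib_left)

lemma conv_smult_right: "conv f (\<lambda>u. c * h u) w = c * conv f h w"
  by (simp add: conv_def algebra_simps sum_distrib_left)

lemma conv_sum_left: "conv (\<lambda>u. \<Sum>i\<in>S. c i * f i u) h w = (\<Sum>i\<in>S. c i * conv (f i) h w)"
  by (induction S rule: infinite_finite_induct)
    (simp_all add: conv_add_left conv_smult_left)

lemma conv_assoc: "conv (conv f h) k w = conv f (conv h k) w"
  by (induction w arbitrary: f)
    (simp_all add: conv_add_left conv_smult_left algebra_simps)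

lemma conv_one_left: "conv (\<lambda>w. if w = [] then 1 else 0) f w = f w"
  by (cases w) simp_all

lemma conv_one_right: "conv f (\<lambda>w. if w = [] then 1 else 0) w = f w"
  by (induction w arbitrary: f) simp_all

lemma conv_nonzero:
  assumes "conv f h w \<noteq> 0"
  obtains a b where "w = a @ b" "f a \<noteq> 0" "h b \<noteq> 0"
proof -
  obtain k where "f (take k w) * h (drop k w) \<noteq> 0"
    using assms unfolding conv_def by (meson sum.not_neutral_contains_not_neutral)
  thus ?thesis using that[of "take k w" "drop k w"] by simp
qed

lemma free_algebra_simps [simp]:
  "f \<otimes>\<^bsub>free_algebra n\<^esub> h = conv f h"
  "f \<oplus>\<^bsub>free_algebra n\<^esub> h = (\<lambda>w. f w + h w)"
  "c \<odot>\<^bsub>free_algebra n\<^esub> f = (\<lambda>w. c * f w)"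
  "\<one>\<^bsub>free_algebra n\<^esub> = (\<lambda>w. if w = [] then 1 else 0)"
  "\<zero>\<^bsub>free_algebra n\<^esub> = (\<lambda>w. 0)"
  by (simp_all add: free_algebra_def conv_def fun_eq_iff)

lemma mem_free_algebra:
  "f \<in> carrier (free_algebra n) \<longleftrightarrow> finite {w. f w \<noteq> 0} \<and> (\<forall>w. f w \<noteq> 0 \<longrightarrow> set w \<subseteq> {1..n})"
  by (simp add: free_algebra_def)

lemma free_finite_support: "f \<in> carrier (free_algebra n) \<Longrightarrow> finite {w. f w \<noteq> 0}"
  by (simp add: mem_free_algebra)

lemma free_letters: "f \<in> carrier (free_algebra n) \<Longrightarrow> f w \<noteq> 0 \<Longrightarrow> set w \<subseteq> {1..n}"
  by (simp add: mem_free_algebra)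

lemma free_mult_closed [simp, intro]:
  assumes "f \<in> carrier (free_algebra n)" "h \<in> carrier (free_algebra n)"
  shows "conv f h \<in> carrier (free_algebra n)"
  unfolding mem_free_algebra
proof
  have "{w. conv f h w \<noteq> 0} \<subseteq> (\<lambda>(a, b). a @ b) ` ({w. f w \<noteq> 0} \<times> {w. h w \<noteq> 0})"
    by (auto elim!: conv_nonzero)
  thus "finite {w. conv f h w \<noteq> 0}"
    by (rule finite_subset) (use assms in \<open>auto simp: free_finite_support\<close>)
  show "\<forall>w. conv f h w \<noteq> 0 \<longrightarrow> set w \<subseteq> {1..n}"
  proof (intro allI impI)
    fix w assume "conv f h w \<noteq> 0"
    then obtain a b where "w = a @ b" "f a \<noteq> 0" "h b \<noteq> 0" by (rule conv_nonzero)
    thus "set w \<subseteq> {1..n}" using free_letters[of f n a] free_letters[of h n b] assms by simp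
  qed
qed

lemma free_add_closed:
  assumes "f \<in> carrier (free_algebra n)" "h \<in> carrier (free_algebra n)"
  shows "(\<lambda>w. f w + h w) \<in> carrier (free_algebra n)"
  unfolding mem_free_algebra
proof
  have "{w. f w + h w \<noteq> 0} \<subseteq> {w. f w \<noteq> 0} \<union> {w. h w \<noteq> 0}" by auto
  thus "finite {w. f w + h w \<noteq> 0}" by (rule finite_subset) (use assms in \<open>auto simp: free_finite_support\<close>)
  show "\<forall>w. f w + h w \<noteq> 0 \<longrightarrow> set w \<subseteq> {1..n}"
    using assms by (metis add_0 free_letters)
qed

lemma free_smult_closed:
  assumes "f \<in> carrier (free_algebra n)"
  shows "(\<lambda>w. c * f w) \<in> carrier (free_algebra n)"
  unfolding mem_free_algebra
proof
  have "{w. c * f w \<noteq> 0} \<subseteq> {w. f w \<noteq> 0}" by auto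
  thus "finite {w. c * f w \<noteq> 0}" by (rule finite_subset) (use assms in \<open>auto simp: free_finite_support\<close>)
qed (use assms in \<open>auto simp: mem_free_algebra\<close>)

lemma free_algebra_over: "algebra_over (free_algebra n)"
proof (rule algebra_over.intro)
  show "ring (free_algebra n)"
  proof (rule ringI)
    show "abelian_group (free_algebra n)"
    proof (rule abelian_groupI)
      fix x assume x: "x \<in> carrier (free_algebra n)"
      show "\<exists>y\<in>carrier (free_algebra n). y \<oplus>\<^bsub>free_algebra n\<^esub> x = \<zero>\<^bsub>free_algebra n\<^esub>"
        by (rule bexI[of _ "\<lambda>w. (- 1) * x w"]) (use free_smult_closed[OF x, of "- 1"] in simp_all)
    qed (simp_all add: free_add_closed fun_eq_iff, simp add: mem_free_algebra)
    show "Group.monoid (free_algebra n)"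
      by (rule monoidI)
        (simp_all add: free_mult_closed conv_assoc fun_eq_iff conv_one_left conv_one_right,
          simp add: mem_free_algebra)
  qed (simp_all add: fun_eq_iff conv_add_left conv_add_right)
  show "algebra_over_axioms (free_algebra n)"
    by (rule algebra_over_axioms.intro)
      (simp_all add: free_smult_closed conv_smult_left conv_smult_right fun_eq_iff algebra_simps)
qed

lemma free_uminus: "f \<in> carrier (free_algebra n) \<Longrightarrow> \<ominus>\<^bsub>free_algebra n\<^esub> f = (\<lambda>w. - f w)"
  using algebra_over.minus_eq_smult[OF free_algebra_over] by simp

lemma free_a_minus:
  "h \<in> carrier (free_algebra n) \<Longrightarrow> f \<ominus>\<^bsub>free_algebra n\<^esub> h = (\<lambda>w. f w - h w)"
  by (simp add: a_minus_def free_uminus)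

definition wd :: "nat list \<Rightarrow> nat list \<Rightarrow> complex" where
  "wd w = (\<lambda>u. if u = w then 1 else 0)"

lemma wd_closed [simp, intro]: "set w \<subseteq> {1..n} \<Longrightarrow> wd w \<in> carrier (free_algebra n)"
  by (auto simp: wd_def mem_free_algebra)

lemma free_gen_eq_wd: "free_gen i = wd [i]"
  by (simp add: free_gen_def wd_def)

lemma conv_wd_left: "conv (wd a) h w = (if take (length a) w = a then h (drop (length a) w) else 0)"
proof (induction w arbitrary: a)
  case Nil
  thus ?case by (auto simp: wd_def)
next
  case (Cons x w)
  show ?case
  proof (cases a)
    case Nil
    have "conv (\<lambda>u. 0) h w = 0" by (simp add: conv_def)
    thus ?thesis using Nil by (simp add: wd_def)
  next
    case (Cons y a')
    have "(\<lambda>u. wd a (x # u)) = (\<lambda>u. (if x = y then 1 else 0) * wd a' u)"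
      by (auto simp: wd_def Cons)
    hence "conv (wd a) h (x # w) = (if x = y then 1 else 0) * conv (wd a') h w"
      by (simp add: conv_smult_left) (simp add: wd_def Cons)
    thus ?thesis using Cons.IH[of a'] by (simp add: Cons)
  qed
qed

lemma conv_wd_wd: "conv (wd a) (wd b) = wd (a @ b)"
proof
  fix w
  have "w = a @ b \<longleftrightarrow> take (length a) w = a \<and> drop (length a) w = b"
    using append_eq_conv_conj[of a b w] by auto
  thus "conv (wd a) (wd b) w = wd (a @ b) w" unfolding conv_wd_left by (simp add: wd_def)
qed

text \<open>The words form a basis, so a property that is closed under linear combinations has to
  be checked for words only; moreover only words that occur in \<open>t\<close> matter, which keeps track of the
  degree of \<open>t\<close>.\<close>

lemma free_induct [consumes 1, case_names zero add smult wd]: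
  assumes t: "t \<in> carrier (free_algebra n)"
    and zero: "P (\<lambda>w. 0)"
    and add: "\<And>x y. x \<in> carrier (free_algebra n) \<Longrightarrow> y \<in> carrier (free_algebra n)
      \<Longrightarrow> P x \<Longrightarrow> P y \<Longrightarrow> P (\<lambda>w. x w + y w)"
    and smult: "\<And>c x. x \<in> carrier (free_algebra n) \<Longrightarrow> P x \<Longrightarrow> P (\<lambda>w. c * x w)"
    and wd: "\<And>w. set w \<subseteq> {1..n} \<Longrightarrow> t w \<noteq> 0 \<Longrightarrow> P (wd w)"
  shows "P t"
proof -
  have "P x" if "finite S" "{w. x w \<noteq> 0} = S" "\<And>w. x w \<noteq> 0 \<Longrightarrow> x w = t w" for S x
    using that
  proof (induction S arbitrary: x rule: finite_induct)
    case empty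
    hence "x = (\<lambda>w. 0)" by auto
    thus ?case using zero by simp
  next
    case (insert w S)
    have "w \<in> {w. x w \<noteq> 0}" using insert.prems by simp
    hence w: "x w \<noteq> 0" "t w \<noteq> 0" using insert.prems(2)[of w] by auto
    hence sw: "set w \<subseteq> {1..n}" using t free_letters by blast
    have supp: "{u. (x(w := 0)) u \<noteq> 0} = S" using insert.prems insert.hyps by auto
    have xt: "(x(w := 0)) u = t u" if "(x(w := 0)) u \<noteq> 0" for u
      using that insert.prems(2)[of u] by (auto split: if_splits)
    have "x(w := 0) \<in> carrier (free_algebra n)"
      unfolding mem_free_algebra supp using insert.hyps xt t free_letters by (metis (full_types))
    moreover have "P (x(w := 0))" using insert.IH supp xt by blast
    moreover have "P (\<lambda>u. x w * wd w u)" using sw w by (intro smult wd) auto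
    moreover have "(\<lambda>u. x w * wd w u) \<in> carrier (free_algebra n)"
      using sw by (intro free_smult_closed) auto
    ultimately have "P (\<lambda>u. (x(w := 0)) u + x w * wd w u)" by (intro add)
    moreover have "(\<lambda>u. (x(w := 0)) u + x w * wd w u) = x" by (auto simp: wd_def)
    ultimately show ?case by simp
  qed
  thus ?thesis using free_finite_support[OF t] by blast
qed

subsection \<open>Homogeneous components\<close>

definition len_part :: "nat \<Rightarrow> (nat list \<Rightarrow> complex) \<Rightarrow> nat list \<Rightarrow> complex" where
  "len_part m f = (\<lambda>w. if length w = m then f w else 0)"

lemma len_part_closed: "f \<in> carrier (free_algebra n) \<Longrightarrow> len_part m f \<in> carrier (free_algebra n)"
  by (auto simp: mem_free_algebra len_part_def elim: rev_finite_subset)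

lemma len_part_conv:
  "len_part m (conv f h) w = (\<Sum>i\<le>m. conv (len_part i f) (len_part (m - i) h) w)"
proof (cases "length w = m")
  case True
  have "(\<Sum>i\<le>m. conv (len_part i f) (len_part (m - i) h) w)
      = (\<Sum>i\<le>m. \<Sum>k\<le>m. if k = i then f (take k w) * h (drop k w) else 0)"
  proof (intro sum.cong refl)
    fix i assume "i \<in> {..m}"
    thus "conv (len_part i f) (len_part (m - i) h) w
        = (\<Sum>k\<le>m. if k = i then f (take k w) * h (drop k w) else 0)"
      unfolding conv_def True by (intro sum.cong refl) (auto simp: len_part_def True)
  qed
  also have "\<dots> = conv f h w" using True by (subst sum.swap) (simp add: conv_def)
  finally show ?thesis using True by (simp add: len_part_def)
next
  case False
  hence "conv (len_part i f) (len_part (m - i) h) w = 0" if "i \<le> m" for i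
    using that by (auto simp: conv_def len_part_def intro!: sum.neutral)
  thus ?thesis using False by (simp add: len_part_def)
qed

subsection \<open>Linear substitutions\<close>

text \<open>
  The substitution \<open>v\<^sub>i \<rightarrow> \<Sum>\<^sub>x M\<^sub>i\<^sub>x v\<^sub>x\<close>, as a recursion on the word whose coefficient is
  computed.
\<close>

fun wact :: "nat \<Rightarrow> (nat \<Rightarrow> nat \<Rightarrow> complex) \<Rightarrow> (nat list \<Rightarrow> complex) \<Rightarrow> nat list \<Rightarrow> complex" where
  "wact n M f [] = f []"
| "wact n M f (x # u) = (if x \<in> {1..n} then \<Sum>i=1..n. M i x * wact n M (\<lambda>w. f (i # w)) u else 0)"

lemma wact_add: "wact n M (\<lambda>w. f w + h w) u = wact n M f u + wact n M h u"
  by (induction u arbitrary: f h) (simp_all add: algebra_simps sum.distrib)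

lemma wact_smult: "wact n M (\<lambda>w. c * f w) u = c * wact n M f u"
  by (induction u arbitrary: f) (simp_all add: algebra_simps sum_distrib_left)

lemma wact_sum: "wact n M (\<lambda>w. \<Sum>i\<in>S. c i * f i w) u = (\<Sum>i\<in>S. c i * wact n M (f i) u)"
proof (induction S rule: infinite_finite_induct)
  case (infinite S)
  thus ?case using wact_smult[of n M 0 "\<lambda>_. 0" u] by simp
next
  case empty
  thus ?case using wact_smult[of n M 0 "\<lambda>_. 0" u] by simp
qed (simp add: wact_add wact_smult)

lemma wact_conv: "wact n M (conv f h) u = conv (wact n M f) (wact n M h) u"
proof (induction u arbitrary: f)
  case Nil
  show ?case by simp
next
  case (Cons x u)
  show ?case
  proof (cases "x \<in> {1..n}")
    case True
    have "wact n M (conv f h) (x # u)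
        = (\<Sum>i=1..n. M i x * (f [] * wact n M (\<lambda>w. h (i # w)) u
            + conv (wact n M (\<lambda>w. f (i # w))) (wact n M h) u))"
      using True by (simp add: wact_add wact_smult Cons.IH)
    also have "\<dots> = conv (wact n M f) (wact n M h) (x # u)"
      using True by (simp add: conv_sum_left algebra_simps sum.distrib sum_distrib_left)
    finally show ?thesis .
  next
    case False
    hence "wact n M (conv f h) (x # u) = 0" "wact n M h (x # u) = 0" "\<And>u. wact n M f (x # u) = 0"
      by auto
    thus ?thesis by (simp del: wact.simps(2))
  qed
qed

lemma wact_comp:
  assumes "\<And>j x. j \<in> {1..n} \<Longrightarrow> x \<in> {1..n} \<Longrightarrow> M'' j x = (\<Sum>i=1..n. M' j i * M i x)"
  shows "wact n M (wact n M' f) u = wact n M'' f u"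
proof (induction u arbitrary: f)
  case (Cons x u)
  show ?case
  proof (cases "x \<in> {1..n}")
    case True
    have "wact n M (wact n M' f) (x # u)
        = (\<Sum>i=1..n. M i x * wact n M (\<lambda>w. \<Sum>j=1..n. M' j i * wact n M' (\<lambda>w. f (j # w)) w) u)"
      using True by simp
    also have "\<dots> = (\<Sum>i=1..n. \<Sum>j=1..n. M' j i * M i x * wact n M'' (\<lambda>w. f (j # w)) u)"
      by (simp add: wact_sum Cons.IH sum_distrib_left algebra_simps)
    also have "\<dots> = (\<Sum>j=1..n. (\<Sum>i=1..n. M' j i * M i x) * wact n M'' (\<lambda>w. f (j # w)) u)"
      by (subst sum.swap) (simp add: sum_distrib_right)
    also have "\<dots> = wact n M'' f (x # u)" using True assms by simp
    finally show ?thesis .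
  qed auto
qed simp

lemma wact_id:
  assumes "\<And>i x. i \<in> {1..n} \<Longrightarrow> x \<in> {1..n} \<Longrightarrow> M i x = (if i = x then 1 else 0)"
    "set u \<subseteq> {1..n}"
  shows "wact n M f u = f u"
  using assms(2)
proof (induction u arbitrary: f)
  case (Cons x u)
  have "(\<Sum>i=1..n. M i x * f (i # u)) = (\<Sum>i=1..n. if i = x then f (x # u) else 0)"
    using Cons.prems assms(1) by (intro sum.cong) auto
  thus ?case using Cons by simp
qed simp

text \<open>
  Every letter is replaced by a combination of letters, so lengths are preserved.
\<close>

lemma wact_nonzero:
  assumes "wact n M f u \<noteq> 0"
  shows "set u \<subseteq> {1..n} \<and> (\<exists>w. length w = length u \<and> f w \<noteq> 0)"
  using assms
proof (induction u arbitrary: f)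
  case (Cons x u)
  hence x: "x \<in> {1..n}" by (auto split: if_splits)
  hence "(\<Sum>i=1..n. M i x * wact n M (\<lambda>w. f (i # w)) u) \<noteq> 0" using Cons.prems by simp
  then obtain i where "M i x * wact n M (\<lambda>w. f (i # w)) u \<noteq> 0"
    by (meson sum.not_neutral_contains_not_neutral)
  hence "wact n M (\<lambda>w. f (i # w)) u \<noteq> 0" by simp
  from Cons.IH[OF this] obtain w where "set u \<subseteq> {1..n}" "length w = length u" "f (i # w) \<noteq> 0" by blast
  thus ?case using x by (intro conjI exI[of _ "i # w"]) auto
qed auto

lemma wact_letter_coeff: "i \<in> {1..n} \<Longrightarrow> k \<in> {1..n} \<Longrightarrow> wact n M (wd [i]) [k] = M i k"
  by (simp add: wd_def if_distrib cong: if_cong)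

lemma wact_letter: "i \<in> {1..n} \<Longrightarrow> wact n M (wd [i]) = (\<lambda>w. \<Sum>k=1..n. M i k * wd [k] w)"
proof
  fix w assume i: "i \<in> {1..n}"
  show "wact n M (wd [i]) w = (\<Sum>k=1..n. M i k * wd [k] w)"
  proof (cases "\<exists>x\<in>{1..n}. w = [x]")
    case True
    then obtain x where x: "x \<in> {1..n}" "w = [x]" by blast
    have "wact n M (wd [i]) w = M i x" unfolding x(2) by (rule wact_letter_coeff[OF i x(1)])
    also have "\<dots> = (\<Sum>k=1..n. if k = x then M i x else 0)" using x by simp
    also have "\<dots> = (\<Sum>k=1..n. M i k * wd [k] w)"
      using x by (intro sum.cong) (auto simp: wd_def)
    finally show ?thesis .
  next
    case False
    have "wact n M (wd [i]) w = 0"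
    proof (rule ccontr)
      assume "wact n M (wd [i]) w \<noteq> 0"
      hence "set w \<subseteq> {1..n}" "length w = 1"
        using wact_nonzero[of n M "wd [i]" w] by (auto simp: wd_def split: if_splits)
      thus False using False by (cases w) auto
    qed
    moreover have "(\<Sum>k=1..n. M i k * wd [k] w) = 0"
      using False by (intro sum.neutral) (auto simp: wd_def)
    ultimately show ?thesis by simp
  qed
qed

lemma wact_closed:
  assumes "f \<in> carrier (free_algebra n)"
  shows "wact n M f \<in> carrier (free_algebra n)"
  unfolding mem_free_algebra
proof
  have "{u. wact n M f u \<noteq> 0} \<subseteq> (\<Union>w\<in>{w. f w \<noteq> 0}. {u. set u \<subseteq> {1..n} \<and> length u = length w})"
  proof
    fix u assume "u \<in> {u. wact n M f u \<noteq> 0}"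
    then obtain w where "set u \<subseteq> {1..n}" "length w = length u" "f w \<noteq> 0"
      using wact_nonzero by blast
    thus "u \<in> (\<Union>w\<in>{w. f w \<noteq> 0}. {u. set u \<subseteq> {1..n} \<and> length u = length w})" by auto
  qed
  thus "finite {u. wact n M f u \<noteq> 0}"
    by (rule finite_subset) (auto simp: free_finite_support[OF assms] finite_lists_length_eq)
  show "\<forall>w. wact n M f w \<noteq> 0 \<longrightarrow> set w \<subseteq> {1..n}" using wact_nonzero by blast
qed

lemma wact_eq_sum:
  assumes "set u \<subseteq> {1..n}"
  shows "(\<Sum>w | set w \<subseteq> {1..n} \<and> length w = length u. (\<Prod>k<length u. M (w ! k) (u ! k)) * f w)
    = wact n M f u"
  using assms
proof (induction u arbitrary: f)
  case Nil
  have "{w. set w \<subseteq> {1..n} \<and> w = []} = {[]}" by auto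
  thus ?case by simp
next
  case (Cons x u)
  let ?W = "{w. set w \<subseteq> {1..n} \<and> length w = length u}"
  have eq: "{w. set w \<subseteq> {1..n} \<and> length w = length (x # u)} = (\<lambda>(i, w). i # w) ` ({1..n} \<times> ?W)"
    by (auto simp: length_Suc_conv image_iff)
  have inj: "inj_on (\<lambda>(i, w). i # w) ({1..n} \<times> ?W)" by (auto simp: inj_on_def)
  have "(\<Sum>w | set w \<subseteq> {1..n} \<and> length w = length (x # u). (\<Prod>k<length (x # u). M (w ! k) ((x # u) ! k)) * f w)
      = (\<Sum>(i, w)\<in>{1..n} \<times> ?W. M i x * ((\<Prod>k<length u. M (w ! k) (u ! k)) * f (i # w)))"
    unfolding eq sum.reindex[OF inj]
    by (intro sum.cong refl)
      (auto simp: prod.lessThan_Suc_shift algebra_simps simp del: prod.lessThan_Suc)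
  also have "\<dots> = (\<Sum>i=1..n. M i x * (\<Sum>w\<in>?W. (\<Prod>k<length u. M (w ! k) (u ! k)) * f (i # w)))"
    by (simp add: sum.cartesian_product[symmetric] sum_distrib_left)
  also have "\<dots> = wact n M f (x # u)" using Cons by simp
  finally show ?case .
qed

section \<open>Quantum symmetric algebras and their skew group algebras\<close>

lemma free_finsum_apply:
  "finite S \<Longrightarrow> f \<in> S \<rightarrow> carrier (free_algebra n)
    \<Longrightarrow> (\<Oplus>\<^bsub>free_algebra n\<^esub>i\<in>S. f i) w = (\<Sum>i\<in>S. f i w)"
proof (induction S rule: finite_induct)
  case empty
  interpret algebra_over "free_algebra n" by (rule free_algebra_over)
  show ?case by simp
next
  case (insert s S)
  interpret algebra_over "free_algebra n" by (rule free_algebra_over)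
  from insert show ?case by (auto simp: Pi_def)
qed

lemma free_graded: "graded_over (free_algebra n) len_part"
proof (rule graded_over.intro[OF free_algebra_over graded_over_axioms.intro])
  fix x assume x: "x \<in> carrier (free_algebra n)"
  show "len_part m x \<in> carrier (free_algebra n)" for m using x by (rule len_part_closed)
  have "{m. len_part m x \<noteq> \<zero>\<^bsub>free_algebra n\<^esub>} \<subseteq> length ` {w. x w \<noteq> 0}"
    by (auto simp: len_part_def fun_eq_iff split: if_splits)
  thus "finite {m. len_part m x \<noteq> \<zero>\<^bsub>free_algebra n\<^esub>}"
    using free_finite_support[OF x] by (auto intro: finite_subset)
  show "len_part m (x \<otimes>\<^bsub>free_algebra n\<^esub> y)
      = (\<Oplus>\<^bsub>free_algebra n\<^esub>i\<in>{..m}. len_part i x \<otimes>\<^bsub>free_algebra n\<^esub> len_part (m - i) y)"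
    if y: "y \<in> carrier (free_algebra n)" for y m
  proof
    fix w
    have "(\<Oplus>\<^bsub>free_algebra n\<^esub>i\<in>{..m}. len_part i x \<otimes>\<^bsub>free_algebra n\<^esub> len_part (m - i) y) w
        = (\<Sum>i\<le>m. conv (len_part i x) (len_part (m - i) y) w)"
      using x y by (subst free_finsum_apply) (auto intro: free_mult_closed len_part_closed)
    thus "len_part m (x \<otimes>\<^bsub>free_algebra n\<^esub> y) w
        = (\<Oplus>\<^bsub>free_algebra n\<^esub>i\<in>{..m}. len_part i x \<otimes>\<^bsub>free_algebra n\<^esub> len_part (m - i) y) w"
      by (simp add: len_part_conv)
  qed
qed (auto simp: len_part_def fun_eq_iff)

text \<open>
  The relation \<open>v\<^sub>i v\<^sub>j - q\<^sub>i\<^sub>j v\<^sub>j v\<^sub>i\<close> of the quantum symmetric algebra.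
\<close>

definition rel :: "(nat \<Rightarrow> nat \<Rightarrow> complex) \<Rightarrow> nat \<Rightarrow> nat \<Rightarrow> nat list \<Rightarrow> complex" where
  "rel q i j = (\<lambda>w. wd [i, j] w - q i j * wd [j, i] w)"

lemma rel_closed [simp, intro]: "i \<in> {1..n} \<Longrightarrow> j \<in> {1..n} \<Longrightarrow> rel q i j \<in> carrier (free_algebra n)"
  using algebra_over.axioms(1)[OF free_algebra_over, THEN ring.ring_simprules(4),
      of "wd [i, j]" n "\<lambda>w. q i j * wd [j, i] w"]
  by (simp add: rel_def free_a_minus free_smult_closed)

lemma rel_alt: "rel q i j = (\<lambda>w. wd [i, j] w + - q i j * wd [j, i] w)"
  by (simp add: rel_def)

lemma rel_eq:
  assumes "i \<in> {1..n}" "j \<in> {1..n}"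
  shows "free_gen i \<otimes>\<^bsub>free_algebra n\<^esub> free_gen j
    \<ominus>\<^bsub>free_algebra n\<^esub> q i j \<odot>\<^bsub>free_algebra n\<^esub> (free_gen j \<otimes>\<^bsub>free_algebra n\<^esub> free_gen i) = rel q i j"
  using assms by (simp add: free_gen_eq_wd conv_wd_wd free_a_minus free_smult_closed rel_def)

locale q_system =
  fixes n :: nat and q :: "nat \<Rightarrow> nat \<Rightarrow> complex"
  assumes q_nz: "i \<in> {1..n} \<Longrightarrow> j \<in> {1..n} \<Longrightarrow> q i j \<noteq> 0"
    and q_diag: "i \<in> {1..n} \<Longrightarrow> q i i = 1"
    and q_inv: "i \<in> {1..n} \<Longrightarrow> j \<in> {1..n} \<Longrightarrow> q j i = inverse (q i j)"
begin

abbreviation T where "T \<equiv> free_algebra n"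
abbreviation J where "J \<equiv> q_ideal n q"

sublocale T: graded_over T len_part by (rule free_graded)

lemma q_swap: "i \<in> {1..n} \<Longrightarrow> j \<in> {1..n} \<Longrightarrow> q i j * q j i = 1"
  using q_nz[of i j] q_inv[of i j] by simp

lemma J_eq: "J = Idl\<^bsub>T\<^esub> {rel q i j | i j. i \<in> {1..n} \<and> j \<in> {1..n}}"
proof -
  have im: "{f i j | i j. i \<in> {1..n} \<and> j \<in> {1..n}} = (\<lambda>(i, j). f i j) ` ({1..n} \<times> {1..n})"
    for f :: "nat \<Rightarrow> nat \<Rightarrow> nat list \<Rightarrow> complex" by (auto, metis)
  have "{free_gen i \<otimes>\<^bsub>T\<^esub> free_gen j \<ominus>\<^bsub>T\<^esub> q i j \<odot>\<^bsub>T\<^esub> (free_gen j \<otimes>\<^bsub>T\<^esub> free_gen i)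
              | i j. i \<in> {1..n} \<and> j \<in> {1..n}} = {rel q i j | i j. i \<in> {1..n} \<and> j \<in> {1..n}}"
    unfolding im by (intro image_cong refl, clarify, rule rel_eq)
  thus ?thesis by (simp add: q_ideal_def Let_def del: free_algebra_simps)
qed

lemma rels_closed: "{rel q i j | i j. i \<in> {1..n} \<and> j \<in> {1..n}} \<subseteq> carrier T"
  using rel_closed by auto

lemma J_ideal: "ideal J T"
  unfolding J_eq by (rule T.genideal_ideal[OF rels_closed])

lemma rel_in_J: "i \<in> {1..n} \<Longrightarrow> j \<in> {1..n} \<Longrightarrow> rel q i j \<in> J"
  unfolding J_eq using T.genideal_self[OF rels_closed] by blast

lemma J_minimal:
  assumes "ideal I T" "\<And>i j. i \<in> {1..n} \<Longrightarrow> j \<in> {1..n} \<Longrightarrow> rel q i j \<in> I"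
  shows "J \<subseteq> I"
  unfolding J_eq using assms by (intro T.genideal_minimal) auto

sublocale S: algebra_ideal T J
  using J_ideal T.algebra_over_axioms by (simp add: algebra_ideal_def)

lemma S_Q: "S.Q = q_algebra n q" by (simp add: q_algebra_def)

lemma J_closed: "x \<in> J \<Longrightarrow> x \<in> carrier T" using S.I.a_subset by blast

text \<open>
  The conditions describe the elements that have no component in degrees 0 and 1 and whose
  quadratic component is a combination of relations.  They define an ideal, because the
  quadratic component of a product with such an element is obtained by multiplication with
  a constant term.
\<close>

lemma J_low:
  assumes "x \<in> J"
  shows "x [] = 0" "x [i] = 0" "k \<in> {1..n} \<Longrightarrow> l \<in> {1..n} \<Longrightarrow> x [l, k] = - q k l * x [k, l]"
proof -
  let ?I = "{x \<in> carrier T. x [] = 0 \<and> (\<forall>i. x [i] = 0)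
    \<and> (\<forall>k\<in>{1..n}. \<forall>l\<in>{1..n}. x [l, k] = - q k l * x [k, l])}"
  have "ideal ?I T"
  proof (rule T.idealI')
    fix x y assume x: "x \<in> ?I" and y: "y \<in> carrier T"
    hence c: "x \<in> carrier T" "x [] = 0" "\<And>i. x [i] = 0" by auto
    have sw: "x [l, k] = - q k l * x [k, l]" if "k \<in> {1..n}" "l \<in> {1..n}" for k l
      using x that by blast
    have "conv x y [] = 0" "conv x y [i] = 0" "conv y x [] = 0" "conv y x [i] = 0"
      "conv x y [k, l] = x [k, l] * y []" "conv y x [k, l] = y [] * x [k, l]" for i k l
      using c by simp_all
    note cv = this
    have "conv x y [l, k] = - q k l * conv x y [k, l]" "conv y x [l, k] = - q k l * conv y x [k, l]"
      if "k \<in> {1..n}" "l \<in> {1..n}" for k l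
      unfolding cv(5,6) by (subst sw[OF that], simp)+
    thus "x \<otimes>\<^bsub>T\<^esub> y \<in> ?I" "y \<otimes>\<^bsub>T\<^esub> x \<in> ?I"
      using free_mult_closed[OF c(1) y] free_mult_closed[OF y c(1)] cv(1-4)
      unfolding free_algebra_simps by blast+
  next
    fix x y assume x: "x \<in> ?I" and y: "y \<in> ?I"
    have "x [l, k] + y [l, k] = - q k l * (x [k, l] + y [k, l])"
      if "k \<in> {1..n}" "l \<in> {1..n}" for k l
    proof -
      have "x [l, k] = - q k l * x [k, l]" "y [l, k] = - q k l * y [k, l]" using x y that by blast+
      thus ?thesis by (simp only: distrib_left)
    qed
    moreover have "x [] + y [] = 0" "x [i] + y [i] = 0" for i using x y by simp_all
    moreover have "(\<lambda>w. x w + y w) \<in> carrier T" using x y by (intro free_add_closed) blast+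
    ultimately show "x \<oplus>\<^bsub>T\<^esub> y \<in> ?I" unfolding free_algebra_simps by blast
  next
    show "\<zero>\<^bsub>T\<^esub> \<in> ?I" by (simp add: mem_free_algebra)
  qed blast
  moreover have "rel q i j \<in> ?I" if "i \<in> {1..n}" "j \<in> {1..n}" for i j
  proof -
    have "rel q i j [l, k] = - q k l * rel q i j [k, l]" for k l
    proof (cases "i = j")
      case True
      thus ?thesis using q_diag[OF that(1)] by (simp add: rel_def wd_def)
    next
      case False
      have "q i j * q j i = 1" "q j i * q i j = 1" using that q_swap by auto
      with False show ?thesis by (simp add: rel_def wd_def)
    qed
    moreover have "rel q i j [] = 0" "rel q i j [k] = 0" for k by (simp_all add: rel_def wd_def)
    ultimately show ?thesis using rel_closed[OF that, of q] by blast
  qed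
  ultimately have "J \<subseteq> ?I" by (rule J_minimal)
  thus "x [] = 0" "x [i] = 0" "k \<in> {1..n} \<Longrightarrow> l \<in> {1..n} \<Longrightarrow> x [l, k] = - q k l * x [k, l]"
    using assms by blast+
qed

lemma J_len_part: assumes "x \<in> J" shows "len_part m x \<in> J"
proof -
  let ?I = "{x \<in> carrier T. \<forall>m. len_part m x \<in> J}"
  have "ideal ?I T"
  proof (rule T.idealI')
    fix x y assume x: "x \<in> ?I" and y: "y \<in> carrier T"
    hence "len_part i x \<otimes>\<^bsub>T\<^esub> len_part k y \<in> J" "len_part k y \<otimes>\<^bsub>T\<^esub> len_part i x \<in> J" for i k
      using S.I.I_r_closed[of "len_part i x" "len_part k y"]
        S.I.I_l_closed[of "len_part i x" "len_part k y"] by (auto simp del: free_algebra_simps)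
    hence "(\<Oplus>\<^bsub>T\<^esub>i\<in>{..m}. len_part i x \<otimes>\<^bsub>T\<^esub> len_part (m - i) y) \<in> J"
      "(\<Oplus>\<^bsub>T\<^esub>i\<in>{..m}. len_part i y \<otimes>\<^bsub>T\<^esub> len_part (m - i) x) \<in> J" for m
      by (auto intro!: T.finsum_closed_subset S.I.a_subset simp del: free_algebra_simps)
    thus "x \<otimes>\<^bsub>T\<^esub> y \<in> ?I" "y \<otimes>\<^bsub>T\<^esub> x \<in> ?I"
      using x y by (auto simp: T.cmp_mult simp del: free_algebra_simps)
  next
    show "\<zero>\<^bsub>T\<^esub> \<in> ?I" by (auto simp del: free_algebra_simps)
  next
    fix x y assume "x \<in> ?I" "y \<in> ?I"
    thus "x \<oplus>\<^bsub>T\<^esub> y \<in> ?I" by (auto simp: T.cmp_add simp del: free_algebra_simps)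
  qed auto
  moreover have "rel q i j \<in> ?I" if "i \<in> {1..n}" "j \<in> {1..n}" for i j
  proof -
    have "len_part m (rel q i j) = (if m = 2 then rel q i j else \<zero>\<^bsub>T\<^esub>)" for m
      by (auto simp: len_part_def rel_def wd_def)
    thus ?thesis using rel_in_J[OF that] J_closed by (auto simp del: free_algebra_simps)
  qed
  ultimately have "J \<subseteq> ?I" by (rule J_minimal)
  thus ?thesis using assms by auto
qed

text \<open>
  Each relation occurs twice, as \<^term>\<open>rel q k l\<close> and as a multiple of \<^term>\<open>rel q l k\<close>; hence
  the factor \<open>1/2\<close>.
\<close>

lemma quadratic_J:
  assumes "x \<in> J" "\<And>w. x w \<noteq> 0 \<Longrightarrow> length w = 2"
  shows "x w = (\<Sum>(k, l)\<in>{1..n} \<times> {1..n}. x [k, l] / 2 * rel q k l w)"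
proof -
  let ?N = "{1..n}"
  have xc: "x \<in> carrier T" using assms J_closed by simp
  have "(\<Sum>(k, l)\<in>?N \<times> ?N. x [k, l] / 2 * rel q k l w)
      = (\<Sum>(k, l)\<in>?N \<times> ?N. x [k, l] / 2 * wd [k, l] w) + (\<Sum>(k, l)\<in>?N \<times> ?N. x [l, k] / 2 * wd [l, k] w)"
    unfolding sum.distrib[symmetric]
  proof (intro sum.cong refl, clarify)
    fix k l assume "k \<in> ?N" "l \<in> ?N"
    thus "x [k, l] / 2 * rel q k l w = x [k, l] / 2 * wd [k, l] w + x [l, k] / 2 * wd [l, k] w"
      by (subst J_low(3)[OF assms(1), of k l]) (simp_all add: rel_def algebra_simps)
  qed
  also have "(\<Sum>(k, l)\<in>?N \<times> ?N. x [l, k] / 2 * wd [l, k] w)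
      = (\<Sum>(k, l)\<in>?N \<times> ?N. x [k, l] / 2 * wd [k, l] w)"
    by (rule sum.reindex_bij_witness[of _ prod.swap prod.swap]) auto
  also have "(\<Sum>(k, l)\<in>?N \<times> ?N. x [k, l] / 2 * wd [k, l] w) + (\<Sum>(k, l)\<in>?N \<times> ?N. x [k, l] / 2 * wd [k, l] w)
      = (\<Sum>(k, l)\<in>?N \<times> ?N. if w = [k, l] then x w else 0)"
    unfolding sum.distrib[symmetric] by (intro sum.cong refl) (auto simp: wd_def)
  also have "\<dots> = x w"
  proof (cases "x w = 0")
    case False
    hence "length w = 2" "set w \<subseteq> ?N" using assms(2) free_letters[OF xc] by auto
    then obtain k l where kl: "w = [k, l]" "k \<in> ?N" "l \<in> ?N"
      by (cases w; cases "tl w") auto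
    have "(\<Sum>(k', l')\<in>?N \<times> ?N. if w = [k', l'] then x w else 0)
        = (\<Sum>z\<in>?N \<times> ?N. if z = (k, l) then x w else 0)"
      by (intro sum.cong refl) (auto simp: kl split: if_splits)
    thus ?thesis using kl by simp
  next
    case True
    hence "(\<Sum>(k, l)\<in>?N \<times> ?N. if w = [k, l] then x w else 0) = 0"
      by (intro sum.neutral) auto
    thus ?thesis using True by simp
  qed
  finally show ?thesis ..
qed

end

text \<open>
  The group acts on \<open>V\<close> by the matrices \<open>M g\<close>, where \<open>M g i k\<close> is the coordinate of \<open>v\<^sub>k\<close> in the
  image of \<open>v\<^sub>i\<close>; this accounts for the order of the factors in the composition law.
\<close>

locale q_action = q_system n q + G: group G
  for n :: nat and q :: "nat \<Rightarrow> nat \<Rightarrow> complex" and G :: "('g, 'h) monoid_scheme" +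
  fixes M :: "'g \<Rightarrow> nat \<Rightarrow> nat \<Rightarrow> complex"
    and \<alpha> :: "'g \<Rightarrow> (nat list \<Rightarrow> complex) set \<Rightarrow> (nat list \<Rightarrow> complex) set"
  assumes finite_G: "finite (carrier G)"
    and M_one: "i \<in> {1..n} \<Longrightarrow> k \<in> {1..n} \<Longrightarrow> M \<one>\<^bsub>G\<^esub> i k = (if i = k then 1 else 0)"
    and M_comp: "g \<in> carrier G \<Longrightarrow> h \<in> carrier G \<Longrightarrow> j \<in> {1..n} \<Longrightarrow> k \<in> {1..n}
      \<Longrightarrow> M (g \<otimes>\<^bsub>G\<^esub> h) j k = (\<Sum>i=1..n. M h j i * M g i k)"
    and \<alpha>_acts: "acts_by_automorphisms G (q_algebra n q) \<alpha>"
    and \<alpha>_gen: "g \<in> carrier G \<Longrightarrow> i \<in> {1..n}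
      \<Longrightarrow> \<alpha> g (q_gen n q i) = q_ideal n q +>\<^bsub>free_algebra n\<^esub> wact n (M g) (free_gen i)"
begin

abbreviation gmult (infixl "\<cdot>" 70) where "g \<cdot> h \<equiv> g \<otimes>\<^bsub>G\<^esub> h"

abbreviation act where "act g \<equiv> wact n (M g)"

text \<open>
  The action on the free algebra, restricted to the carrier as group actions have to be.
\<close>

definition \<tau> where "\<tau> g = (\<lambda>f\<in>carrier T. act g f)"

lemma act_act: "g \<in> carrier G \<Longrightarrow> h \<in> carrier G \<Longrightarrow> act g (act h f) = act (g \<cdot> h) f"
  by (rule ext, rule wact_comp) (rule M_comp)

lemma act_id: assumes "f \<in> carrier T" shows "act \<one>\<^bsub>G\<^esub> f = f"
proof
  fix u
  show "act \<one>\<^bsub>G\<^esub> f u = f u"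
  proof (cases "set u \<subseteq> {1..n}")
    case True thus ?thesis by (intro wact_id M_one)
  next
    case False
    hence "act \<one>\<^bsub>G\<^esub> f u = 0" "f u = 0"
      using wact_nonzero[of n "M \<one>\<^bsub>G\<^esub>" f u] free_letters[OF assms, of u] by blast+
    thus ?thesis by simp
  qed
qed

lemma act_conv: "act g (conv f h) = conv (act g f) (act g h)"
  by (rule ext) (rule wact_conv)

lemma act_closed [simp, intro]: "f \<in> carrier T \<Longrightarrow> act g f \<in> carrier T"
  by (rule wact_closed)

lemma act_one: "act g (\<lambda>w. if w = [] then 1 else 0) = (\<lambda>w. if w = [] then 1 else 0)"
proof
  fix u show "act g (\<lambda>w. if w = [] then 1 else 0) u = (if u = [] then 1 else 0)"
  proof (cases "u = []")
    case False
    have "act g (\<lambda>w. if w = [] then 1 else 0) u = 0"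
      by (rule ccontr, drule wact_nonzero) (use False in \<open>auto split: if_splits\<close>)
    thus ?thesis using False by simp
  qed simp
qed

lemma conv_assoc_fun: "conv (conv f h) k = conv f (conv h k)"
  by (rule ext) (rule conv_assoc)

lemma conv_smult_left_fun: "conv (\<lambda>w. x * a w) t = (\<lambda>w. x * conv a t w)"
  by (rule ext) (rule conv_smult_left)

lemma conv_smult_right_fun: "conv t (\<lambda>w. x * a w) = (\<lambda>w. x * conv t a w)"
  by (rule ext) (rule conv_smult_right)

lemma conv_add_left_fun: "conv (\<lambda>w. a w + b w) t = (\<lambda>w. conv a t w + conv b t w)"
  by (rule ext) (rule conv_add_left)

lemma conv_add_right_fun: "conv t (\<lambda>w. a w + b w) = (\<lambda>w. conv t a w + conv t b w)"
  by (rule ext) (rule conv_add_right)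

lemma act_add_fun: "act g (\<lambda>w. a w + b w) = (\<lambda>w. act g a w + act g b w)"
  by (rule ext) (rule wact_add)

lemma act_smult_fun: "act g (\<lambda>w. x * a w) = (\<lambda>w. x * act g a w)"
  by (rule ext) (rule wact_smult)

lemma conv_zero_right: "conv t (\<lambda>_. 0) = (\<lambda>_. 0)"
  using conv_smult_right_fun[of t 0 "\<lambda>_. 0"] by simp

lemma conv_zero_left_fun: "conv (\<lambda>_. 0) t = (\<lambda>_. 0)"
  by (rule ext) simp

lemma act_zero_fun: "act g (\<lambda>_. 0) = (\<lambda>_. 0)"
  using act_smult_fun[of g 0 "\<lambda>_. 0"] by simp

lemmas fun_linear = conv_add_left_fun conv_add_right_fun conv_smult_left_fun conv_smult_right_fun
  act_add_fun act_smult_fun conv_zero_right conv_zero_left_fun act_zero_fun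

lemma \<tau>_iso: assumes g: "g \<in> carrier G" shows "\<tau> g \<in> algebra_iso T T"
proof -
  have "\<tau> g \<in> ring_hom T T"
  proof (rule ring_hom_memI)
    fix x y assume xy: "x \<in> carrier T" "y \<in> carrier T"
    show "\<tau> g x \<in> carrier T" using xy by (simp add: \<tau>_def)
    show "\<tau> g (x \<otimes>\<^bsub>T\<^esub> y) = \<tau> g x \<otimes>\<^bsub>T\<^esub> \<tau> g y"
      using xy free_mult_closed[OF xy] by (simp add: \<tau>_def act_conv)
    show "\<tau> g (x \<oplus>\<^bsub>T\<^esub> y) = \<tau> g x \<oplus>\<^bsub>T\<^esub> \<tau> g y"
      using xy free_add_closed[OF xy] by (simp add: \<tau>_def fun_eq_iff wact_add)
  next
    have "(\<lambda>w. if w = [] then 1 else 0) \<in> carrier T" using T.one_closed by simp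
    thus "\<tau> g \<one>\<^bsub>T\<^esub> = \<one>\<^bsub>T\<^esub>" by (simp add: \<tau>_def act_one)
  qed
  moreover have "bij_betw (\<tau> g) (carrier T) (carrier T)"
  proof (rule bij_betwI[where g = "\<tau> (inv\<^bsub>G\<^esub> g)"])
    fix x assume "x \<in> carrier T"
    thus "\<tau> (inv\<^bsub>G\<^esub> g) (\<tau> g x) = x" "\<tau> g (\<tau> (inv\<^bsub>G\<^esub> g) x) = x"
      using g by (simp_all add: \<tau>_def act_act act_id)
  qed (auto simp: \<tau>_def)
  ultimately show ?thesis
    by (auto simp: algebra_iso_def ring_iso_def \<tau>_def wact_smult free_smult_closed fun_eq_iff)
qed

lemma \<tau>_acts: "acts_by_automorphisms G T \<tau>"
proof -
  have bij: "\<tau> g \<in> Bij (carrier T)" if "g \<in> carrier G" for g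
    using algebra_isoD(6)[OF \<tau>_iso[OF that]] by (simp add: Bij_def) (simp add: \<tau>_def)
  have "group_hom G (BijGroup (carrier T)) \<tau>"
  proof (rule group_hom.intro[OF G.group_axioms group_BijGroup group_hom_axioms.intro], rule homI)
    fix g h assume "g \<in> carrier G" "h \<in> carrier G"
    thus "\<tau> (g \<cdot> h) = \<tau> g \<otimes>\<^bsub>BijGroup (carrier T)\<^esub> \<tau> h"
      using bij by (auto simp: BijGroup_def compose_def fun_eq_iff \<tau>_def act_act)
  qed (auto simp: BijGroup_def bij)
  thus ?thesis using \<tau>_iso by (simp add: acts_by_automorphisms_def group_action_def)
qed

text \<open>
  The relations of the Hecke algebra are imposed on \<open>E\<close>; the cocycle lives on \<open>R\<close>.
\<close>

sublocale E: skew_setting T G \<tau>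
  by unfold_locales (use finite_G \<tau>_acts in auto)

sublocale R: skew_setting S.Q G \<alpha>
  by unfold_locales (use finite_G \<alpha>_acts S_Q in auto)

abbreviation multE (infixl "\<otimes>\<^sub>E" 70) where "x \<otimes>\<^sub>E y \<equiv> x \<otimes>\<^bsub>E.B\<^esub> y"
abbreviation addE (infixl "\<oplus>\<^sub>E" 65) where "x \<oplus>\<^sub>E y \<equiv> x \<oplus>\<^bsub>E.B\<^esub> y"
abbreviation minusE (infixl "\<ominus>\<^sub>E" 65) where "x \<ominus>\<^sub>E y \<equiv> x \<ominus>\<^bsub>E.B\<^esub> y"
abbreviation smultE (infixr "\<odot>\<^sub>E" 75) where "c \<odot>\<^sub>E x \<equiv> c \<odot>\<^bsub>E.B\<^esub> x"

abbreviation multR (infixl "\<otimes>\<^sub>R" 70) where "x \<otimes>\<^sub>R y \<equiv> x \<otimes>\<^bsub>R.B\<^esub> y"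
abbreviation addR (infixl "\<oplus>\<^sub>R" 65) where "x \<oplus>\<^sub>R y \<equiv> x \<oplus>\<^bsub>R.B\<^esub> y"
abbreviation minusR (infixl "\<ominus>\<^sub>R" 65) where "x \<ominus>\<^sub>R y \<equiv> x \<ominus>\<^bsub>R.B\<^esub> y"
abbreviation smultR (infixr "\<odot>\<^sub>R" 75) where "c \<odot>\<^sub>R x \<equiv> c \<odot>\<^bsub>R.B\<^esub> x"

text \<open>
  Both sides are algebra homomorphisms that agree on the letters.
\<close>

lemma \<alpha>_proj:
  assumes g: "g \<in> carrier G" and "t \<in> carrier T"
  shows "\<alpha> g (S.proj t) = S.proj (act g t)"
  using assms(2)
proof (induction t rule: free_induct)
  case zero
  have "\<alpha> g (S.proj \<zero>\<^bsub>T\<^esub>) = S.proj \<zero>\<^bsub>T\<^esub>"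
    using R.act_zero[OF g] by (simp only: S.zero_quotient(2))
  moreover have "act g (\<lambda>w. 0) = (\<lambda>w. 0)" using wact_smult[of n "M g" 0 "\<lambda>_. 0"] by (simp add: fun_eq_iff)
  ultimately show ?case by simp
next
  case (add x y)
  have "\<alpha> g (S.proj (x \<oplus>\<^bsub>T\<^esub> y)) = \<alpha> g (S.proj x) \<oplus>\<^bsub>S.Q\<^esub> \<alpha> g (S.proj y)"
    using add g R.act_add by (simp del: free_algebra_simps flip: S.proj_add)
  also have "\<dots> = S.proj (act g x \<oplus>\<^bsub>T\<^esub> act g y)"
    using add by (simp del: free_algebra_simps)
  finally show ?case by (simp add: wact_add)
next
  case (smult c x)
  have "\<alpha> g (S.proj (c \<odot>\<^bsub>T\<^esub> x)) = c \<odot>\<^bsub>S.Q\<^esub> \<alpha> g (S.proj x)"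
    using smult g R.act_smult by (simp del: free_algebra_simps flip: S.proj_smult)
  also have "\<dots> = S.proj (c \<odot>\<^bsub>T\<^esub> act g x)"
    using smult by (simp del: free_algebra_simps)
  finally show ?case by (simp add: wact_smult)
next
  case (wd w)
  from wd(1) show ?case
  proof (induction w)
    case Nil
    have "wd [] = \<one>\<^bsub>T\<^esub>" by (auto simp: wd_def)
    moreover have "act g \<one>\<^bsub>T\<^esub> = \<one>\<^bsub>T\<^esub>" by (simp add: act_one)
    ultimately show ?case using R.act_one[OF g] by (simp only: S.proj_one)
  next
    case (Cons i w)
    have c: "wd [i] \<in> carrier T" "wd w \<in> carrier T" using Cons.prems by auto
    have e: "wd (i # w) = wd [i] \<otimes>\<^bsub>T\<^esub> wd w" by (simp add: conv_wd_wd)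
    have i: "\<alpha> g (S.proj (wd [i])) = S.proj (act g (wd [i]))"
      using \<alpha>_gen[OF g, of i] Cons.prems by (simp add: q_gen_def free_gen_eq_wd)
    have w: "\<alpha> g (S.proj (wd w)) = S.proj (act g (wd w))" using Cons by simp
    have "\<alpha> g (S.proj (wd (i # w))) = S.proj (act g (wd [i])) \<otimes>\<^bsub>S.Q\<^esub> S.proj (act g (wd w))"
      using c g i w R.act_mult[OF g, of "S.proj (wd [i])" "S.proj (wd w)"]
      by (simp add: e del: free_algebra_simps)
    also have "\<dots> = S.proj (act g (wd [i]) \<otimes>\<^bsub>T\<^esub> act g (wd w))"
      using c by (simp del: free_algebra_simps)
    also have "act g (wd [i]) \<otimes>\<^bsub>T\<^esub> act g (wd w) = act g (wd (i # w))"
      by (simp add: e act_conv)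
    finally show ?case .
  qed
qed

text \<open>
  Since the action on the quotient is well defined.
\<close>

lemma act_J: assumes "g \<in> carrier G" "x \<in> J" shows "act g x \<in> J"
proof -
  have "S.proj (act g x) = \<alpha> g (S.proj x)" using \<alpha>_proj assms J_closed by simp
  also have "S.proj x = \<zero>\<^bsub>S.Q\<^esub>" using assms S.proj_eq_zero_iff J_closed by (simp add: S.zero_quotient(1))
  also have "\<alpha> g \<zero>\<^bsub>S.Q\<^esub> = J" using assms by (simp add: R.act_zero) (simp add: S.zero_quotient(1))
  finally show ?thesis using S.proj_eq_zero_iff[of "act g x"] assms J_closed by simp
qed

lemma act_length:
  assumes "\<And>w. f w \<noteq> 0 \<Longrightarrow> length w = m" "act g f u \<noteq> 0"
  shows "length u = m"
  using wact_nonzero[OF assms(2)] assms(1) by metis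

text \<open>
  The image of a relation is a quadratic element of \<open>J\<close>, hence a combination of relations.
\<close>

lemma act_rel:
  assumes g: "g \<in> carrier G" and ij: "i \<in> {1..n}" "j \<in> {1..n}"
  shows "act g (rel q i j) w
    = (\<Sum>(k, l)\<in>{1..n} \<times> {1..n}. act g (rel q i j) [k, l] / 2 * rel q k l w)"
proof (rule quadratic_J)
  show "act g (rel q i j) \<in> J" using g ij rel_in_J act_J by blast
  have "length w = 2" if "rel q i j w \<noteq> 0" for w
    using that by (auto simp: rel_def wd_def split: if_splits)
  thus "length w = 2" if "act g (rel q i j) w \<noteq> 0" for w
    using act_length[OF _ that] by blast
qed

definition \<pi> where "\<pi> f = (\<lambda>g\<in>carrier G. S.proj (f g))"

lemma \<pi>_closed: "f \<in> carrier E.B \<Longrightarrow> \<pi> f \<in> carrier R.B"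
  by (auto simp: \<pi>_def R.carrier_skew E.carrier_skew)

lemma \<tau>_apply: "f \<in> carrier T \<Longrightarrow> \<tau> g f = act g f" by (simp add: \<tau>_def)

lemma \<pi>_hom: "\<pi> \<in> ring_hom E.B R.B"
proof (rule ring_hom_memI)
  fix x y assume xy: "x \<in> carrier E.B" "y \<in> carrier E.B"
  show "\<pi> x \<in> carrier R.B" using xy \<pi>_closed by simp
  show "\<pi> (x \<oplus>\<^sub>E y) = \<pi> x \<oplus>\<^sub>R \<pi> y"
    by (rule R.skew_eqI) (use xy \<pi>_closed in \<open>auto simp: \<pi>_def simp del: free_algebra_simps\<close>)
  show "\<pi> (x \<otimes>\<^sub>E y) = \<pi> x \<otimes>\<^sub>R \<pi> y"
  proof (rule R.skew_eqI)
    fix k assume k: "k \<in> carrier G"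
    have "\<pi> (x \<otimes>\<^sub>E y) k
        = (\<Oplus>\<^bsub>S.Q\<^esub>g\<in>carrier G. S.proj (x g \<otimes>\<^bsub>T\<^esub> \<tau> g (y (inv\<^bsub>G\<^esub> g \<cdot> k))))"
      using xy k finite_G
      by (simp add: \<pi>_def E.skew_mult_apply del: free_algebra_simps) (intro S.proj_finsum, auto simp del: free_algebra_simps)
    also have "\<dots> = (\<Oplus>\<^bsub>S.Q\<^esub>g\<in>carrier G. S.proj (x g) \<otimes>\<^bsub>S.Q\<^esub> \<alpha> g (S.proj (y (inv\<^bsub>G\<^esub> g \<cdot> k))))"
      using xy k by (intro S.Q.finsum_cong') (auto simp: \<alpha>_proj \<tau>_apply simp del: free_algebra_simps)
    also have "\<dots> = (\<pi> x \<otimes>\<^sub>R \<pi> y) k"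
      unfolding R.skew_mult_apply[OF k]
      using xy k by (intro S.Q.finsum_cong') (auto simp: \<pi>_def simp del: free_algebra_simps)
    finally show "\<pi> (x \<otimes>\<^sub>E y) k = (\<pi> x \<otimes>\<^sub>R \<pi> y) k" .
  qed (use xy \<pi>_closed in auto)
next
  show "\<pi> \<one>\<^bsub>E.B\<^esub> = \<one>\<^bsub>R.B\<^esub>"
    by (rule R.skew_eqI) (auto simp: \<pi>_closed, auto simp: \<pi>_def E.skew_one_eq R.skew_one_eq E.single_apply
        R.single_apply S.proj_one S.zero_quotient(2) simp del: free_algebra_simps)
qed

lemma \<pi>_smult: "x \<in> carrier E.B \<Longrightarrow> \<pi> (c \<odot>\<^sub>E x) = c \<odot>\<^sub>R \<pi> x"
  by (rule R.skew_eqI) (auto simp: \<pi>_closed, auto simp: \<pi>_def simp del: free_algebra_simps)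

lemma \<pi>_eq_iff:
  assumes "f \<in> carrier E.B" "h \<in> carrier E.B"
  shows "\<pi> f = \<pi> h \<longleftrightarrow> (\<forall>g\<in>carrier G. (f \<ominus>\<^sub>E h) g \<in> J)"
proof -
  have "\<pi> f = \<pi> h \<longleftrightarrow> (\<forall>g\<in>carrier G. S.proj (f g) = S.proj (h g))"
    unfolding \<pi>_def by (auto simp: fun_eq_iff restrict_def)
  thus ?thesis using assms by (auto simp: S.proj_eq_iff simp del: free_algebra_simps)
qed

text \<open>
  Group elements have degree 0.
\<close>

definition ecmp where "ecmp m f = (\<lambda>g\<in>carrier G. len_part m (f g))"

sublocale GE: graded_over E.B ecmp
proof (rule graded_over.intro[OF E.skew_algebra_over graded_over_axioms.intro])
  have cl: "ecmp m x \<in> carrier E.B" if "x \<in> carrier E.B" for m x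
    using that len_part_closed by (auto simp: E.carrier_skew ecmp_def PiE_iff)
  fix x y m k assume x: "x \<in> carrier E.B"
  show "ecmp m x \<in> carrier E.B" by (rule cl[OF x])
  show "ecmp m (c \<odot>\<^sub>E x) = c \<odot>\<^sub>E ecmp m x" for c
    by (rule E.skew_eqI) (use x cl in \<open>auto simp: ecmp_def T.cmp_smult simp del: free_algebra_simps\<close>)
  show "ecmp m (ecmp k x) = (if m = k then ecmp m x else \<zero>\<^bsub>E.B\<^esub>)"
    by (rule E.skew_eqI) (use x cl in \<open>auto simp: T.cmp_cmp simp del: free_algebra_simps\<close>,
      use x in \<open>auto simp: ecmp_def T.cmp_cmp simp del: free_algebra_simps\<close>)
  have "{m. ecmp m x \<noteq> \<zero>\<^bsub>E.B\<^esub>} \<subseteq> (\<Union>g\<in>carrier G. {m. len_part m (x g) \<noteq> \<zero>\<^bsub>T\<^esub>})"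
  proof
    fix m assume "m \<in> {m. ecmp m x \<noteq> \<zero>\<^bsub>E.B\<^esub>}"
    then obtain g where "g \<in> carrier G" "ecmp m x g \<noteq> \<zero>\<^bsub>E.B\<^esub> g"
      using E.skew_eqI[OF cl[OF x, of m] E.skew_zero_closed] by auto
    thus "m \<in> (\<Union>g\<in>carrier G. {m. len_part m (x g) \<noteq> \<zero>\<^bsub>T\<^esub>})"
      by (auto simp: ecmp_def simp del: free_algebra_simps)
  qed
  thus "finite {m. ecmp m x \<noteq> \<zero>\<^bsub>E.B\<^esub>}"
    by (rule finite_subset) (use x finite_G T.cmp_finite in auto)
  assume y: "y \<in> carrier E.B"
  show "ecmp m (x \<oplus>\<^sub>E y) = ecmp m x \<oplus>\<^sub>E ecmp m y"
    by (rule E.skew_eqI) (use x y cl in \<open>auto simp: ecmp_def T.cmp_add simp del: free_algebra_simps\<close>)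
  show "ecmp m (x \<otimes>\<^sub>E y) = (\<Oplus>\<^bsub>E.B\<^esub>i\<in>{..m}. ecmp i x \<otimes>\<^sub>E ecmp (m - i) y)"
  proof (rule E.skew_eqI)
    fix k assume k: "k \<in> carrier G"
    let ?y = "\<lambda>g. y (inv\<^bsub>G\<^esub> g \<cdot> k)"
    have comm: "len_part i (\<tau> g t) = \<tau> g (len_part i t)" if "t \<in> carrier T" for i g t
    proof
      fix u
      have "act g t u = act g (len_part (length u) t) u"
      proof -
        have "act g (\<lambda>w. t w + (- 1) * len_part (length u) t w) u = 0"
          by (rule ccontr, drule wact_nonzero) (auto simp: len_part_def)
        thus ?thesis unfolding wact_add wact_smult by simp
      qed
      moreover have "act g (len_part i t) u = 0" if "length u \<noteq> i"
        by (rule ccontr, drule wact_nonzero) (use that in \<open>auto simp: len_part_def split: if_splits\<close>)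
      ultimately show "len_part i (\<tau> g t) u = \<tau> g (len_part i t) u"
        using that len_part_closed[of t n i] by (simp add: \<tau>_def) (auto simp: len_part_def)
    qed
    have "ecmp m (x \<otimes>\<^sub>E y) k = (\<Oplus>\<^bsub>T\<^esub>g\<in>carrier G. len_part m (x g \<otimes>\<^bsub>T\<^esub> \<tau> g (?y g)))"
      using k x y finite_G
      by (simp add: ecmp_def E.skew_mult_apply del: free_algebra_simps)
        (intro T.cmp_finsum, auto simp del: free_algebra_simps)
    also have "\<dots> = (\<Oplus>\<^bsub>T\<^esub>g\<in>carrier G. \<Oplus>\<^bsub>T\<^esub>i\<in>{..m}. len_part i (x g) \<otimes>\<^bsub>T\<^esub> \<tau> g (len_part (m - i) (?y g)))"
      using x y k by (intro T.finsum_cong')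
        (auto intro!: T.finsum_closed simp: T.cmp_mult comm simp del: free_algebra_simps)
    also have "\<dots> = (\<Oplus>\<^bsub>T\<^esub>i\<in>{..m}. \<Oplus>\<^bsub>T\<^esub>g\<in>carrier G. len_part i (x g) \<otimes>\<^bsub>T\<^esub> \<tau> g (len_part (m - i) (?y g)))"
      using x y k finite_G by (intro T.finsum_swap) (auto simp del: free_algebra_simps)
    also have "\<dots> = (\<Oplus>\<^bsub>T\<^esub>i\<in>{..m}. (ecmp i x \<otimes>\<^sub>E ecmp (m - i) y) k)"
      unfolding E.skew_mult_apply[OF k] using x y k
      by (intro T.finsum_cong')
        (auto simp: ecmp_def intro!: T.finsum_closed T.finsum_cong' simp del: free_algebra_simps)
    also have "\<dots> = (\<Oplus>\<^bsub>E.B\<^esub>i\<in>{..m}. ecmp i x \<otimes>\<^sub>E ecmp (m - i) y) k"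
      using k x y cl by (intro E.skew_finsum_apply[symmetric]) auto
    finally show "ecmp m (x \<otimes>\<^sub>E y) k = (\<Oplus>\<^bsub>E.B\<^esub>i\<in>{..m}. ecmp i x \<otimes>\<^sub>E ecmp (m - i) y) k" .
  qed (use x y cl in \<open>auto intro!: E.B.finsum_closed\<close>)
next
  fix m
  show "ecmp m \<one>\<^bsub>E.B\<^esub> = (if m = 0 then \<one>\<^bsub>E.B\<^esub> else \<zero>\<^bsub>E.B\<^esub>)"
  proof -
    have "len_part m \<zero>\<^bsub>T\<^esub> = \<zero>\<^bsub>T\<^esub>" "len_part m \<one>\<^bsub>T\<^esub> = (if m = 0 then \<one>\<^bsub>T\<^esub> else \<zero>\<^bsub>T\<^esub>)"
      by (rule T.cmp_zero) (rule T.cmp_one)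
    thus ?thesis
      by (auto simp: ecmp_def E.skew_one_eq E.single_def skew_group_algebra_def fun_eq_iff
          simp del: free_algebra_simps)
  qed
qed

end

section \<open>Linear functionals on the free algebra\<close>

definition lin :: "(nat list \<Rightarrow> complex) \<Rightarrow> (nat list \<Rightarrow> complex) \<Rightarrow> complex" where
  "lin d t = (\<Sum>w | t w \<noteq> 0. t w * d w)"

lemma lin_eq_sum: "finite S \<Longrightarrow> {w. t w \<noteq> 0} \<subseteq> S \<Longrightarrow> lin d t = (\<Sum>w\<in>S. t w * d w)"
  unfolding lin_def by (rule sum.mono_neutral_left) auto

lemma lin_add:
  assumes "s \<in> carrier (free_algebra n)" "t \<in> carrier (free_algebra n)"
  shows "lin d (\<lambda>w. s w + t w) = lin d s + lin d t"
proof -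
  let ?S = "{w. s w \<noteq> 0} \<union> {w. t w \<noteq> 0}"
  have "finite ?S" using assms free_finite_support by auto
  moreover have "{w. s w + t w \<noteq> 0} \<subseteq> ?S" by auto
  ultimately show ?thesis
    by (simp add: lin_eq_sum[of ?S] distrib_right sum.distrib)
qed

lemma lin_smult: "lin d (\<lambda>w. c * t w) = c * lin d t"
  by (cases "c = 0") (simp_all add: lin_def sum_distrib_left mult.assoc)

lemma lin_wd [simp]: "lin d (wd w) = d w"
proof -
  have "{u. wd w u \<noteq> 0} = {w}" by (auto simp: wd_def)
  thus ?thesis by (simp add: lin_def) (simp add: wd_def)
qed

lemma wd_length: "wd w u \<noteq> 0 \<Longrightarrow> length u = length w"
  by (simp add: wd_def split: if_splits)

lemma lin_zero [simp]: "lin d (\<lambda>_. 0) = 0"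
  by (simp add: lin_def)

lemma lin_diff:
  assumes "s \<in> carrier (free_algebra n)" "t \<in> carrier (free_algebra n)"
  shows "lin d (\<lambda>w. s w - t w) = lin d s - lin d t"
  using lin_add[OF assms(1) free_smult_closed[OF assms(2), of "- 1"], of d] lin_smult[of d "- 1" t]
  by simp

lemma free_sum_closed:
  assumes "finite S" "\<And>i. i \<in> S \<Longrightarrow> f i \<in> carrier (free_algebra n)"
  shows "(\<lambda>w. \<Sum>i\<in>S. c i * f i w) \<in> carrier (free_algebra n)"
  using assms
proof (induction S rule: finite_induct)
  case empty
  thus ?case by (simp add: mem_free_algebra)
next
  case (insert i S)
  thus ?case by (simp add: free_add_closed free_smult_closed)
qed

lemma lin_sum:
  assumes "finite S" "\<And>i. i \<in> S \<Longrightarrow> f i \<in> carrier (free_algebra n)"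
  shows "lin d (\<lambda>w. \<Sum>i\<in>S. c i * f i w) = (\<Sum>i\<in>S. c i * lin d (f i))"
  using assms
proof (induction S rule: finite_induct)
  case (insert i S)
  hence "lin d (\<lambda>w. c i * f i w + (\<Sum>i\<in>S. c i * f i w))
      = lin d (\<lambda>w. c i * f i w) + lin d (\<lambda>w. \<Sum>i\<in>S. c i * f i w)"
    by (intro lin_add[of _ n] free_smult_closed free_sum_closed) auto
  thus ?case using insert by (simp add: lin_smult)
qed simp

lemma lin_cong: "(\<And>w. t w \<noteq> 0 \<Longrightarrow> d w = d' w) \<Longrightarrow> lin d t = lin d' t"
  unfolding lin_def by (intro sum.cong) auto

section \<open>Inversions of a word\<close>

text \<open>
  The number of inversions, which decreases when a descent is straightened.
\<close>

fun invs :: "nat list \<Rightarrow> nat" where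
  "invs [] = 0"
| "invs (x # w) = length (filter (\<lambda>y. y < x) w) + invs w"

lemma invs_swap: "j < i \<Longrightarrow> invs (u @ [j, i] @ u') < invs (u @ [i, j] @ u')"
  by (induction u) auto

definition desc :: "nat list \<Rightarrow> nat \<Rightarrow> bool" where
  "desc w p \<longleftrightarrow> Suc p < length w \<and> w ! Suc p < w ! p"

lemma desc_append: "desc (u @ [i, j] @ u') (length u) \<longleftrightarrow> j < i"
  by (simp add: desc_def nth_append)

lemma desc_decomp:
  assumes "desc w p"
  shows "w = take p w @ [w ! p, w ! Suc p] @ drop (p + 2) w"
  using assms unfolding desc_def
  by (metis Cons_nth_drop_Suc Suc_lessD add_2_eq_Suc' append_Cons append_Nil append_take_drop_id)

section \<open>The diamond lemma\<close>

text \<open>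
  \<open>K i j\<close> stands for \<open>\<kappa> (v\<^sub>i, v\<^sub>j)\<close>.  The second condition is the equivariance of \<open>\<kappa>\<close>: as a function
  of relations, \<open>\<kappa>\<close> takes the image of \<^term>\<open>rel q i j\<close> under \<open>g\<close> to \<open>g (K i j) g\<^sup>-\<^sup>1\<close>.  The
  third is the coefficient of \<open>h\<close> in
  \<open>\<kappa>\<^sub>i\<^sub>j v\<^sub>k + q\<^sub>i\<^sub>j v\<^sub>j \<kappa>\<^sub>i\<^sub>k + q\<^sub>i\<^sub>j q\<^sub>i\<^sub>k \<kappa>\<^sub>j\<^sub>k v\<^sub>i
     = v\<^sub>i \<kappa>\<^sub>j\<^sub>k + q\<^sub>j\<^sub>k \<kappa>\<^sub>i\<^sub>k v\<^sub>j + q\<^sub>j\<^sub>k q\<^sub>i\<^sub>k v\<^sub>k \<kappa>\<^sub>i\<^sub>j\<close>,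
  whose two sides are the lower terms that arise when \<open>v\<^sub>i v\<^sub>j v\<^sub>k\<close> is reversed in the two possible
  ways.
\<close>

locale pbw_data = q_action n q G M \<alpha>
  for n :: nat and q :: "nat \<Rightarrow> nat \<Rightarrow> complex" and G :: "('g, 'h) monoid_scheme"
    and M :: "'g \<Rightarrow> nat \<Rightarrow> nat \<Rightarrow> complex"
    and \<alpha> :: "'g \<Rightarrow> (nat list \<Rightarrow> complex) set \<Rightarrow> (nat list \<Rightarrow> complex) set" +
  fixes K :: "nat \<Rightarrow> nat \<Rightarrow> 'g \<Rightarrow> complex"
  assumes K_antisym: "i \<in> {1..n} \<Longrightarrow> j \<in> {1..n} \<Longrightarrow> h \<in> carrier G \<Longrightarrow> K i j h = - q i j * K j i h"
    and K_equivariant: "i \<in> {1..n} \<Longrightarrow> j \<in> {1..n} \<Longrightarrow> g \<in> carrier G \<Longrightarrow> h \<in> carrier G \<Longrightarrow>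
      (\<Sum>(k, l)\<in>{1..n} \<times> {1..n}. act g (rel q i j) [k, l] / 2 * K k l h)
        = K i j (inv\<^bsub>G\<^esub> g \<cdot> h \<cdot> g)"
    and K_jacobi: "i \<in> {1..n} \<Longrightarrow> j \<in> {1..n} \<Longrightarrow> k \<in> {1..n} \<Longrightarrow> h \<in> carrier G \<Longrightarrow>
      K i j h * act h (wd [k]) w + q i j * K i k h * wd [j] w + q i j * q i k * K j k h * act h (wd [i]) w
      = K j k h * wd [i] w + q j k * K i k h * act h (wd [j]) w + q j k * q i k * K i j h * wd [k] w"
begin

abbreviation N where "N \<equiv> {1..n}"

text \<open>
  The value of the functional \<open>c\<close> at \<open>u \<kappa>\<^sub>i\<^sub>j u' g\<close>, after the group elements that occur in \<open>\<kappa>\<^sub>i\<^sub>j\<close> have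
  been moved to the right past \<open>u'\<close>.
\<close>

definition lower_term :: "(nat list \<Rightarrow> 'g \<Rightarrow> complex) \<Rightarrow> nat list \<Rightarrow> nat \<Rightarrow> nat \<Rightarrow> nat list \<Rightarrow> 'g \<Rightarrow> complex" where
  "lower_term c u i j u' g
    = (\<Sum>h\<in>carrier G. K i j h * lin (\<lambda>w. c w (h \<cdot> g)) (conv (wd u) (act h (wd u'))))"

text \<open>
  The functional \<open>c\<close> vanishes at \<open>u (v\<^sub>i v\<^sub>j - q\<^sub>i\<^sub>j v\<^sub>j v\<^sub>i - \<kappa>\<^sub>i\<^sub>j) u' g\<close>.
\<close>

definition compat :: "(nat list \<Rightarrow> 'g \<Rightarrow> complex) \<Rightarrow> nat list \<Rightarrow> nat \<Rightarrow> nat \<Rightarrow> nat list \<Rightarrow> 'g \<Rightarrow> bool" where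
  "compat c u i j u' g \<longleftrightarrow>
     c (u @ [i, j] @ u') g - q i j * c (u @ [j, i] @ u') g = lower_term c u i j u' g"

text \<open>
  The functional respects all relations inside words of length \<open>m\<close>.
\<close>

definition solves :: "nat \<Rightarrow> (nat list \<Rightarrow> 'g \<Rightarrow> complex) \<Rightarrow> bool" where
  "solves m c \<longleftrightarrow> (\<forall>u i j u' g. set u \<subseteq> N \<longrightarrow> set u' \<subseteq> N \<longrightarrow> i \<in> N \<longrightarrow> j \<in> N \<longrightarrow> g \<in> carrier G
     \<longrightarrow> length u + length u' + 2 = m \<longrightarrow> compat c u i j u' g)"

lemma solves_words:
  assumes "solves m c" "set u \<subseteq> N" "set u' \<subseteq> N" "k \<in> N" "l \<in> N" "x \<in> carrier G"
    "length u + length u' + 2 = m"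
  shows "lin (\<lambda>w. c w x) (conv (wd u) (conv (rel q k l) (wd u')))
    = (\<Sum>h\<in>carrier G. K k l h * lin (\<lambda>w. c w (h \<cdot> x)) (conv (wd u) (act h (wd u'))))"
proof -
  have "conv (wd u) (conv (rel q k l) (wd u'))
      = (\<lambda>w. wd (u @ [k, l] @ u') w - q k l * wd (u @ [l, k] @ u') w)"
  proof
    fix w
    have "conv (rel q k l) (wd u') = (\<lambda>w. wd ([k, l] @ u') w + - q k l * wd ([l, k] @ u') w)"
      using conv_add_left[of "wd [k, l]" "\<lambda>w. - q k l * wd [l, k] w" "wd u'"]
        conv_smult_left[of "- q k l" "wd [l, k]" "wd u'"]
      by (simp add: rel_def conv_wd_wd fun_eq_iff)
    thus "conv (wd u) (conv (rel q k l) (wd u')) w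
      = wd (u @ [k, l] @ u') w - q k l * wd (u @ [l, k] @ u') w"
      using conv_add_right[of "wd u" "wd ([k, l] @ u')" "\<lambda>w. - q k l * wd ([l, k] @ u') w" w]
        conv_smult_right[of "wd u" "- q k l" "wd ([l, k] @ u')" w]
      by (simp add: conv_wd_wd)
  qed
  moreover have "wd (u @ [k, l] @ u') \<in> carrier T" "wd (u @ [l, k] @ u') \<in> carrier T"
    using assms by auto
  ultimately have "lin (\<lambda>w. c w x) (conv (wd u) (conv (rel q k l) (wd u')))
      = c (u @ [k, l] @ u') x - q k l * c (u @ [l, k] @ u') x"
    by (simp add: lin_diff[of _ n] lin_smult free_smult_closed)
  moreover have "compat c u k l u' x" using assms unfolding solves_def by blast
  ultimately show ?thesis by (simp only: compat_def lower_term_def)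
qed

lemma lin_conv_comb:
  assumes "s \<in> carrier T" "x \<in> carrier T" "y \<in> carrier T"
  shows "lin d (conv s (act h (\<lambda>w. x w + r * y w)))
      = lin d (conv s (act h x)) + r * lin d (conv s (act h y))"
    "lin d (conv (\<lambda>w. x w + r * y w) s) = lin d (conv x s) + r * lin d (conv y s)"
  using assms by (simp_all only: fun_linear lin_add[of _ n] lin_smult free_mult_closed act_closed
      free_smult_closed)

text \<open>
  The extension of the relation from words to homogeneous factors, by bilinearity.
\<close>

lemma solves_homogeneous:
  assumes "solves m c" "k \<in> N" "l \<in> N" "x \<in> carrier G" "a + b + 2 = m"
    "t \<in> carrier T" "\<And>w. t w \<noteq> 0 \<Longrightarrow> length w = a"
    "t' \<in> carrier T" "\<And>w. t' w \<noteq> 0 \<Longrightarrow> length w = b"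
  shows "lin (\<lambda>w. c w x) (conv t (conv (rel q k l) t'))
    = (\<Sum>h\<in>carrier G. K k l h * lin (\<lambda>w. c w (h \<cdot> x)) (conv t (act h t')))"
  using assms(6)
proof (induction t rule: free_induct)
  case (wd u)
  hence u: "set u \<subseteq> N" "length u = a" using assms(7) by auto
  from assms(8) show ?case
  proof (induction t' rule: free_induct)
    case (wd u')
    thus ?case using assms(1-5,9) u by (intro solves_words) auto
  next
    case (add s s')
    thus ?case using assms(2-4) u
      by (simp add: fun_linear lin_add[of _ n] distrib_left sum.distrib)
  next
    case (smult y s)
    thus ?case using assms(2-4) u
      by (simp add: fun_linear lin_smult sum_distrib_left mult.left_commute)
  qed (simp add: fun_linear)
next
  case (add s s')
  thus ?case using assms(2-4,8)
    by (simp add: fun_linear lin_add[of _ n] distrib_left sum.distrib)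
next
  case (smult y s)
  thus ?case using assms(2-4,8)
    by (simp add: fun_linear lin_smult sum_distrib_left mult.left_commute)
qed (simp add: fun_linear)

text \<open>
  The relation may also be preceded by a group element: \<open>g\<close> turns a relation into a combination of
  relations, and by equivariance the lower terms follow.  The sum over \<open>h\<close> is
  substituted by its conjugate.
\<close>

lemma solves_act:
  assumes c: "solves m c" and ij: "i \<in> N" "j \<in> N" and g: "g \<in> carrier G" and x: "x \<in> carrier G"
    and ab: "a + b + 2 = m"
    and t: "t \<in> carrier T" "\<And>w. t w \<noteq> 0 \<Longrightarrow> length w = a"
    and t': "t' \<in> carrier T" "\<And>w. t' w \<noteq> 0 \<Longrightarrow> length w = b"
  shows "lin (\<lambda>w. c w (g \<cdot> x)) (conv t (conv (act g (rel q i j)) (act g t')))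
    = (\<Sum>h\<in>carrier G. K i j h * lin (\<lambda>w. c w (g \<cdot> h \<cdot> x)) (conv t (act (g \<cdot> h) t')))"
proof -
  define e where "e k l = act g (rel q i j) [k, l] / 2" for k l
  let ?P = "N \<times> N"
  let ?L = "\<lambda>h. lin (\<lambda>w. c w (h \<cdot> (g \<cdot> x))) (conv t (act h (act g t')))"
  have gx: "g \<cdot> x \<in> carrier G" using g x by simp
  have rel: "act g (rel q i j) = (\<lambda>w. \<Sum>p\<in>?P. e (fst p) (snd p) * rel q (fst p) (snd p) w)"
  proof
    fix w
    show "act g (rel q i j) w = (\<Sum>p\<in>?P. e (fst p) (snd p) * rel q (fst p) (snd p) w)"
      unfolding e_def using act_rel[OF g ij, of w] unfolding case_prod_beta .
  qed
  have "conv t (conv (act g (rel q i j)) (act g t'))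
      = (\<lambda>w. \<Sum>p\<in>?P. e (fst p) (snd p) * conv t (conv (rel q (fst p) (snd p)) (act g t')) w)"
  proof -
    have "conv t (\<lambda>u. \<Sum>i\<in>S. c i * f i u) = (\<lambda>w. \<Sum>i\<in>S. c i * conv t (f i) w)"
      for S :: "(nat \<times> nat) set" and c f and t :: "nat list \<Rightarrow> complex"
      by (induction S rule: infinite_finite_induct) (simp_all add: fun_linear)
    moreover have "conv (\<lambda>u. \<Sum>i\<in>S. c i * f i u) t = (\<lambda>w. \<Sum>i\<in>S. c i * conv (f i) t w)"
      for S :: "(nat \<times> nat) set" and c f and t :: "nat list \<Rightarrow> complex" by (rule ext) (rule conv_sum_left)
    ultimately show ?thesis by (subst rel) simp
  qed
  hence "lin (\<lambda>w. c w (g \<cdot> x)) (conv t (conv (act g (rel q i j)) (act g t')))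
      = (\<Sum>p\<in>?P. e (fst p) (snd p)
          * lin (\<lambda>w. c w (g \<cdot> x)) (conv t (conv (rel q (fst p) (snd p)) (act g t'))))"
    using t t' g by (simp only:) (intro lin_sum[of _ _ n], auto)
  also have "\<dots> = (\<Sum>p\<in>?P. e (fst p) (snd p) * (\<Sum>h\<in>carrier G. K (fst p) (snd p) h * ?L h))"
    using c gx ab t t' act_length[of t' b g] by (intro sum.cong refl arg_cong2[of _ _ _ _ "(*)"] solves_homogeneous) auto
  also have "\<dots> = (\<Sum>h\<in>carrier G. (\<Sum>p\<in>?P. e (fst p) (snd p) * K (fst p) (snd p) h) * ?L h)"
    by (simp add: sum_distrib_left sum_distrib_right mult.assoc) (rule sum.swap)
  also have "\<dots> = (\<Sum>h\<in>carrier G. K i j (inv\<^bsub>G\<^esub> g \<cdot> h \<cdot> g) * ?L h)"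
    using K_equivariant[OF ij g] by (intro sum.cong refl) (simp only: case_prod_unfold e_def)
  also have "\<dots> = (\<Sum>h\<in>carrier G. K i j h * ?L (g \<cdot> h \<cdot> inv\<^bsub>G\<^esub> g))"
    using g by (intro sum.reindex_bij_witness[of _ "\<lambda>h. g \<cdot> h \<cdot> inv\<^bsub>G\<^esub> g" "\<lambda>h. inv\<^bsub>G\<^esub> g \<cdot> h \<cdot> g"])
      (auto simp: G.m_assoc, auto simp flip: G.m_assoc)
  also have "\<dots> = (\<Sum>h\<in>carrier G. K i j h * lin (\<lambda>w. c w (g \<cdot> h \<cdot> x)) (conv t (act (g \<cdot> h) t')))"
  proof (intro sum.cong refl)
    fix h assume h: "h \<in> carrier G"
    have e: "g \<cdot> h \<cdot> inv\<^bsub>G\<^esub> g \<cdot> (g \<cdot> x) = g \<cdot> h \<cdot> x"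
      "g \<cdot> h \<cdot> inv\<^bsub>G\<^esub> g \<cdot> g = g \<cdot> h"
      using g h x by (simp_all add: G.m_assoc G.inv_solve_left[symmetric] flip: G.m_assoc[of "inv\<^bsub>G\<^esub> g" g])
    show "K i j h * ?L (g \<cdot> h \<cdot> inv\<^bsub>G\<^esub> g)
      = K i j h * lin (\<lambda>w. c w (g \<cdot> h \<cdot> x)) (conv t (act (g \<cdot> h) t'))"
      using g h by (simp add: act_act e)
  qed
  finally show ?thesis .
qed

lemma length_conv_act:
  assumes "conv (wd a) (act h (wd b)) w \<noteq> 0"
  shows "length w = length a + length b"
proof -
  obtain x y where xy: "w = x @ y" "wd a x \<noteq> 0" "act h (wd b) y \<noteq> 0"
    using conv_nonzero[OF assms] by metis
  have "length y = length b" using wd_length by (rule act_length[OF _ xy(3)])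
  thus ?thesis using xy wd_length by simp
qed

text \<open>
  The word \<open>a v\<^sub>i v\<^sub>j b v\<^sub>k v\<^sub>l d\<close> is straightened at both places.  Straightening in either order leads to the
  same four words, so it remains to compare the lower terms.  These are
  \<open>a \<kappa>\<^sub>i\<^sub>j b r d\<close> and \<open>a r' b \<kappa>\<^sub>k\<^sub>l d\<close> with relations \<open>r\<close> and \<open>r'\<close>; both words are
  shorter, and applying the relations in them gives \<open>a \<kappa>\<^sub>i\<^sub>j b \<kappa>\<^sub>k\<^sub>l d\<close> in either case.
\<close>

lemma compat_disjoint:
  assumes c: "solves m c" and m: "m = length a + length b + length d + 2"
    and sets: "set a \<subseteq> N" "set b \<subseteq> N" "set d \<subseteq> N" "i \<in> N" "j \<in> N" "k \<in> N" "l \<in> N"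
    and g: "g \<in> carrier G"
    and 1: "compat c a i j (b @ [k, l] @ d) g"
    and 2: "compat c (a @ [j, i] @ b) k l d g"
    and 3: "compat c a i j (b @ [l, k] @ d) g"
  shows "compat c (a @ [i, j] @ b) k l d g"
proof -
  have rk: "(\<lambda>w. wd (b @ [k, l] @ d) w + - q k l * wd (b @ [l, k] @ d) w)
      = conv (wd b) (conv (rel q k l) (wd d))"
    and ri: "(\<lambda>w. wd (a @ [i, j] @ b) w + - q i j * wd (a @ [j, i] @ b) w)
      = conv (wd a) (conv (rel q i j) (wd b))"
  proof -
    show "(\<lambda>w. wd (b @ [k, l] @ d) w + - q k l * wd (b @ [l, k] @ d) w)
      = conv (wd b) (conv (rel q k l) (wd d))"
     "(\<lambda>w. wd (a @ [i, j] @ b) w + - q i j * wd (a @ [j, i] @ b) w)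
      = conv (wd a) (conv (rel q i j) (wd b))"
      by (simp_all only: rel_alt fun_linear conv_wd_wd)
  qed
  let ?L = "\<lambda>h h'. lin (\<lambda>w. c w (h \<cdot> h' \<cdot> g))
    (conv (wd a) (conv (act h (wd b)) (act (h \<cdot> h') (wd d))))"
  have "lower_term c a i j (b @ [k, l] @ d) g - q k l * lower_term c a i j (b @ [l, k] @ d) g
      = (\<Sum>h\<in>carrier G. K i j h * lin (\<lambda>w. c w (h \<cdot> g))
          (conv (wd a) (act h (\<lambda>w. wd (b @ [k, l] @ d) w + - q k l * wd (b @ [l, k] @ d) w))))"
  proof -
    have "(\<Sum>h\<in>carrier G. K i j h * lin (\<lambda>w. c w (h \<cdot> g))
          (conv (wd a) (act h (\<lambda>w. wd (b @ [k, l] @ d) w + - q k l * wd (b @ [l, k] @ d) w))))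
      = (\<Sum>h\<in>carrier G. K i j h * (lin (\<lambda>w. c w (h \<cdot> g)) (conv (wd a) (act h (wd (b @ [k, l] @ d))))
          + - q k l * lin (\<lambda>w. c w (h \<cdot> g)) (conv (wd a) (act h (wd (b @ [l, k] @ d))))))"
      using sets by (intro sum.cong refl arg_cong2[of _ _ _ _ "(*)"] lin_conv_comb) auto
    thus ?thesis
      by (simp only: lower_term_def) (simp add: algebra_simps sum_subtractf sum_distrib_left)
  qed
  also have "\<dots> = (\<Sum>h\<in>carrier G. K i j h * lin (\<lambda>w. c w (h \<cdot> g))
          (conv (conv (wd a) (act h (wd b))) (conv (act h (rel q k l)) (act h (wd d)))))"
    unfolding rk by (simp add: act_conv conv_assoc_fun)
  also have "\<dots> = (\<Sum>h\<in>carrier G. K i j h * (\<Sum>h'\<in>carrier G. K k l h' * ?L h h'))"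
  proof (intro sum.cong refl arg_cong2[of _ _ _ _ "(*)"])
    fix h assume h: "h \<in> carrier G"
    note len = length_conv_act[of a h b]
    have "lin (\<lambda>w. c w (h \<cdot> g))
          (conv (conv (wd a) (act h (wd b))) (conv (act h (rel q k l)) (act h (wd d))))
      = (\<Sum>h'\<in>carrier G. K k l h' * lin (\<lambda>w. c w (h \<cdot> h' \<cdot> g))
          (conv (conv (wd a) (act h (wd b))) (act (h \<cdot> h') (wd d))))"
      by (rule solves_act[OF c, of _ _ _ _ "length a + length b" "length d"])
        (use sets h g m len wd_length in auto)
    thus "lin (\<lambda>w. c w (h \<cdot> g))
          (conv (conv (wd a) (act h (wd b))) (conv (act h (rel q k l)) (act h (wd d))))
      = (\<Sum>h'\<in>carrier G. K k l h' * ?L h h')"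
      by (simp only: conv_assoc_fun)
  qed
  also have "\<dots> = (\<Sum>h'\<in>carrier G. K k l h' * (\<Sum>h\<in>carrier G. K i j h * ?L h h'))"
    by (simp add: sum_distrib_left mult.left_commute) (rule sum.swap)
  also have "\<dots> = (\<Sum>h'\<in>carrier G. K k l h' * lin (\<lambda>w. c w (h' \<cdot> g))
          (conv (wd a) (conv (rel q i j) (conv (wd b) (act h' (wd d))))))"
  proof (intro sum.cong refl arg_cong2[of _ _ _ _ "(*)"])
    fix h' assume h': "h' \<in> carrier G"
    note len = length_conv_act[of b h' d]
    have "lin (\<lambda>w. c w (h' \<cdot> g)) (conv (wd a) (conv (rel q i j) (conv (wd b) (act h' (wd d)))))
      = (\<Sum>h\<in>carrier G. K i j h * lin (\<lambda>w. c w (h \<cdot> (h' \<cdot> g)))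
          (conv (wd a) (act h (conv (wd b) (act h' (wd d))))))"
      using sets h' g m len
      by (intro solves_homogeneous[OF c, of _ _ _ "length a" "length b + length d"])
        (auto dest: wd_length)
    thus "(\<Sum>h\<in>carrier G. K i j h * ?L h h')
      = lin (\<lambda>w. c w (h' \<cdot> g)) (conv (wd a) (conv (rel q i j) (conv (wd b) (act h' (wd d)))))"
      using h' g by (simp add: act_conv act_act G.m_assoc)
  qed
  also have "\<dots> = (\<Sum>h\<in>carrier G. K k l h * lin (\<lambda>w. c w (h \<cdot> g))
          (conv (\<lambda>w. wd (a @ [i, j] @ b) w + - q i j * wd (a @ [j, i] @ b) w) (act h (wd d))))"
    unfolding ri by (simp add: conv_assoc_fun)
  also have "\<dots> = lower_term c (a @ [i, j] @ b) k l d g - q i j * lower_term c (a @ [j, i] @ b) k l d g"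
  proof -
    have "(\<Sum>h\<in>carrier G. K k l h * lin (\<lambda>w. c w (h \<cdot> g))
          (conv (\<lambda>w. wd (a @ [i, j] @ b) w + - q i j * wd (a @ [j, i] @ b) w) (act h (wd d))))
      = (\<Sum>h\<in>carrier G. K k l h * (lin (\<lambda>w. c w (h \<cdot> g)) (conv (wd (a @ [i, j] @ b)) (act h (wd d)))
          + - q i j * lin (\<lambda>w. c w (h \<cdot> g)) (conv (wd (a @ [j, i] @ b)) (act h (wd d)))))"
      using sets by (intro sum.cong refl arg_cong2[of _ _ _ _ "(*)"] lin_conv_comb) auto
    thus ?thesis
      by (simp only: lower_term_def) (simp add: algebra_simps sum_subtractf sum_distrib_left)
  qed
  finally have "lower_term c a i j (b @ [k, l] @ d) g - q k l * lower_term c a i j (b @ [l, k] @ d) g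
    = lower_term c (a @ [i, j] @ b) k l d g - q i j * lower_term c (a @ [j, i] @ b) k l d g" .
  thus ?thesis using 1 2 3 unfolding compat_def by (simp add: algebra_simps)
qed

text \<open>
  The word \<open>a v\<^sub>i v\<^sub>j v\<^sub>k d\<close> can be turned into \<open>a v\<^sub>k v\<^sub>j v\<^sub>i d\<close> by three exchanges in two ways.  Five of
  the six exchanges are known to be compatible; the sixth follows because the lower terms of the
  two ways agree by the Jacobi identity.
\<close>

lemma compat_overlap:
  assumes sets: "set a \<subseteq> N" "set d \<subseteq> N" "i \<in> N" "j \<in> N" "k \<in> N" and g: "g \<in> carrier G"
    and 1: "compat c a i j (k # d) g" and 2: "compat c (a @ [j]) i k d g" and 3: "compat c a j k (i # d) g"
    and 4: "compat c a i k (j # d) g" and 5: "compat c (a @ [k]) i j d g"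
  shows "compat c (a @ [i]) j k d g"
proof -
  define \<Phi> where "\<Phi> h y = lin (\<lambda>w. c w (h \<cdot> g)) (conv (wd a) (conv y (act h (wd d))))" for h y
  have L1: "lower_term c a x y (z # d) g = (\<Sum>h\<in>carrier G. K x y h * \<Phi> h (act h (wd [z])))" for x y z
  proof -
    have "wd (z # d) = conv (wd [z]) (wd d)" by (simp add: conv_wd_wd)
    thus ?thesis by (simp add: lower_term_def \<Phi>_def act_conv)
  qed
  have L2: "lower_term c (a @ [z]) x y d g = (\<Sum>h\<in>carrier G. K x y h * \<Phi> h (wd [z]))" for x y z
    by (simp add: lower_term_def \<Phi>_def conv_wd_wd[symmetric] conv_assoc_fun)
  have \<Phi>_add: "\<Phi> h (\<lambda>w. x w + y w) = \<Phi> h x + \<Phi> h y"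
    if "x \<in> carrier T" "y \<in> carrier T" for h x y
    using that sets by (simp add: \<Phi>_def fun_linear lin_add[of _ n])
  have \<Phi>_smult: "\<Phi> h (\<lambda>w. r * x w) = r * \<Phi> h x" for h r x
    by (simp add: \<Phi>_def fun_linear lin_smult)
  have key: "K i j h * \<Phi> h (act h (wd [k])) + q i j * K i k h * \<Phi> h (wd [j])
      + q i j * q i k * K j k h * \<Phi> h (act h (wd [i]))
    = K j k h * \<Phi> h (wd [i]) + q j k * K i k h * \<Phi> h (act h (wd [j]))
      + q j k * q i k * K i j h * \<Phi> h (wd [k])" if h: "h \<in> carrier G" for h
  proof -
    have "\<Phi> h (\<lambda>w. (K i j h * act h (wd [k]) w + q i j * K i k h * wd [j] w)
        + q i j * q i k * K j k h * act h (wd [i]) w)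
      = \<Phi> h (\<lambda>w. (K j k h * wd [i] w + q j k * K i k h * act h (wd [j]) w)
        + q j k * q i k * K i j h * wd [k] w)"
      using K_jacobi[OF sets(3-5) h] by simp
    moreover have c: "wd [i] \<in> carrier T" "wd [j] \<in> carrier T" "wd [k] \<in> carrier T"
      using sets by auto
    ultimately show ?thesis
      by (simp only: \<Phi>_add \<Phi>_smult act_closed free_add_closed free_smult_closed)
  qed
  have "lower_term c a i j (k # d) g + q i j * lower_term c (a @ [j]) i k d g
      + q i j * q i k * lower_term c a j k (i # d) g
    = lower_term c (a @ [i]) j k d g + q j k * lower_term c a i k (j # d) g
      + q j k * q i k * lower_term c (a @ [k]) i j d g"
    unfolding L1 L2 sum_distrib_left sum.distrib[symmetric]
    by (intro sum.cong refl) (use key in \<open>simp add: mult.assoc\<close>)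
  thus ?thesis using 1 2 3 4 5 unfolding compat_def by (simp add: algebra_simps)
qed

lemma compat_antisym:
  assumes "compat c u j i u' g" "i \<in> N" "j \<in> N"
  shows "compat c u i j u' g"
proof -
  have "lower_term c u i j u' g = - q i j * lower_term c u j i u' g"
    using K_antisym[OF assms(2,3)] by (simp add: lower_term_def sum_distrib_left mult.assoc sum_negf)
  thus ?thesis using assms(1) q_swap[OF assms(2,3)] unfolding compat_def
    by (simp add: algebra_simps)
qed

lemma compat_refl:
  assumes "i \<in> N"
  shows "compat c u i i u' g"
proof -
  have "K i i h = 0" if "h \<in> carrier G" for h
    using K_antisym[OF assms assms that] q_diag[OF assms] by simp
  thus ?thesis using q_diag[OF assms] by (simp add: compat_def lower_term_def)
qed

text \<open>
  The functional with the values \<open>b\<close> at sorted words, computed by straightening the first descent.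
  The inner sum is the value of the functional at \<open>u (h u')\<close>, written over the finite set of all
  words of that length so that the recursive calls are visible.
\<close>

function sol :: "(nat list \<Rightarrow> 'g \<Rightarrow> complex) \<Rightarrow> nat list \<Rightarrow> 'g \<Rightarrow> complex" where
  "sol b w g = (if \<exists>p. desc w p then
     let p = (LEAST p. desc w p) in
       q (w ! p) (w ! Suc p) * sol b (take p w @ [w ! Suc p, w ! p] @ drop (p + 2) w) g
       + (\<Sum>h\<in>carrier G. K (w ! p) (w ! Suc p) h *
           (\<Sum>w'\<in>{w'. set w' \<subseteq> N \<and> length w' = length w - 2}.
              conv (wd (take p w)) (act h (wd (drop (p + 2) w))) w' * sol b w' (h \<cdot> g)))
     else b w g)"
  by pat_completeness auto
termination
proof (relation "measures [\<lambda>(b, w, g). length w, \<lambda>(b, w, g). invs w]")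
  fix b :: "nat list \<Rightarrow> 'g \<Rightarrow> complex" and w and g :: 'g and p
  assume "\<exists>p. desc w p" and p: "p = (LEAST p. desc w p)"
  hence d: "desc w p" by (auto intro: LeastI_ex)
  have e: "w = take p w @ [w ! p, w ! Suc p] @ drop (p + 2) w" by (rule desc_decomp[OF d])
  define w1 where "w1 = take p w @ [w ! Suc p, w ! p] @ drop (p + 2) w"
  have "invs w1 < invs (take p w @ [w ! p, w ! Suc p] @ drop (p + 2) w)"
    unfolding w1_def using d by (intro invs_swap) (simp add: desc_def)
  also have "\<dots> = invs w" by (rule arg_cong[OF e[symmetric]])
  finally have "invs w1 < invs w" .
  moreover have "length w1 = length w"
    using arg_cong[OF e, of length] by (simp add: w1_def)
  ultimately show "((b, take p w @ [w ! Suc p, w ! p] @ drop (p + 2) w, g), b, w, g)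
      \<in> measures [\<lambda>(b, w, g). length w, \<lambda>(b, w, g). invs w]"
    unfolding w1_def[symmetric] by simp
  fix h w' assume "w' \<in> {w'. set w' \<subseteq> N \<and> length w' = length w - 2}"
  thus "((b, w', h \<cdot> g), b, w, g) \<in> measures [\<lambda>(b, w, g). length w, \<lambda>(b, w, g). invs w]"
    using d by (auto simp: desc_def)
qed simp

declare sol.simps [simp del]

lemma sol_sorted: "\<not> (\<exists>p. desc w p) \<Longrightarrow> sol b w g = b w g"
  by (subst sol.simps) (simp only: if_False)

lemma sol_first_descent:
  assumes "set u \<subseteq> N" "set u' \<subseteq> N" "j < i"
    and first: "\<And>p. p < length u \<Longrightarrow> \<not> desc (u @ [i, j] @ u') p"
  shows "compat (sol b) u i j u' g"
proof -
  let ?w = "u @ [i, j] @ u'"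
  have d: "desc ?w (length u)" using assms by (simp only: desc_append)
  have p: "(LEAST p. desc ?w p) = length u"
    using d first by (intro Least_equality) (auto simp: not_less[symmetric])
  have "(\<Sum>w'\<in>{w'. set w' \<subseteq> N \<and> length w' = length ?w - 2}.
          conv (wd u) (act h (wd u')) w' * sol b w' (h \<cdot> g))
      = lin (\<lambda>w. sol b w (h \<cdot> g)) (conv (wd u) (act h (wd u')))" for h
  proof (rule lin_eq_sum[symmetric])
    show "finite {w'. set w' \<subseteq> N \<and> length w' = length ?w - 2}" by (rule finite_lists_length_eq) simp
    have "conv (wd u) (act h (wd u')) \<in> carrier T" using assms by auto
    thus "{w. conv (wd u) (act h (wd u')) w \<noteq> 0} \<subseteq> {w'. set w' \<subseteq> N \<and> length w' = length ?w - 2}"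
      using free_letters length_conv_act[of u h u'] by auto
  qed
  hence "sol b ?w g = q i j * sol b (u @ [j, i] @ u') g + lower_term (sol b) u i j u' g"
    using d by (subst sol.simps) (auto simp: Let_def p[simplified] lower_term_def nth_append)
  thus ?thesis by (simp add: compat_def)
qed

text \<open>
  Induction on the length and, inside, on the number of inversions.  At the first descent
  the relation holds by construction.  Any other descent lies to the right of it and either
  overlaps with it or is disjoint from it; all other exchanges that the two diamonds involve concern
  words with fewer inversions.
\<close>

lemma solves_sol: "solves m (sol b)"
proof (induction m rule: less_induct)
  case (less m)
  have main: "compat (sol b) u i j u' g"
    if "length u + length u' + 2 = m" "set u \<subseteq> N" "set u' \<subseteq> N" "i \<in> N" "j \<in> N" "j < i" "g \<in> carrier G"
    for u i j u' g
    using that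
  proof (induction "invs (u @ [i, j] @ u')" arbitrary: u i j u' rule: less_induct)
    case (less u i j u')
    let ?w = "u @ [i, j] @ u'"
    define p where "p = (LEAST p. desc ?w p)"
    have "desc ?w (length u)" using less.prems by (simp only: desc_append)
    hence p: "desc ?w p" "p \<le> length u" "\<And>p'. p' < p \<Longrightarrow> \<not> desc ?w p'"
      unfolding p_def by (auto intro: LeastI Least_le dest: not_less_Least)
    consider "p = length u" | "length u = Suc p" | "length u \<ge> p + 2" using p(2) by linarith
    thus ?case
    proof cases
      case 1
      thus ?thesis using p less.prems by (intro sol_first_descent) auto
    next
      case 2
      define a i0 where "a = take p u" and "i0 = u ! p"
      have u: "u = a @ [i0]" using 2 by (simp add: a_def i0_def take_Suc_conv_app_nth[symmetric])
      have la: "length a = p" using 2 by (simp add: a_def)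
      have "i < i0" using p(1) la unfolding u by (simp add: desc_def nth_append)
      note order = \<open>i < i0\<close> \<open>j < i\<close>
      have inv: "invs ((a @ [i]) @ [i0, j] @ u') < invs ?w" "invs (a @ [i0, j] @ i # u') < invs ?w"
        using invs_swap[of i i0 a "j # u'"] invs_swap[of j i "a @ [i0]" u'] order by (simp_all add: u)
      have inv': "invs (a @ [i, j] @ i0 # u') < invs ((a @ [i]) @ [i0, j] @ u')"
        "invs ((a @ [j]) @ [i0, i] @ u') < invs (a @ [i0, j] @ i # u')"
        using invs_swap[of j i0 "a @ [i]" u'] invs_swap[of j i0 a "i # u'"] order by simp_all
      have sets: "set a \<subseteq> N" "i0 \<in> N" using less.prems by (auto simp: u)
      show ?thesis unfolding u
      proof (rule compat_overlap[of a u' i0 i j])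
        show "compat (sol b) a i0 i (j # u') g"
          using order sets less.prems p(3) by (intro sol_first_descent) (auto simp: la u)
        show "compat (sol b) (a @ [i]) i0 j u' g"
          by (rule less.hyps) (use inv order sets less.prems in \<open>auto simp: u\<close>)
        show "compat (sol b) a i j (i0 # u') g"
          by (rule less.hyps) (use inv inv' order sets less.prems in \<open>auto simp: u\<close>)
        show "compat (sol b) a i0 j (i # u') g"
          by (rule less.hyps) (use inv order sets less.prems in \<open>auto simp: u\<close>)
        show "compat (sol b) (a @ [j]) i0 i u' g"
          by (rule less.hyps) (use inv inv' order sets less.prems in \<open>auto simp: u\<close>)
      qed (use sets less.prems in auto)
    next
      case 3
      define a i0 j0 c where "a = take p u" and "i0 = u ! p" and "j0 = u ! Suc p" and "c = drop (p + 2) u"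
      have "u ! p # u ! Suc p # drop (Suc (Suc p)) u = drop p u"
        using 3 by (simp add: Cons_nth_drop_Suc)
      hence "take p u @ u ! p # u ! Suc p # drop (Suc (Suc p)) u = u" by simp
      hence u: "u = a @ [i0, j0] @ c" by (simp add: a_def i0_def j0_def c_def)
      have la: "length a = p" using 3 by (simp add: a_def)
      have "j0 < i0" using p(1) la unfolding u by (simp add: desc_def nth_append)
      note order = this \<open>j < i\<close>
      have inv: "invs ((a @ [j0, i0] @ c) @ [i, j] @ u') < invs ?w"
        using invs_swap[of j0 i0 a "c @ [i, j] @ u'"] order by (simp add: u)
      have inv': "invs (a @ [i0, j0] @ c @ [j, i] @ u') < invs ?w"
        using invs_swap[of j i "a @ [i0, j0] @ c" u'] order by (simp add: u)
      have sets: "set a \<subseteq> N" "i0 \<in> N" "j0 \<in> N" "set c \<subseteq> N" using less.prems by (auto simp: u)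
      show ?thesis unfolding u
      proof (rule compat_disjoint[of "length a + length c + length u' + 2"])
        show "solves (length a + length c + length u' + 2) (sol b)"
          using less.prems(1) by (intro \<open>\<And>k. k < m \<Longrightarrow> solves k (sol b)\<close>) (simp add: u)
        show "compat (sol b) a i0 j0 (c @ [i, j] @ u') g"
          using order sets less.prems p(3) by (intro sol_first_descent) (auto simp: la u)
        show "compat (sol b) (a @ [j0, i0] @ c) i j u' g"
          by (rule less.hyps) (use inv order sets less.prems in \<open>auto simp: u\<close>)
        show "compat (sol b) a i0 j0 (c @ [j, i] @ u') g"
          by (rule less.hyps) (use inv' order sets less.prems in \<open>auto simp: u\<close>)
      qed (use sets less.prems in auto)
    qed
  qed
  show ?case
    unfolding solves_def
  proof (intro allI impI)
    fix u i j u' g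
    assume *: "set u \<subseteq> N" "set u' \<subseteq> N" "i \<in> N" "j \<in> N" "g \<in> carrier G" "length u + length u' + 2 = m"
    consider "j < i" | "i < j" | "i = j" by linarith
    thus "compat (sol b) u i j u' g"
    proof cases
      case 1 thus ?thesis using * by (intro main)
    next
      case 2 show ?thesis by (rule compat_antisym[OF main]) (use * 2 in auto)
    next
      case 3 thus ?thesis using * compat_refl by simp
    qed
  qed
qed

text \<open>
  Straightening never increases the length.
\<close>

lemma solution_vanishes:
  assumes c: "\<And>m. solves m c"
    and sorted: "\<And>w g. \<not> (\<exists>p. desc w p) \<Longrightarrow> length w < m \<Longrightarrow> c w g = 0"
  shows "set w \<subseteq> N \<Longrightarrow> length w < m \<Longrightarrow> g \<in> carrier G \<Longrightarrow> c w g = 0"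
proof (induction w arbitrary: g rule: wf_induct_rule[OF wf_measures[of "[length, invs]"]])
  case (1 w)
  show ?case
  proof (cases "\<exists>p. desc w p")
    case False
    thus ?thesis using sorted 1 by simp
  next
    case True
    then obtain p where p: "desc w p" by blast
    define u i j u' where "u = take p w" and "i = w ! p" and "j = w ! Suc p" and "u' = drop (p + 2) w"
    have w: "w = u @ [i, j] @ u'" unfolding u_def i_def j_def u'_def by (rule desc_decomp[OF p])
    have ji: "j < i" using p by (simp add: desc_def i_def j_def)
    have sets: "set u \<subseteq> N" "set u' \<subseteq> N" "i \<in> N" "j \<in> N" using 1(2) unfolding w by auto
    have sw: "c (u @ [j, i] @ u') g = 0"
      using 1(2-4) invs_swap[OF ji, of u u'] by (intro 1(1)) (auto simp: w)
    have "lin (\<lambda>w. c w (h \<cdot> g)) (conv (wd u) (act h (wd u'))) = 0" if h: "h \<in> carrier G" for h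
    proof -
      have "lin (\<lambda>w. c w (h \<cdot> g)) (conv (wd u) (act h (wd u')))
          = lin (\<lambda>_. 0) (conv (wd u) (act h (wd u')))"
      proof (rule lin_cong)
        fix w' assume w': "conv (wd u) (act h (wd u')) w' \<noteq> 0"
        have "conv (wd u) (act h (wd u')) \<in> carrier T" using sets by auto
        hence "set w' \<subseteq> N" using w' by (rule free_letters)
        thus "c w' (h \<cdot> g) = 0"
          using length_conv_act[OF w'] 1(3,4) h by (intro 1(1)) (auto simp: w)
      qed
      thus ?thesis by (simp add: lin_def)
    qed
    hence "lower_term c u i j u' g = 0" by (simp add: lower_term_def)
    moreover have "compat c u i j u' g"
      using c[of "length u + length u' + 2"] sets 1(4) unfolding solves_def by blast
    ultimately show ?thesis using sw by (simp add: compat_def w)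
  qed
qed

section \<open>The Hecke ideal\<close>

text \<open>
  The linear functional on \<open>E\<close> with the value \<open>c w g\<close> at \<open>w g\<close>.
\<close>

definition pairing :: "(nat list \<Rightarrow> 'g \<Rightarrow> complex) \<Rightarrow> ('g \<Rightarrow> nat list \<Rightarrow> complex) \<Rightarrow> complex" where
  "pairing c f = (\<Sum>g\<in>carrier G. lin (\<lambda>w. c w g) (f g))"

lemma pairing_add:
  assumes "x \<in> carrier E.B" "y \<in> carrier E.B"
  shows "pairing c (x \<oplus>\<^sub>E y) = pairing c x + pairing c y"
  using assms by (simp add: pairing_def lin_add[of _ n] sum.distrib)

lemma pairing_smult: "pairing c (r \<odot>\<^sub>E x) = r * pairing c x"
  by (simp add: pairing_def lin_smult sum_distrib_left)

lemma pairing_zero: "pairing c \<zero>\<^bsub>E.B\<^esub> = 0"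
  by (simp add: pairing_def)

lemma pairing_diff:
  assumes "x \<in> carrier E.B" "y \<in> carrier E.B"
  shows "pairing c (x \<ominus>\<^sub>E y) = pairing c x - pairing c y"
  using assms pairing_add[of x "(- 1) \<odot>\<^sub>E y" c] pairing_smult[of c "- 1" y]
  by (simp add: a_minus_def E.B.minus_eq_smult)

lemma pairing_finsum:
  "finite S \<Longrightarrow> f \<in> S \<rightarrow> carrier E.B \<Longrightarrow> pairing c (\<Oplus>\<^bsub>E.B\<^esub>i\<in>S. f i) = (\<Sum>i\<in>S. pairing c (f i))"
  by (induction S rule: finite_induct) (auto simp: pairing_zero pairing_add Pi_def)

lemma pairing_single:
  assumes "g \<in> carrier G"
  shows "pairing c (E.single t g) = lin (\<lambda>w. c w g) t"
proof -
  have "pairing c (E.single t g) = (\<Sum>k\<in>carrier G. if k = g then lin (\<lambda>w. c w g) t else 0)"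
    unfolding pairing_def by (intro sum.cong refl) (auto simp: E.single_apply)
  thus ?thesis using assms finite_G by simp
qed

definition kappaE :: "nat \<Rightarrow> nat \<Rightarrow> 'g \<Rightarrow> nat list \<Rightarrow> complex" where
  "kappaE i j = group_algebra_incl T G (K i j)"

definition hecke_rel :: "nat \<Rightarrow> nat \<Rightarrow> 'g \<Rightarrow> nat list \<Rightarrow> complex" where
  "hecke_rel i j = E.single (rel q i j) \<one>\<^bsub>G\<^esub> \<ominus>\<^sub>E kappaE i j"

lemma kappaE_eq: "kappaE i j = (\<Oplus>\<^bsub>E.B\<^esub>k\<in>carrier G. E.single (K i j k \<odot>\<^bsub>T\<^esub> \<one>\<^bsub>T\<^esub>) k)"
proof -
  have c: "kappaE i j \<in> carrier E.B"
    by (auto simp: kappaE_def group_algebra_incl_def E.carrier_skew simp del: free_algebra_simps)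
  show ?thesis by (subst E.skew_eq_finsum_single[OF c], intro E.B.finsum_cong' refl)
      (auto simp: kappaE_def group_algebra_incl_def simp del: free_algebra_simps)
qed

lemma kappaE_closed [simp, intro]: "kappaE i j \<in> carrier E.B"
  by (auto simp: kappaE_def group_algebra_incl_def E.carrier_skew simp del: free_algebra_simps)

lemma hecke_rel_closed [simp, intro]: "i \<in> N \<Longrightarrow> j \<in> N \<Longrightarrow> hecke_rel i j \<in> carrier E.B"
  by (auto simp: hecke_rel_def)

lemma pairing_single_hecke_rel:
  assumes c: "\<And>m. solves m c" and ij: "i \<in> N" "j \<in> N" and g: "g \<in> carrier G" and h: "h \<in> carrier G"
    and u: "set u \<subseteq> N" "set u' \<subseteq> N"
  shows "pairing c (E.single (wd u) g \<otimes>\<^sub>E hecke_rel i j \<otimes>\<^sub>E E.single (wd u') h) = 0"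
proof -
  let ?a = "E.single (wd u) g" and ?b = "E.single (wd u') h"
  let ?r = "E.single (rel q i j) \<one>\<^bsub>G\<^esub>"
  have cl: "?a \<in> carrier E.B" "?b \<in> carrier E.B" "?r \<in> carrier E.B" using u ij by auto
  have gen: "?a \<otimes>\<^sub>E E.single t k \<otimes>\<^sub>E ?b
      = E.single (conv (wd u) (conv (act g t) (act (g \<cdot> k) (wd u')))) (g \<cdot> k \<cdot> h)"
    if "t \<in> carrier T" "k \<in> carrier G" for t k
    using that u g h by (simp add: E.single_mult_single \<tau>_apply conv_assoc_fun)
  have r: "pairing c (?a \<otimes>\<^sub>E ?r \<otimes>\<^sub>E ?b)
      = lin (\<lambda>w. c w (g \<cdot> h)) (conv (wd u) (conv (act g (rel q i j)) (act g (wd u'))))"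
    using ij g h by (simp add: gen pairing_single)
  have k: "pairing c (?a \<otimes>\<^sub>E kappaE i j \<otimes>\<^sub>E ?b)
      = (\<Sum>k\<in>carrier G. K i j k * lin (\<lambda>w. c w (g \<cdot> k \<cdot> h)) (conv (wd u) (act (g \<cdot> k) (wd u'))))"
  proof -
    let ?s = "\<lambda>k. E.single (K i j k \<odot>\<^bsub>T\<^esub> \<one>\<^bsub>T\<^esub>) k"
    have sc: "?s k \<in> carrier E.B" for k by (auto simp del: free_algebra_simps)
    have "?a \<otimes>\<^sub>E kappaE i j \<otimes>\<^sub>E ?b = (\<Oplus>\<^bsub>E.B\<^esub>k\<in>carrier G. ?a \<otimes>\<^sub>E ?s k \<otimes>\<^sub>E ?b)"
      unfolding kappaE_eq using sc cl finite_G
      by (simp only: E.B.finsum_rdistr E.B.finsum_ldistr Pi_I E.skew_mult_closed)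
    hence "pairing c (?a \<otimes>\<^sub>E kappaE i j \<otimes>\<^sub>E ?b)
        = (\<Sum>k\<in>carrier G. pairing c (?a \<otimes>\<^sub>E ?s k \<otimes>\<^sub>E ?b))"
      using sc cl finite_G by (simp only: pairing_finsum Pi_I E.skew_mult_closed)
    also have "\<dots> = (\<Sum>k\<in>carrier G. K i j k * lin (\<lambda>w. c w (g \<cdot> k \<cdot> h))
        (conv (wd u) (act (g \<cdot> k) (wd u'))))"
    proof (intro sum.cong refl)
      fix k assume k: "k \<in> carrier G"
      have "K i j k \<odot>\<^bsub>T\<^esub> \<one>\<^bsub>T\<^esub> \<in> carrier T" by (simp del: free_algebra_simps)
      moreover have "conv (act g (K i j k \<odot>\<^bsub>T\<^esub> \<one>\<^bsub>T\<^esub>)) x = (\<lambda>w. K i j k * x w)" for x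
        by (simp add: fun_linear act_one) (simp add: fun_eq_iff conv_one_left)
      ultimately show "pairing c (?a \<otimes>\<^sub>E ?s k \<otimes>\<^sub>E ?b)
        = K i j k * lin (\<lambda>w. c w (g \<cdot> k \<cdot> h)) (conv (wd u) (act (g \<cdot> k) (wd u')))"
        using k g h by (simp only: gen pairing_single G.m_closed fun_linear lin_smult)
    qed
    finally show ?thesis .
  qed
  have "?a \<otimes>\<^sub>E hecke_rel i j \<otimes>\<^sub>E ?b
      = ?a \<otimes>\<^sub>E ?r \<otimes>\<^sub>E ?b \<ominus>\<^sub>E ?a \<otimes>\<^sub>E kappaE i j \<otimes>\<^sub>E ?b"
    unfolding hecke_rel_def a_minus_def using cl
    by (simp add: E.B.r_distr E.B.l_distr E.B.r_minus E.B.l_minus)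
  hence "pairing c (?a \<otimes>\<^sub>E hecke_rel i j \<otimes>\<^sub>E ?b)
      = pairing c (?a \<otimes>\<^sub>E ?r \<otimes>\<^sub>E ?b) - pairing c (?a \<otimes>\<^sub>E kappaE i j \<otimes>\<^sub>E ?b)"
    using cl by (simp add: pairing_diff)
  also have "\<dots> = 0"
    unfolding r k
    by (subst solves_act[OF c ij g h refl, of "wd u" "length u" "wd u'" "length u'"])
      (use u wd_length in auto)
  finally show ?thesis .
qed

lemma skew_single_induct [consumes 1, case_names add smult zero single]:
  assumes f: "f \<in> carrier E.B"
    and add: "\<And>x y. x \<in> carrier E.B \<Longrightarrow> y \<in> carrier E.B \<Longrightarrow> P x \<Longrightarrow> P y \<Longrightarrow> P (x \<oplus>\<^sub>E y)"
    and smult: "\<And>c x. x \<in> carrier E.B \<Longrightarrow> P x \<Longrightarrow> P (c \<odot>\<^sub>E x)"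
    and zero: "P \<zero>\<^bsub>E.B\<^esub>"
    and single: "\<And>u g. set u \<subseteq> N \<Longrightarrow> g \<in> carrier G \<Longrightarrow> P (E.single (wd u) g)"
  shows "P f"
proof -
  have s: "P (E.single t g)" if "t \<in> carrier T" "g \<in> carrier G" for t g
    using that(1)
  proof (induction t rule: free_induct)
    case zero
    thus ?case using assms(4) E.single_zero by simp
  next
    case (add x y)
    thus ?case using assms(2)[of "E.single x g" "E.single y g"] E.single_add[of x y g] by simp
  next
    case (smult c x)
    thus ?case using assms(3)[of "E.single x g" c] E.single_smult[of x c g] by simp
  qed (use single that in auto)
  have "(\<Oplus>\<^bsub>E.B\<^esub>g\<in>carrier G. E.single (f g) g) \<in> {x \<in> carrier E.B. P x}"
    using finite_G f s zero add by (intro E.B.finsum_closed_subset) auto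
  thus ?thesis using E.skew_eq_finsum_single[OF f] by simp
qed

definition hecke where "hecke = Idl\<^bsub>E.B\<^esub> {hecke_rel i j | i j. i \<in> N \<and> j \<in> N}"

lemma hecke_rels_closed: "{hecke_rel i j | i j. i \<in> N \<and> j \<in> N} \<subseteq> carrier E.B" by auto

lemma hecke_ideal: "ideal hecke E.B"
  unfolding hecke_def by (rule E.B.genideal_ideal[OF hecke_rels_closed])

lemma hecke_rel_in_hecke: "i \<in> N \<Longrightarrow> j \<in> N \<Longrightarrow> hecke_rel i j \<in> hecke"
  unfolding hecke_def using E.B.genideal_self[OF hecke_rels_closed] by blast

lemma pairing_hecke_rel:
  assumes c: "\<And>m. solves m c" and ij: "i \<in> N" "j \<in> N" and a: "a \<in> carrier E.B" and b: "b \<in> carrier E.B"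
  shows "pairing c (a \<otimes>\<^sub>E hecke_rel i j \<otimes>\<^sub>E b) = 0"
  using a
proof (induction a rule: skew_single_induct)
  case (add x y)
  thus ?case using b ij by (simp add: E.B.l_distr pairing_add)
next
  case (smult r x)
  thus ?case using b ij by (simp add: E.B.smult_m_assoc pairing_smult)
next
  case zero
  thus ?case using b ij by (simp add: pairing_zero)
next
  case (single u g)
  hence ug: "E.single (wd u) g \<in> carrier E.B" by auto
  from b show ?case
  proof (induction b rule: skew_single_induct)
    case (add x y)
    thus ?case using ug ij by (simp add: E.B.r_distr pairing_add)
  next
    case (smult r x)
    thus ?case using ug ij by (simp add: E.B.m_smult_assoc pairing_smult)
  next
    case zero
    thus ?case using ug ij by (simp add: pairing_zero)
  next
    case (single u' h)
    thus ?case using pairing_single_hecke_rel[OF c ij] \<open>set u \<subseteq> N\<close> \<open>g \<in> carrier G\<close> by simp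
  qed
qed

text \<open>
  The elements whose products \<open>a f b\<close> are all annihilated form an ideal in the kernel of the
  functional.
\<close>

lemma pairing_hecke:
  assumes c: "\<And>m. solves m c" and f: "f \<in> hecke"
  shows "pairing c f = 0"
proof -
  let ?I = "{f \<in> carrier E.B. \<forall>a\<in>carrier E.B. \<forall>b\<in>carrier E.B. pairing c (a \<otimes>\<^sub>E f \<otimes>\<^sub>E b) = 0}"
  have "ideal ?I E.B"
  proof (rule E.B.idealI')
    fix x y assume x: "x \<in> ?I" and y: "y \<in> carrier E.B"
    have "a \<otimes>\<^sub>E (x \<otimes>\<^sub>E y) \<otimes>\<^sub>E b = a \<otimes>\<^sub>E x \<otimes>\<^sub>E (y \<otimes>\<^sub>E b)"
      "a \<otimes>\<^sub>E (y \<otimes>\<^sub>E x) \<otimes>\<^sub>E b = (a \<otimes>\<^sub>E y) \<otimes>\<^sub>E x \<otimes>\<^sub>E b"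
      if "a \<in> carrier E.B" "b \<in> carrier E.B" for a b
      using that x y by (simp_all add: E.B.m_assoc)
    thus "x \<otimes>\<^sub>E y \<in> ?I" "y \<otimes>\<^sub>E x \<in> ?I" using x y by auto
  qed (auto simp: E.B.r_distr E.B.l_distr pairing_add pairing_zero)
  moreover have "hecke_rel i j \<in> ?I" if "i \<in> N" "j \<in> N" for i j
    using that pairing_hecke_rel[OF c] by auto
  ultimately have "hecke \<subseteq> ?I"
    unfolding hecke_def by (intro E.B.genideal_minimal) auto
  hence "f \<in> carrier E.B" "pairing c (\<one>\<^bsub>E.B\<^esub> \<otimes>\<^sub>E f \<otimes>\<^sub>E \<one>\<^bsub>E.B\<^esub>) = 0" using f by auto
  thus ?thesis by simp
qed

sublocale GI: graded_ideal E.B ecmp hecke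
  using hecke_ideal GE.graded_over_axioms E.skew_algebra_over
  by (simp add: graded_ideal_def algebra_ideal_def)

lemma ecmp_single: "ecmp m (E.single t g) = E.single (len_part m t) g"
  by (auto simp: ecmp_def E.single_def len_part_def fun_eq_iff)

text \<open>
  Identifies both the filtration and the grading of \<open>E\<close> with those given by the length of words.
\<close>

lemma ecmp_vanishing_eq:
  "{f \<in> carrier E.B. \<forall>m. P m \<longrightarrow> ecmp m f = \<zero>\<^bsub>E.B\<^esub>}
    = carrier G \<rightarrow>\<^sub>E {t \<in> carrier T. \<forall>w. t w \<noteq> 0 \<longrightarrow> \<not> P (length w)}"
proof (intro equalityI subsetI)
  fix f assume f: "f \<in> {f \<in> carrier E.B. \<forall>m. P m \<longrightarrow> ecmp m f = \<zero>\<^bsub>E.B\<^esub>}"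
  have "\<not> P (length w)" if g: "g \<in> carrier G" "f g w \<noteq> 0" for g w
  proof
    assume "P (length w)"
    hence "ecmp (length w) f g w = 0" using f g by simp
    thus False using g by (simp add: ecmp_def len_part_def)
  qed
  thus "f \<in> carrier G \<rightarrow>\<^sub>E {t \<in> carrier T. \<forall>w. t w \<noteq> 0 \<longrightarrow> \<not> P (length w)}"
    using f by (auto simp: E.carrier_skew PiE_iff)
next
  fix f assume f: "f \<in> carrier G \<rightarrow>\<^sub>E {t \<in> carrier T. \<forall>w. t w \<noteq> 0 \<longrightarrow> \<not> P (length w)}"
  hence fc: "f \<in> carrier E.B" by (auto simp: E.carrier_skew PiE_iff)
  have "ecmp m f = \<zero>\<^bsub>E.B\<^esub>" if "P m" for m
  proof (rule E.skew_eqI)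
    fix g assume g: "g \<in> carrier G"
    hence "\<forall>w. f g w \<noteq> 0 \<longrightarrow> \<not> P (length w)" using f by auto
    thus "ecmp m f g = \<zero>\<^bsub>E.B\<^esub> g" using that g by (auto simp: ecmp_def len_part_def fun_eq_iff)
  qed (use fc in auto)
  thus "f \<in> {f \<in> carrier E.B. \<forall>m. P m \<longrightarrow> ecmp m f = \<zero>\<^bsub>E.B\<^esub>}" using fc by simp
qed

lemma filt_eq: "GE.filt d = skew_part G (free_filtration n) d"
  unfolding GE.filt_def ecmp_vanishing_eq skew_part_def free_filtration_def by (simp add: not_less)

lemma grad_eq: "GE.grad d = skew_part G (free_grade n) d"
  unfolding GE.grad_def ecmp_vanishing_eq skew_part_def free_grade_def by simp

lemma lower_finsum:
  assumes "finite S" "\<And>i. i \<in> S \<Longrightarrow> f i \<in> GI.lower d"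
  shows "(\<Oplus>\<^bsub>E.B\<^esub>i\<in>S. f i) \<in> GI.lower d"
  using assms by (intro E.B.finsum_closed_subset) (auto intro: GI.lower_add)

lemma single_filt: "t \<in> carrier T \<Longrightarrow> E.single (len_part m t) g \<in> GE.filt (int m)"
  using GE.cmp_in_filt[of "E.single t g" m "int m"] by (simp add: ecmp_single)

lemma rel_length: "rel q i j w \<noteq> 0 \<Longrightarrow> length w = 2"
  by (auto simp: rel_def wd_def split: if_splits)

text \<open>
  A relation is congruent modulo \<open>I\<close> to \<open>\<kappa>\<^sub>i\<^sub>j\<close>, which has degree 0.  The elements of \<open>T\<close> all of whose
  components can be replaced modulo \<open>I\<close> by something of lower degree form an ideal.
\<close>

lemma single_J_lower:
  assumes "t \<in> J"
  shows "E.single (len_part m t) \<one>\<^bsub>G\<^esub> \<in> GI.lower (int m - 1)"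
proof -
  let ?s = "\<lambda>m t. E.single (len_part m t) \<one>\<^bsub>G\<^esub>"
  let ?I = "{t \<in> carrier T. \<forall>m. ?s m t \<in> GI.lower (int m - 1)}"
  have prod: "?s m (x \<otimes>\<^bsub>T\<^esub> y) = (\<Oplus>\<^bsub>E.B\<^esub>i\<in>{..m}. ?s i x \<otimes>\<^sub>E ?s (m - i) y)"
    if "x \<in> carrier T" "y \<in> carrier T" for m x y
  proof -
    have "?s m (x \<otimes>\<^bsub>T\<^esub> y) = E.single (\<Oplus>\<^bsub>T\<^esub>i\<in>{..m}. len_part i x \<otimes>\<^bsub>T\<^esub> len_part (m - i) y) \<one>\<^bsub>G\<^esub>"
      using that by (simp add: T.cmp_mult del: free_algebra_simps)
    also have "\<dots> = (\<Oplus>\<^bsub>E.B\<^esub>i\<in>{..m}. E.single (len_part i x \<otimes>\<^bsub>T\<^esub> len_part (m - i) y) \<one>\<^bsub>G\<^esub>)"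
      using that by (intro E.single_finsum) (auto simp del: free_algebra_simps)
    also have "\<dots> = (\<Oplus>\<^bsub>E.B\<^esub>i\<in>{..m}. ?s i x \<otimes>\<^sub>E ?s (m - i) y)"
      using that by (intro E.B.finsum_cong' refl)
        (auto simp: E.single_mult_single simp del: free_algebra_simps)
    finally show ?thesis .
  qed
  have "ideal ?I T"
  proof (rule T.idealI')
    fix x y assume x: "x \<in> ?I" and y: "y \<in> carrier T"
    have "?s i x \<otimes>\<^sub>E ?s (m - i) y \<in> GI.lower (int m - 1)" if "i \<le> m" for i m
    proof -
      have "?s i x \<otimes>\<^sub>E ?s (m - i) y \<in> GI.lower (int i - 1 + int (m - i))"
        using x y by (intro GI.lower_mult_filt single_filt) auto
      thus ?thesis using that by (simp add: of_nat_diff)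
    qed
    moreover have "?s i y \<otimes>\<^sub>E ?s (m - i) x \<in> GI.lower (int m - 1)" if "i \<le> m" for i m
    proof -
      have "?s i y \<otimes>\<^sub>E ?s (m - i) x \<in> GI.lower (int i + (int (m - i) - 1))"
        using x y by (intro GI.filt_mult_lower single_filt) auto
      thus ?thesis using that by (simp add: of_nat_diff)
    qed
    ultimately show "x \<otimes>\<^bsub>T\<^esub> y \<in> ?I" "y \<otimes>\<^bsub>T\<^esub> x \<in> ?I"
      using x y by (auto simp: prod intro!: lower_finsum simp del: free_algebra_simps)
  next
    fix x y assume xy: "x \<in> ?I" "y \<in> ?I"
    hence "?s m (x \<oplus>\<^bsub>T\<^esub> y) = ?s m x \<oplus>\<^sub>E ?s m y" for m
      by (simp add: T.cmp_add E.single_add del: free_algebra_simps)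
    thus "x \<oplus>\<^bsub>T\<^esub> y \<in> ?I" using xy by (auto intro!: GI.lower_add simp del: free_algebra_simps)
  next
    show "\<zero>\<^bsub>T\<^esub> \<in> ?I" by (simp add: E.single_zero del: free_algebra_simps)
  qed blast
  moreover have "rel q i j \<in> ?I" if ij: "i \<in> N" "j \<in> N" for i j
  proof -
    have "?s m (rel q i j) \<in> GI.lower (int m - 1)" for m
    proof (cases "m = 2")
      case True
      have "kappaE i j \<in> GE.filt 1"
        by (auto simp: filt_eq skew_part_def free_filtration_def kappaE_def group_algebra_incl_def
            simp del: free_algebra_simps) (auto split: if_splits)
      moreover have "E.single (rel q i j) \<one>\<^bsub>G\<^esub> \<ominus>\<^sub>E kappaE i j \<in> hecke"
        using hecke_rel_in_hecke[OF ij] by (simp add: hecke_rel_def)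
      moreover have "len_part 2 (rel q i j) = rel q i j"
        using rel_length by (fastforce simp: len_part_def)
      ultimately show ?thesis using True ij by (auto simp: GI.lower_def)
    next
      case False
      hence "len_part m (rel q i j) = \<zero>\<^bsub>T\<^esub>" using rel_length by (fastforce simp: len_part_def)
      thus ?thesis using E.single_zero by simp
    qed
    thus ?thesis using ij by auto
  qed
  ultimately have "J \<subseteq> ?I" by (rule J_minimal)
  thus ?thesis using assms by auto
qed

text \<open>
  The part of the comparison that holds for every \<open>\<kappa>\<close>: leading terms in \<open>J\<close> can be
  lowered.
\<close>

lemma J_lower:
  assumes f: "f \<in> carrier E.B" and J: "\<And>g. g \<in> carrier G \<Longrightarrow> f g \<in> J"
  shows "ecmp m f \<in> GI.lower (int m - 1)"
proof -
  have "E.single (len_part m (f g)) g \<in> GI.lower (int m - 1)" if g: "g \<in> carrier G" for g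
  proof -
    have "E.single \<one>\<^bsub>T\<^esub> g \<in> GE.filt 0"
      using single_filt[of "\<one>\<^bsub>T\<^esub>" 0 g] T.cmp_one[of 0] by (simp del: free_algebra_simps)
    hence "E.single (len_part m (f g)) \<one>\<^bsub>G\<^esub> \<otimes>\<^sub>E E.single \<one>\<^bsub>T\<^esub> g \<in> GI.lower (int m - 1 + 0)"
      using single_J_lower[OF J[OF g]] by (intro GI.lower_mult_filt)
    moreover have "len_part m (f g) \<in> carrier T" using f g by auto
    ultimately show ?thesis using g by (simp add: E.single_mult_single del: free_algebra_simps)
  qed
  moreover have "ecmp m f = (\<Oplus>\<^bsub>E.B\<^esub>g\<in>carrier G. E.single (len_part m (f g)) g)"
  proof -
    have "ecmp m f \<in> carrier E.B" using f by simp
    from E.skew_eq_finsum_single[OF this] show ?thesis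
      by (rule trans) (use f in \<open>auto intro!: E.B.finsum_cong' simp: ecmp_def\<close>)
  qed
  ultimately show ?thesis using lower_finsum[OF finite_G] by simp
qed

text \<open>
  Each exchange at a descent changes a word by a multiple and an element of \<open>J\<close> and decreases
  the number of inversions, so the sorted words span the quantum symmetric algebra.
\<close>

lemma sorted_representative:
  assumes "t \<in> carrier T"
  shows "\<exists>s\<in>carrier T. (\<lambda>w. t w - s w) \<in> J \<and> (\<forall>w. s w \<noteq> 0 \<longrightarrow> \<not> (\<exists>p. desc w p))"
proof -
  have J_add: "(\<lambda>w. x w + y w) \<in> J" if "x \<in> J" "y \<in> J" for x y
    using S.I.a_closed[OF that] by simp
  have J_smult: "(\<lambda>w. r * x w) \<in> J" if "x \<in> J" for r x
    using T.ideal_smult_closed[OF J_ideal that, of r] by simp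
  have J_zero: "(\<lambda>w. 0) \<in> J" using S.I.zero_closed by simp
  show ?thesis
    using assms
  proof (induction t rule: free_induct)
    case zero
    show ?case by (rule bexI[of _ "\<lambda>w. 0"]) (use J_zero T.zero_closed in auto)
  next
    case (add x y)
    then obtain s s' where s: "s \<in> carrier T" "(\<lambda>w. x w - s w) \<in> J" "\<And>w. s w \<noteq> 0 \<Longrightarrow> \<not> (\<exists>p. desc w p)"
      "s' \<in> carrier T" "(\<lambda>w. y w - s' w) \<in> J" "\<And>w. s' w \<noteq> 0 \<Longrightarrow> \<not> (\<exists>p. desc w p)" by blast
    have "(\<lambda>w. x w + y w - (s w + s' w)) \<in> J"
      using J_add[OF s(2,5)] by (simp add: algebra_simps)
    moreover have "s w + s' w \<noteq> 0 \<Longrightarrow> \<not> (\<exists>p. desc w p)" for w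
      using s(3,6)[of w] by (cases "s w = 0") auto
    ultimately show ?case
      using s free_add_closed by (intro bexI[of _ "\<lambda>w. s w + s' w"]) auto
  next
    case (smult r x)
    then obtain s where s: "s \<in> carrier T" "(\<lambda>w. x w - s w) \<in> J" "\<And>w. s w \<noteq> 0 \<Longrightarrow> \<not> (\<exists>p. desc w p)"
      by blast
    have "(\<lambda>w. r * x w - r * s w) \<in> J"
      using J_smult[OF s(2), of r] by (simp add: algebra_simps)
    thus ?case using s free_smult_closed by (intro bexI[of _ "\<lambda>w. r * s w"]) auto
  next
    case (wd w)
    from wd(1) show ?case
    proof (induction "invs w" arbitrary: w rule: less_induct)
      case (less w)
      show ?case
      proof (cases "\<exists>p. desc w p")
        case False
        moreover have "wd w u \<noteq> 0 \<Longrightarrow> u = w" for u by (simp add: wd_def split: if_splits)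
        ultimately show ?thesis using less.prems J_zero
          by (intro bexI[of _ "wd w"]) auto
      next
        case True
        then obtain p where p: "desc w p" by blast
        define u i j u' where "u = take p w" and "i = w ! p" and "j = w ! Suc p" and "u' = drop (p + 2) w"
        have w: "w = u @ [i, j] @ u'" unfolding u_def i_def j_def u'_def by (rule desc_decomp[OF p])
        have ji: "j < i" using p by (simp add: desc_def i_def j_def)
        have sets: "set u \<subseteq> N" "set u' \<subseteq> N" "i \<in> N" "j \<in> N" using less.prems unfolding w by auto
        let ?w = "u @ [j, i] @ u'"
        obtain s where s: "s \<in> carrier T" "(\<lambda>x. wd ?w x - s x) \<in> J" "\<And>w. s w \<noteq> 0 \<Longrightarrow> \<not> (\<exists>p. desc w p)"
          using less.hyps[of ?w] invs_swap[OF ji, of u u'] sets w by auto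
        have "conv (wd u) (conv (rel q i j) (wd u')) = (\<lambda>x. wd w x + - q i j * wd ?w x)"
          unfolding rel_alt w by (simp only: fun_linear conv_wd_wd)
        moreover have "conv (wd u) (conv (rel q i j) (wd u')) \<in> J"
          using S.I.I_l_closed[OF S.I.I_r_closed[OF rel_in_J, of i j "wd u'"], of "wd u"] sets by simp
        ultimately have "(\<lambda>x. (wd w x + - q i j * wd ?w x) + q i j * (wd ?w x - s x)) \<in> J"
          using J_add J_smult[OF s(2), of "q i j"] by simp
        hence "(\<lambda>x. wd w x - q i j * s x) \<in> J" by (simp add: algebra_simps)
        thus ?thesis using s free_smult_closed by (intro bexI[of _ "\<lambda>x. q i j * s x"]) auto
      qed
    qed
  qed
qed

text \<open>
  The converse of \<open>J_lower\<close>, and the place where the functionals are used: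
  a leading component that can be lowered modulo \<open>I\<close> lies in \<open>J\<close>.
\<close>

lemma lower_J:
  assumes f: "f \<in> carrier E.B" and low: "ecmp m f \<in> GI.lower (int m - 1)" and g0: "g0 \<in> carrier G"
  shows "len_part m (f g0) \<in> J"
proof -
  have "\<exists>s\<in>carrier T. (\<lambda>w. len_part m (f g) w - s w) \<in> J
      \<and> (\<forall>w. s w \<noteq> 0 \<longrightarrow> \<not> (\<exists>p. desc w p) \<and> length w = m)" if g: "g \<in> carrier G" for g
  proof -
    have "f g \<in> carrier T" using f g by simp
    then obtain s where s: "s \<in> carrier T" "(\<lambda>w. f g w - s w) \<in> J" "\<And>w. s w \<noteq> 0 \<Longrightarrow> \<not> (\<exists>p. desc w p)"
      using sorted_representative[of "f g"] by blast
    have "len_part m (\<lambda>w. f g w - s w) \<in> J" using s(2) by (rule J_len_part)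
    moreover have "len_part m (\<lambda>w. f g w - s w) = (\<lambda>w. len_part m (f g) w - len_part m s w)"
      by (auto simp: len_part_def)
    ultimately show ?thesis using s len_part_closed
      by (intro bexI[of _ "len_part m s"]) (auto simp: len_part_def)
  qed
  hence "\<forall>g\<in>carrier G. \<exists>s. s \<in> carrier T \<and> (\<lambda>w. len_part m (f g) w - s w) \<in> J
      \<and> (\<forall>w. s w \<noteq> 0 \<longrightarrow> \<not> (\<exists>p. desc w p) \<and> length w = m)" by blast
  from bchoice[OF this] obtain s where s: "\<And>g. g \<in> carrier G \<Longrightarrow> s g \<in> carrier T"
    "\<And>g. g \<in> carrier G \<Longrightarrow> (\<lambda>w. len_part m (f g) w - s g w) \<in> J"
    "\<And>g w. g \<in> carrier G \<Longrightarrow> s g w \<noteq> 0 \<Longrightarrow> \<not> (\<exists>p. desc w p)"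
    "\<And>g w. g \<in> carrier G \<Longrightarrow> s g w \<noteq> 0 \<Longrightarrow> length w = m" by blast
  \<comment> \<open>\<open>S'\<close> is the sorted part of the leading component; what was removed lies in \<open>J\<close> and is of lower degree modulo \<open>I\<close>.\<close>
  define S' where "S' = (\<lambda>g\<in>carrier G. s g)"
  have S': "S' \<in> carrier E.B" using s(1) by (auto simp: S'_def E.carrier_skew)
  let ?d = "ecmp m f \<ominus>\<^sub>E S'"
  have dc: "?d \<in> carrier E.B" using f S' by simp
  have dg: "?d g = (\<lambda>w. len_part m (f g) w - s g w)" if "g \<in> carrier G" for g
  proof -
    have "?d g = ecmp m f g \<ominus>\<^bsub>T\<^esub> S' g" using that f S' by (intro E.skew_a_minus_apply) auto
    thus ?thesis using that s(1)[OF that] by (simp add: free_a_minus ecmp_def S'_def)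
  qed
  have "ecmp m ?d = ?d"
  proof (rule E.skew_eqI)
    fix g assume g: "g \<in> carrier G"
    have "len_part m (?d g) = ?d g"
      unfolding dg[OF g] using s(4)[OF g] by (fastforce simp: len_part_def)
    thus "ecmp m ?d g = ?d g" using g by (simp add: ecmp_def)
  qed (use dc in auto)
  hence "?d \<in> GI.lower (int m - 1)" using J_lower[OF dc, of m] s(2) dg by simp
  hence "ecmp m f \<ominus>\<^sub>E ?d \<in> GI.lower (int m - 1)" using low GI.lower_a_minus by blast
  moreover have "ecmp m f \<ominus>\<^sub>E ?d = S'"
    using f S' by (simp add: a_minus_def E.B.minus_add E.B.r_neg1 E.B.r_neg2)
  ultimately obtain x l where xl: "x \<in> hecke" "l \<in> GE.filt (int m - 1)" "S' = x \<oplus>\<^sub>E l"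
    unfolding GI.lower_iff by auto
  have xc: "x \<in> carrier E.B" "l \<in> carrier E.B" using xl GI.I.a_subset by auto
  have "s g0 w0 = 0" for w0
  proof (rule ccontr)
    assume w0: "s g0 w0 \<noteq> 0"
    \<comment> \<open>This functional reads off the coefficient of \<open>w0 g0\<close> in \<open>S'\<close> and annihilates \<open>I\<close> and all lower degrees.\<close>
    define c where "c = sol (\<lambda>w g. if w = w0 \<and> g = g0 then 1 else 0)"
    have c: "solves k c" for k unfolding c_def by (rule solves_sol)
    have csort: "c w g = (if w = w0 \<and> g = g0 then 1 else 0)" if "\<not> (\<exists>p. desc w p)" for w g
      using sol_sorted[OF that] by (simp add: c_def)
    have lw0: "length w0 = m" using s(4)[OF g0 w0] .
    have cz: "c w g = 0" if "set w \<subseteq> N" "length w < m" "g \<in> carrier G" for w g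
    proof (rule solution_vanishes[OF c _ that])
      fix w g assume "\<not> (\<exists>p. desc w p)" "length w < m"
      thus "c w g = 0" using csort[of w g] lw0 by auto
    qed
    have "pairing c l = 0"
      unfolding pairing_def
    proof (intro sum.neutral ballI)
      fix g assume g: "g \<in> carrier G"
      have "lin (\<lambda>w. c w g) (l g) = lin (\<lambda>w. 0) (l g)"
      proof (rule lin_cong)
        fix w assume w: "l g w \<noteq> 0"
        have "l g \<in> free_filtration n (int m - 1)" using xl(2) g by (auto simp: filt_eq skew_part_def)
        thus "c w g = 0" using w g by (intro cz) (auto simp: free_filtration_def mem_free_algebra)
      qed
      thus "lin (\<lambda>w. c w g) (l g) = 0" by (simp add: lin_def)
    qed
    moreover have "pairing c x = 0" by (rule pairing_hecke[OF c xl(1)])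
    ultimately have "pairing c S' = 0" using xl(3) xc by (simp add: pairing_add)
    moreover have "pairing c S' = (\<Sum>g\<in>carrier G. if g = g0 then s g0 w0 else 0)"
      unfolding pairing_def
    proof (intro sum.cong refl)
      fix g assume g: "g \<in> carrier G"
      have "lin (\<lambda>w. c w g) (S' g) = lin (\<lambda>w. if w = w0 \<and> g = g0 then 1 else 0) (s g)"
        using g s(3)[OF g] csort by (simp add: S'_def) (rule lin_cong, simp)
      also have "\<dots> = (if g = g0 then s g0 w0 else 0)"
      proof (cases "g = g0")
        case True
        have "lin (\<lambda>w. if w = w0 then 1 else 0) (s g0) = (\<Sum>w | s g0 w \<noteq> 0. if w = w0 then s g0 w0 else 0)"
          unfolding lin_def by (intro sum.cong) auto
        thus ?thesis using True w0 free_finite_support[OF s(1)[OF g0]] by simp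
      qed (simp add: lin_def)
      finally show "lin (\<lambda>w. c w g) (S' g) = (if g = g0 then s g0 w0 else 0)" .
    qed
    ultimately show False using w0 g0 finite_G by simp
  qed
  thus ?thesis using s(2)[OF g0] by simp
qed

lemma J_of_parts:
  assumes t: "t \<in> carrier T" and J: "\<And>m. len_part m t \<in> J"
  shows "t \<in> J"
proof -
  let ?L = "length ` {w. t w \<noteq> 0}"
  have fin: "finite ?L" using free_finite_support[OF t] by simp
  have "(\<Oplus>\<^bsub>T\<^esub>m\<in>?L. len_part m t) \<in> J"
    using fin J S.I.a_closed by (intro T.finsum_closed_subset S.I.a_subset S.I.zero_closed) auto
  moreover have "(\<Oplus>\<^bsub>T\<^esub>m\<in>?L. len_part m t) = t"
  proof
    fix w
    have "(\<Oplus>\<^bsub>T\<^esub>m\<in>?L. len_part m t) w = (\<Sum>m\<in>?L. len_part m t w)"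
      using fin t by (intro free_finsum_apply) (auto intro: len_part_closed)
    also have "\<dots> = (\<Sum>m\<in>?L. if m = length w then t w else 0)"
      by (intro sum.cong) (auto simp: len_part_def)
    also have "\<dots> = t w" using fin by (cases "t w = 0") auto
    finally show "(\<Oplus>\<^bsub>T\<^esub>m\<in>?L. len_part m t) w = t w" .
  qed
  ultimately show ?thesis by simp
qed

lemma pi_image_grad: "\<pi> ` GE.grad d = skew_part G (q_grade n q) d"
  unfolding grad_eq skew_part_def q_grade_def quotient_part_def \<pi>_def[abs_def]
  by (rule PiE_pointwise_image)

theorem pbw:
  "graded_algebra_isomorphic
     (associated_graded (quotient_algebra E.B hecke)
        (quotient_part E.B hecke (skew_part G (free_filtration n))))
     (associated_graded_part (quotient_algebra E.B hecke)
        (quotient_part E.B hecke (skew_part G (free_filtration n))))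
     (quantum_symmetric_skew G n q \<alpha>) (skew_part G (q_grade n q))"
proof -
  have F: "skew_part G (free_filtration n) = GE.filt" by (rule ext) (simp add: filt_eq)
  have surj: "\<pi> ` carrier E.B = carrier R.B"
    unfolding E.carrier_skew R.carrier_skew S.carrier_quotient \<pi>_def[abs_def]
    by (rule PiE_pointwise_image)
  have ker: "\<pi> f = \<pi> h \<longleftrightarrow> (\<forall>m. ecmp m (f \<ominus>\<^sub>E h) \<in> GI.lower (int m - 1))"
    if fh: "f \<in> carrier E.B" "h \<in> carrier E.B" for f h
  proof -
    let ?d = "f \<ominus>\<^sub>E h"
    have d: "?d \<in> carrier E.B" using fh by simp
    have "?d g \<in> J" if "\<forall>m. ecmp m ?d \<in> GI.lower (int m - 1)" "g \<in> carrier G" for g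
    proof (rule J_of_parts)
      show "?d g \<in> carrier T" using d that(2) by (rule E.skew_apply)
      show "len_part m (?d g) \<in> J" for m using that by (intro lower_J[OF d]) auto
    qed
    thus ?thesis unfolding \<pi>_eq_iff[OF fh] using J_lower[OF d] by blast
  qed
  have "graded_algebra_isomorphic GI.gr (associated_graded_part GI.Q GI.FH) R.B (skew_part G (q_grade n q))"
    by (rule GI.associated_graded_isomorphic[OF \<pi>_hom surj \<pi>_smult ker pi_image_grad])
  thus ?thesis by (simp add: F S_Q)
qed

end

section \<open>Identities for constant cocycles\<close>

context q_system
begin

text \<open>
  The coefficients of words of length at most one are the same for all representatives of a
  coset, because \<open>J\<close> starts in degree 2.  They turn identities in \<open>R\<close> into identities of complex
  numbers.
\<close>

definition low_coeff :: "nat list \<Rightarrow> (nat list \<Rightarrow> complex) set \<Rightarrow> complex" where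
  "low_coeff u X = (SOME f. f \<in> X) u"

lemma low_coeff_proj:
  assumes t: "t \<in> carrier T" and u: "length u \<le> 1"
  shows "low_coeff u (S.proj t) = t u"
proof -
  define f where "f = (SOME f. f \<in> S.proj t)"
  have "f \<in> S.proj t" unfolding f_def by (rule someI[of "\<lambda>f. f \<in> S.proj t", OF S.I.a_rcos_self[OF t]])
  hence f: "f \<in> carrier T" "f \<ominus>\<^bsub>T\<^esub> t \<in> J" using S.proj_mem_iff[OF t] by auto
  have "(f \<ominus>\<^bsub>T\<^esub> t) u = 0"
    using u J_low(1,2)[OF f(2)] by (cases u) auto
  thus ?thesis using t by (simp add: low_coeff_def free_a_minus flip: f_def)
qed

end

context q_action
begin

definition coeffR :: "'g \<Rightarrow> nat list \<Rightarrow> ('g \<Rightarrow> (nat list \<Rightarrow> complex) set) \<Rightarrow> complex" where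
  "coeffR h u r = low_coeff u (r h)"

lemma coeffR_add:
  assumes "h \<in> carrier G" "length u \<le> 1" "r \<in> carrier R.B" "s \<in> carrier R.B"
  shows "coeffR h u (r \<oplus>\<^sub>R s) = coeffR h u r + coeffR h u s"
proof -
  have "r h \<in> carrier S.Q" "s h \<in> carrier S.Q" using assms by auto
  then obtain x y where xy: "x \<in> carrier T" "y \<in> carrier T" "r h = S.proj x" "s h = S.proj y"
    unfolding S.carrier_quotient by blast
  hence "(r \<oplus>\<^sub>R s) h = S.proj (\<lambda>w. x w + y w)" using assms S.proj_add[of x y] by simp
  thus ?thesis using xy assms low_coeff_proj free_add_closed[of x n y] by (simp add: coeffR_def)
qed

lemma coeffR_smult:
  assumes "h \<in> carrier G" "length u \<le> 1" "r \<in> carrier R.B"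
  shows "coeffR h u (c \<odot>\<^sub>R r) = c * coeffR h u r"
proof -
  have "r h \<in> carrier S.Q" using assms by auto
  then obtain x where xy: "x \<in> carrier T" "r h = S.proj x"
    unfolding S.carrier_quotient by blast
  hence "(c \<odot>\<^sub>R r) h = S.proj (\<lambda>w. c * x w)" using assms S.proj_smult[of x c] by simp
  thus ?thesis using xy assms low_coeff_proj free_smult_closed[of x n c] by (simp add: coeffR_def)
qed

lemma coeffR_diff:
  assumes "h \<in> carrier G" "length u \<le> 1" "r \<in> carrier R.B" "s \<in> carrier R.B"
  shows "coeffR h u (r \<ominus>\<^sub>R s) = coeffR h u r - coeffR h u s"
  using coeffR_add[OF assms(1-3), of "(- 1) \<odot>\<^sub>R s"] coeffR_smult[OF assms(1,2,4), of "- 1"] assms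
  by (simp add: a_minus_def R.B.minus_eq_smult)

definition emb :: "(nat list \<Rightarrow> complex) \<Rightarrow> 'g \<Rightarrow> (nat list \<Rightarrow> complex) set" where
  "emb t = R.single (S.proj t) \<one>\<^bsub>G\<^esub>"

definition \<gamma> :: "'g \<Rightarrow> 'g \<Rightarrow> (nat list \<Rightarrow> complex) set" where
  "\<gamma> g = R.single \<one>\<^bsub>S.Q\<^esub> g"

lemma emb_closed [simp, intro]: "t \<in> carrier T \<Longrightarrow> emb t \<in> carrier R.B"
  by (auto simp: emb_def)

lemma \<gamma>_closed [simp, intro]: "\<gamma> g \<in> carrier R.B"
  by (auto simp: \<gamma>_def)

lemma emb_conv: "s \<in> carrier T \<Longrightarrow> t \<in> carrier T \<Longrightarrow> emb (conv s t) = emb s \<otimes>\<^sub>R emb t"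
  using S.proj_mult[of s t] by (simp add: emb_def R.single_mult_single)

lemma emb_add: "s \<in> carrier T \<Longrightarrow> t \<in> carrier T \<Longrightarrow> emb (\<lambda>w. s w + t w) = emb s \<oplus>\<^sub>R emb t"
  using S.proj_add[of s t] R.single_add[of "S.proj s" "S.proj t"] by (simp add: emb_def)

lemma emb_smult: "s \<in> carrier T \<Longrightarrow> emb (\<lambda>w. c * s w) = c \<odot>\<^sub>R emb s"
  using S.proj_smult[of s c] R.single_smult[of "S.proj s" c] by (simp add: emb_def)

lemma emb_J: "t \<in> J \<Longrightarrow> emb t = \<zero>\<^bsub>R.B\<^esub>"
  using S.proj_eq_zero_iff[of t] J_closed[of t] R.single_zero by (simp add: emb_def S.zero_quotient(1))

lemma emb_eq_smult:
  assumes "s \<in> carrier T" "t \<in> carrier T" "(\<lambda>w. s w + - c * t w) \<in> J"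
  shows "emb s = c \<odot>\<^sub>R emb t"
proof (rule R.B.a_minus_eq_zeroD)
  have "emb s \<ominus>\<^sub>R c \<odot>\<^sub>R emb t = emb (\<lambda>w. s w + - c * t w)"
    using assms(1,2)
    by (simp only: emb_add emb_smult free_smult_closed a_minus_def R.B.smult_uminus_left emb_closed)
  thus "emb s \<ominus>\<^sub>R c \<odot>\<^sub>R emb t = \<zero>\<^bsub>R.B\<^esub>" using emb_J[OF assms(3)] by simp
qed (use assms in auto)

text \<open>
  The commutation rule \<open>g v = (g v) g\<close> of \<open>R\<close>, where \<open>g v\<close> in parentheses is the image of \<open>v\<close>.
\<close>

lemma \<gamma>_emb: "g \<in> carrier G \<Longrightarrow> t \<in> carrier T \<Longrightarrow> \<gamma> g \<otimes>\<^sub>R emb t = emb (act g t) \<otimes>\<^sub>R \<gamma> g"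
  by (simp add: emb_def \<gamma>_def R.single_mult_single \<alpha>_proj)

lemma linear_functional_sum:
  assumes add: "\<And>s t. s \<in> carrier T \<Longrightarrow> t \<in> carrier T \<Longrightarrow> F (\<lambda>w. s w + t w) = F s + F t"
    and smult: "\<And>c s. s \<in> carrier T \<Longrightarrow> F (\<lambda>w. c * s w) = c * F s"
    and "finite S" "\<And>i. i \<in> S \<Longrightarrow> f i \<in> carrier T"
  shows "F (\<lambda>w. \<Sum>i\<in>S. c i * f i w) = (\<Sum>i\<in>S. c i * (F (f i) :: complex))"
  using assms(3,4)
proof (induction S rule: finite_induct)
  case empty
  have "(\<lambda>_. 0) \<in> carrier T" using T.zero_closed by simp
  thus ?case using smult[of "\<lambda>_. 0" 0] by simp
next
  case (insert i S)
  hence "F (\<lambda>w. c i * f i w + (\<Sum>i\<in>S. c i * f i w)) = F (\<lambda>w. c i * f i w) + F (\<lambda>w. \<Sum>i\<in>S. c i * f i w)"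
    by (intro add free_smult_closed free_sum_closed) auto
  thus ?case using insert by (simp add: smult)
qed

end

locale q_cocycle = q_action n q G M \<alpha>
  for n :: nat and q :: "nat \<Rightarrow> nat \<Rightarrow> complex" and G :: "('g, 'h) monoid_scheme"
    and M :: "'g \<Rightarrow> nat \<Rightarrow> nat \<Rightarrow> complex"
    and \<alpha> :: "'g \<Rightarrow> (nat list \<Rightarrow> complex) set \<Rightarrow> (nat list \<Rightarrow> complex) set" +
  fixes \<mu> :: "('g \<Rightarrow> (nat list \<Rightarrow> complex) set) \<Rightarrow> ('g \<Rightarrow> (nat list \<Rightarrow> complex) set)
      \<Rightarrow> 'g \<Rightarrow> (nat list \<Rightarrow> complex) set"
    and K :: "nat \<Rightarrow> nat \<Rightarrow> 'g \<Rightarrow> complex"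
  assumes cocycle: "constant_hochschild_2_cocycle R.B (skew_part G (q_grade n q)) \<mu>"
    and K_\<mu>: "i \<in> {1..n} \<Longrightarrow> j \<in> {1..n} \<Longrightarrow> group_algebra_incl S.Q G (K i j)
      = \<mu> (emb (wd [i])) (emb (wd [j])) \<ominus>\<^sub>R q i j \<odot>\<^sub>R \<mu> (emb (wd [j])) (emb (wd [i]))"
begin

lemma \<mu>_bilinear: "bilinear_on R.B \<mu>"
  using cocycle by (simp add: constant_hochschild_2_cocycle_def hochschild_2_cocycle_def)

lemma \<mu>_closed [simp, intro]: "r \<in> carrier R.B \<Longrightarrow> s \<in> carrier R.B \<Longrightarrow> \<mu> r s \<in> carrier R.B"
  using \<mu>_bilinear unfolding bilinear_on_def by blast

lemma \<mu>_add:
  assumes "r \<in> carrier R.B" "s \<in> carrier R.B" "t \<in> carrier R.B"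
  shows "\<mu> (r \<oplus>\<^sub>R s) t = \<mu> r t \<oplus>\<^sub>R \<mu> s t" "\<mu> t (r \<oplus>\<^sub>R s) = \<mu> t r \<oplus>\<^sub>R \<mu> t s"
  using \<mu>_bilinear assms unfolding bilinear_on_def by blast+

lemma \<mu>_smult:
  assumes "r \<in> carrier R.B" "s \<in> carrier R.B"
  shows "\<mu> (c \<odot>\<^sub>R r) s = c \<odot>\<^sub>R \<mu> r s" "\<mu> r (c \<odot>\<^sub>R s) = c \<odot>\<^sub>R \<mu> r s"
  using \<mu>_bilinear assms unfolding bilinear_on_def by blast+

lemma \<mu>_cocycle:
  "r \<in> carrier R.B \<Longrightarrow> s \<in> carrier R.B \<Longrightarrow> u \<in> carrier R.B
    \<Longrightarrow> \<mu> r s \<otimes>\<^sub>R u \<oplus>\<^sub>R \<mu> (r \<otimes>\<^sub>R s) u = \<mu> r (s \<otimes>\<^sub>R u) \<oplus>\<^sub>R r \<otimes>\<^sub>R \<mu> s u"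
  using cocycle unfolding constant_hochschild_2_cocycle_def hochschild_2_cocycle_def by blast

lemma coeffR_cocycle:
  assumes "h \<in> carrier G" "length w \<le> 1" "r \<in> carrier R.B" "s \<in> carrier R.B" "u \<in> carrier R.B"
  shows "coeffR h w (\<mu> r s \<otimes>\<^sub>R u) + coeffR h w (\<mu> (r \<otimes>\<^sub>R s) u)
    = coeffR h w (\<mu> r (s \<otimes>\<^sub>R u)) + coeffR h w (r \<otimes>\<^sub>R \<mu> s u)"
  using \<mu>_cocycle[OF assms(3-5)] assms by (simp add: coeffR_add[symmetric])

text \<open>
  These values have degree \<open>0 + 1 - 2 = -1\<close>.
\<close>

lemma \<mu>_group_letter:
  assumes "t \<in> free_grade n 1"
  shows "\<mu> (\<gamma> g) (emb t) = \<zero>\<^bsub>R.B\<^esub>" "\<mu> (emb t) (\<gamma> g) = \<zero>\<^bsub>R.B\<^esub>"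
proof -
  have zero: "\<zero>\<^bsub>T\<^esub> \<in> free_grade n d" for d by (simp add: free_grade_def mem_free_algebra)
  have qz: "\<zero>\<^bsub>S.Q\<^esub> \<in> q_grade n q d" for d
    using zero[of d] by (auto simp: q_grade_def quotient_part_def S.zero_quotient(2) simp del: free_algebra_simps)
  have "\<one>\<^bsub>S.Q\<^esub> \<in> q_grade n q 0"
    unfolding q_grade_def quotient_part_def S.proj_one
    by (intro imageI) (simp add: free_grade_def mem_free_algebra)
  hence g: "\<gamma> g \<in> skew_part G (q_grade n q) 0"
    using qz by (auto simp: \<gamma>_def R.single_def skew_part_def)
  have "S.proj t \<in> q_grade n q 1" using assms by (auto simp: q_grade_def quotient_part_def)
  hence x: "emb t \<in> skew_part G (q_grade n q) 1"
    using qz by (auto simp: emb_def R.single_def skew_part_def)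
  have neg: "r = \<zero>\<^bsub>R.B\<^esub>" if "r \<in> skew_part G (q_grade n q) (- 1)" for r
  proof -
    have "f = \<zero>\<^bsub>T\<^esub>" if "f \<in> free_grade n (- 1)" for f
      using that by (auto simp: free_grade_def)
    hence "Y = \<zero>\<^bsub>S.Q\<^esub>" if "Y \<in> q_grade n q (- 1)" for Y
      using that unfolding q_grade_def quotient_part_def S.zero_quotient(2) by blast
    hence "r g = \<zero>\<^bsub>S.Q\<^esub>" if "g \<in> carrier G" for g
      using that \<open>r \<in> skew_part G (q_grade n q) (- 1)\<close> by (auto simp: skew_part_def)
    moreover from this have "r \<in> carrier R.B"
      using \<open>r \<in> skew_part G (q_grade n q) (- 1)\<close> by (auto simp: skew_part_def R.carrier_skew PiE_iff)
    ultimately show ?thesis by (intro R.skew_eqI) auto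
  qed
  have "\<mu> (\<gamma> g) (emb t) \<in> skew_part G (q_grade n q) (0 + 1 - 2)"
    "\<mu> (emb t) (\<gamma> g) \<in> skew_part G (q_grade n q) (1 + 0 - 2)"
    using cocycle g x unfolding constant_hochschild_2_cocycle_def by blast+
  thus "\<mu> (\<gamma> g) (emb t) = \<zero>\<^bsub>R.B\<^esub>" "\<mu> (emb t) (\<gamma> g) = \<zero>\<^bsub>R.B\<^esub>" using neg[of "\<mu> (\<gamma> g) (emb t)"] neg[of "\<mu> (emb t) (\<gamma> g)"] by simp_all
qed

definition kappaR where "kappaR i j = group_algebra_incl S.Q G (K i j)"

lemma kappaR_apply: "h \<in> carrier G \<Longrightarrow> kappaR i j h = S.proj (\<lambda>w. K i j h * (if w = [] then 1 else 0))"
  using S.proj_smult[of "\<one>\<^bsub>T\<^esub>" "K i j h"] T.one_closed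
  by (simp add: kappaR_def group_algebra_incl_def S.proj_one)

lemma kappaR_closed [simp, intro]: "kappaR i j \<in> carrier R.B"
  by (auto simp: kappaR_def group_algebra_incl_def R.carrier_skew)

lemma const_closed: "(\<lambda>w. c * (if w = [] then 1 else 0)) \<in> carrier T"
  using free_smult_closed[OF T.one_closed, of c] by simp

lemma coeffR_linear_kappaR:
  assumes "h \<in> carrier G" "length u \<le> 1" "i \<in> {1..n}" "j \<in> {1..n}" "r \<in> carrier R.B"
  shows "coeffR h u (kappaR i j) = coeffR h u (\<mu> (emb (wd [i])) (emb (wd [j]))) - q i j * coeffR h u (\<mu> (emb (wd [j])) (emb (wd [i])))"
    "coeffR h u (kappaR i j \<otimes>\<^sub>R r) = coeffR h u (\<mu> (emb (wd [i])) (emb (wd [j])) \<otimes>\<^sub>R r)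
      - q i j * coeffR h u (\<mu> (emb (wd [j])) (emb (wd [i])) \<otimes>\<^sub>R r)"
    "coeffR h u (r \<otimes>\<^sub>R kappaR i j) = coeffR h u (r \<otimes>\<^sub>R \<mu> (emb (wd [i])) (emb (wd [j])))
      - q i j * coeffR h u (r \<otimes>\<^sub>R \<mu> (emb (wd [j])) (emb (wd [i])))"
proof -
  let ?a = "\<mu> (emb (wd [i])) (emb (wd [j]))" and ?b = "\<mu> (emb (wd [j])) (emb (wd [i]))"
  have c: "?a \<in> carrier R.B" "?b \<in> carrier R.B" using assms by auto
  have k: "kappaR i j = ?a \<ominus>\<^sub>R q i j \<odot>\<^sub>R ?b" using K_\<mu> assms by (simp add: kappaR_def)
  have "kappaR i j \<otimes>\<^sub>R r = ?a \<otimes>\<^sub>R r \<ominus>\<^sub>R q i j \<odot>\<^sub>R (?b \<otimes>\<^sub>R r)"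
    "r \<otimes>\<^sub>R kappaR i j = r \<otimes>\<^sub>R ?a \<ominus>\<^sub>R q i j \<odot>\<^sub>R (r \<otimes>\<^sub>R ?b)"
    unfolding k using c assms
    by (simp_all add: a_minus_def R.B.l_distr R.B.r_distr R.B.l_minus R.B.r_minus
        R.B.smult_m_assoc R.B.m_smult_assoc)
  thus "coeffR h u (kappaR i j) = coeffR h u ?a - q i j * coeffR h u ?b"
    "coeffR h u (kappaR i j \<otimes>\<^sub>R r) = coeffR h u (?a \<otimes>\<^sub>R r) - q i j * coeffR h u (?b \<otimes>\<^sub>R r)"
    "coeffR h u (r \<otimes>\<^sub>R kappaR i j) = coeffR h u (r \<otimes>\<^sub>R ?a) - q i j * coeffR h u (r \<otimes>\<^sub>R ?b)"
    using c assms k by (simp_all add: coeffR_diff coeffR_smult)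
qed

lemma K_antisymmetric:
  assumes "i \<in> {1..n}" "j \<in> {1..n}" "h \<in> carrier G"
  shows "K i j h = - q i j * K j i h"
proof -
  have "coeffR h [] (kappaR i j) = K i j h" for i j
    using assms(3) const_closed by (simp add: coeffR_def kappaR_apply low_coeff_proj)
  hence "K i j h = coeffR h [] (\<mu> (emb (wd [i])) (emb (wd [j]))) - q i j * coeffR h [] (\<mu> (emb (wd [j])) (emb (wd [i])))"
    "K j i h = coeffR h [] (\<mu> (emb (wd [j])) (emb (wd [i]))) - q j i * coeffR h [] (\<mu> (emb (wd [i])) (emb (wd [j])))"
    using coeffR_linear_kappaR(1)[OF assms(3) _ assms(1,2) \<gamma>_closed, of "[]"]
      coeffR_linear_kappaR(1)[OF assms(3) _ assms(2,1) \<gamma>_closed, of "[]"] by simp_all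
  moreover have "a - q i j * b = - q i j * (b - q j i * a)" for a b
  proof -
    have "- q i j * (b - q j i * a) = (q i j * q j i) * a - q i j * b" by (simp add: algebra_simps)
    thus ?thesis using q_swap[OF assms(1,2)] by simp
  qed
  ultimately show ?thesis by metis
qed

text \<open>
  Let \<open>s\<close> and \<open>t\<close> be letters with images \<open>s'\<close> and \<open>t'\<close> under \<open>g\<close>.  Because \<open>\<mu>\<close> vanishes at a group
  element and a vector, the cocycle identities for \<open>(g, s, t)\<close>, \<open>(s', g, t)\<close> and \<open>(s', t', g)\<close> combine to
  \<open>\<mu> (s', t') g + \<mu> (s' t', g) = \<mu> (g, s t) + g \<mu> (s, t)\<close>.  In the sum over a relation the terms with
  products disappear.  Taking the coefficient of \<open>h g\<close> gives the claim.
\<close>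

lemma K_equivariance:
  assumes ij: "i \<in> {1..n}" "j \<in> {1..n}" and g: "g \<in> carrier G" and h: "h \<in> carrier G"
  shows "(\<Sum>(k, l)\<in>{1..n} \<times> {1..n}. act g (rel q i j) [k, l] / 2 * K k l h)
        = K i j (inv\<^bsub>G\<^esub> g \<cdot> h \<cdot> g)"
proof -
  let ?N = "{1..n}"
  define L where "L = coeffR (h \<cdot> g) []"
  have hg: "h \<cdot> g \<in> carrier G" using g h by simp
  define F where "F s t = L (\<mu> (emb s) (emb t) \<otimes>\<^sub>R \<gamma> g)" for s t
  have L_add: "L (r \<oplus>\<^sub>R s) = L r + L s" if "r \<in> carrier R.B" "s \<in> carrier R.B" for r s
    using that hg by (simp add: L_def coeffR_add)
  have L_smult: "L (c \<odot>\<^sub>R r) = c * L r" if "r \<in> carrier R.B" for r c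
    using that hg by (simp add: L_def coeffR_smult)
  have L_zero: "L \<zero>\<^bsub>R.B\<^esub> = 0" using L_smult[of "\<zero>\<^bsub>R.B\<^esub>" 0] by simp
  have F_add: "F (\<lambda>w. s w + s' w) t = F s t + F s' t" "F t (\<lambda>w. s w + s' w) = F t s + F t s'"
    if "s \<in> carrier T" "s' \<in> carrier T" "t \<in> carrier T" for s s' t
    using that by (simp_all add: F_def emb_add \<mu>_add R.B.l_distr L_add)
  have F_smult: "F (\<lambda>w. c * s w) t = c * F s t" "F t (\<lambda>w. c * s w) = c * F t s"
    if "s \<in> carrier T" "t \<in> carrier T" for c s t
    using that by (simp_all add: F_def emb_smult \<mu>_smult R.B.smult_m_assoc L_smult)
  have letter: "wd [k] \<in> free_grade n 1" "wd [k] \<in> carrier T" if "k \<in> ?N" for k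
    using that by (auto simp: free_grade_def wd_def split: if_splits) (auto simp: mem_free_algebra)
  have act1: "act g (wd [k]) \<in> free_grade n 1" if "k \<in> ?N" for k
    using letter[OF that] act_length[of "wd [k]" 1 g] wd_length by (fastforce simp: free_grade_def)
  define b where "b i j = F (act g (wd [i])) (act g (wd [j]))" for i j
  \<comment> \<open>The combination of the three cocycle identities.\<close>
  have main: "b i j + L (\<mu> (emb (act g (wd [i, j]))) (\<gamma> g))
      = L (\<mu> (\<gamma> g) (emb (wd [i, j]))) + L (\<gamma> g \<otimes>\<^sub>R \<mu> (emb (wd [i])) (emb (wd [j])))"
    if ij: "i \<in> ?N" "j \<in> ?N" for i j
  proof -
    let ?s = "wd [i]" and ?t = "wd [j]" and ?s' = "act g (wd [i])" and ?t' = "act g (wd [j])"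
    note [simp] = letter[OF ij(1)] letter[OF ij(2)] act1[OF ij(1)] act1[OF ij(2)]
    have Xst: "emb (wd [i, j]) = emb ?s \<otimes>\<^sub>R emb ?t" "emb (act g (wd [i, j])) = emb ?s' \<otimes>\<^sub>R emb ?t'"
      using emb_conv[of ?s ?t] emb_conv[of ?s' ?t'] act_conv[of g ?s ?t] by (simp_all add: conv_wd_wd)
    have "L (\<mu> (\<gamma> g \<otimes>\<^sub>R emb ?s) (emb ?t)) = L (\<mu> (\<gamma> g) (emb ?s \<otimes>\<^sub>R emb ?t)) + L (\<gamma> g \<otimes>\<^sub>R \<mu> (emb ?s) (emb ?t))"
      using coeffR_cocycle[OF hg, of "[]" "\<gamma> g" "emb ?s" "emb ?t"] by (simp add: \<mu>_group_letter L_zero flip: L_def)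
    moreover have "L (\<mu> (emb ?s' \<otimes>\<^sub>R \<gamma> g) (emb ?t)) = L (\<mu> (emb ?s') (\<gamma> g \<otimes>\<^sub>R emb ?t))"
      using coeffR_cocycle[OF hg, of "[]" "emb ?s'" "\<gamma> g" "emb ?t"] by (simp add: \<mu>_group_letter L_zero flip: L_def)
    moreover have "L (\<mu> (emb ?s') (emb ?t') \<otimes>\<^sub>R \<gamma> g) + L (\<mu> (emb ?s' \<otimes>\<^sub>R emb ?t') (\<gamma> g))
        = L (\<mu> (emb ?s') (emb ?t' \<otimes>\<^sub>R \<gamma> g))"
      using coeffR_cocycle[OF hg, of "[]" "emb ?s'" "emb ?t'" "\<gamma> g"] by (simp add: \<mu>_group_letter L_zero flip: L_def)
    ultimately show ?thesis using g by (simp add: Xst b_def F_def \<gamma>_emb)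
  qed
  \<comment> \<open>The relation and its image under \<open>g\<close> are zero in \<open>R\<close>.\<close>
  have swap: "emb (wd [i, j]) = q i j \<odot>\<^sub>R emb (wd [j, i])"
    "emb (act g (wd [i, j])) = q i j \<odot>\<^sub>R emb (act g (wd [j, i]))"
    using rel_in_J[OF ij] act_J[OF g rel_in_J[OF ij]] ij
    unfolding rel_alt act_add_fun act_smult_fun by (auto intro!: emb_eq_smult)
  have "b i j - q i j * b j i = L (\<gamma> g \<otimes>\<^sub>R kappaR i j)"
  proof -
    have c: "wd [j, i] \<in> carrier T" using ij by auto
    have l: "L (\<gamma> g \<otimes>\<^sub>R kappaR i j) = L (\<gamma> g \<otimes>\<^sub>R \<mu> (emb (wd [i])) (emb (wd [j])))
        - q i j * L (\<gamma> g \<otimes>\<^sub>R \<mu> (emb (wd [j])) (emb (wd [i])))"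
      unfolding L_def using hg ij by (intro coeffR_linear_kappaR) auto
    have b1: "b i j = q i j * L (\<mu> (\<gamma> g) (emb (wd [j, i]))) + L (\<gamma> g \<otimes>\<^sub>R \<mu> (emb (wd [i])) (emb (wd [j])))
        - q i j * L (\<mu> (emb (act g (wd [j, i]))) (\<gamma> g))"
      using main[OF ij] c unfolding swap by (simp add: \<mu>_smult L_smult eq_diff_eq)
    have b2: "b j i = L (\<mu> (\<gamma> g) (emb (wd [j, i]))) + L (\<gamma> g \<otimes>\<^sub>R \<mu> (emb (wd [j])) (emb (wd [i])))
        - L (\<mu> (emb (act g (wd [j, i]))) (\<gamma> g))"
      using main[OF ij(2,1)] by (simp add: eq_diff_eq)
    show ?thesis unfolding l b1 b2 by (simp add: algebra_simps)
  qed
  moreover have "b i j - q i j * b j i = (\<Sum>k=1..n. \<Sum>l=1..n. act g (rel q i j) [k, l] * F (wd [k]) (wd [l]))"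
  proof -
    have ex: "b i j = (\<Sum>k=1..n. \<Sum>l=1..n. M g i k * M g j l * F (wd [k]) (wd [l]))"
      if ij: "i \<in> ?N" "j \<in> ?N" for i j
    proof -
      have c: "(\<lambda>w. \<Sum>l=1..n. M g j l * wd [l] w) \<in> carrier T"
        by (rule free_sum_closed) auto
      have "b i j = (\<Sum>k=1..n. M g i k * F (wd [k]) (\<lambda>w. \<Sum>l=1..n. M g j l * wd [l] w))"
        unfolding b_def wact_letter[OF ij(1)] wact_letter[OF ij(2)]
        using c F_add F_smult by (intro linear_functional_sum) auto
      also have "\<dots> = (\<Sum>k=1..n. M g i k * (\<Sum>l=1..n. M g j l * F (wd [k]) (wd [l])))"
        using F_add F_smult by (intro sum.cong refl arg_cong2[of _ _ _ _ "(*)"] linear_functional_sum) auto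
      finally show ?thesis by (simp add: sum_distrib_left mult.assoc)
    qed
    have e: "act g (rel q i j) [k, l] = M g i k * M g j l - q i j * (M g j k * M g i l)"
      if "k \<in> ?N" "l \<in> ?N" for k l
    proof -
      have aw: "act g (wd [i, j]) [k, l] = M g i k * M g j l" if "i \<in> ?N" "j \<in> ?N" for i j
      proof -
        have "act g (wd [i, j]) = conv (act g (wd [i])) (act g (wd [j]))"
          using act_conv[of g "wd [i]" "wd [j]"] by (simp add: conv_wd_wd)
        hence "act g (wd [i, j]) [k, l] = act g (wd [i]) [k] * act g (wd [j]) [l]"
        proof -
          have "act g (wd [a]) u = 0" if "length u \<noteq> 1" for a u
            using that act_length[of "wd [a]" 1 g u] wd_length[of "[a]"] by auto
          thus ?thesis using \<open>act g (wd [i, j]) = conv (act g (wd [i])) (act g (wd [j]))\<close>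
            by (simp del: wact.simps)
        qed
        thus ?thesis using \<open>k \<in> ?N\<close> \<open>l \<in> ?N\<close> that by (simp only: wact_letter_coeff)
      qed
      show ?thesis unfolding rel_alt wact_add wact_smult using aw ij by simp
    qed
    show ?thesis
      unfolding ex[OF ij] ex[OF ij(2,1)] sum_distrib_left sum_subtractf[symmetric]
      by (intro sum.cong refl) (simp add: e algebra_simps del: wact.simps)
  qed
  moreover have "(\<Sum>k=1..n. \<Sum>l=1..n. act g (rel q i j) [k, l] * F (wd [k]) (wd [l]))
      = (\<Sum>(k, l)\<in>?N \<times> ?N. act g (rel q i j) [k, l] / 2 * L (kappaR k l \<otimes>\<^sub>R \<gamma> g))"
  proof -
    let ?e = "\<lambda>k l. act g (rel q i j) [k, l]"
    have sym: "?e l k = - q k l * ?e k l" if "k \<in> ?N" "l \<in> ?N" for k l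
      using that J_low(3) act_J[OF g rel_in_J[OF ij]] by blast
    have "(\<Sum>(k, l)\<in>?N \<times> ?N. ?e k l / 2 * L (kappaR k l \<otimes>\<^sub>R \<gamma> g))
      = (\<Sum>(k, l)\<in>?N \<times> ?N. ?e k l / 2 * F (wd [k]) (wd [l])) + (\<Sum>(k, l)\<in>?N \<times> ?N. ?e l k / 2 * F (wd [l]) (wd [k]))"
      unfolding sum.distrib[symmetric]
    proof (intro sum.cong refl, clarify)
      fix k l assume kl: "k \<in> ?N" "l \<in> ?N"
      have "L (kappaR k l \<otimes>\<^sub>R \<gamma> g) = F (wd [k]) (wd [l]) - q k l * F (wd [l]) (wd [k])"
        unfolding L_def F_def using hg kl by (intro coeffR_linear_kappaR) auto
      thus "?e k l / 2 * L (kappaR k l \<otimes>\<^sub>R \<gamma> g) = ?e k l / 2 * F (wd [k]) (wd [l]) + ?e l k / 2 * F (wd [l]) (wd [k])"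
        by (simp only: sym[OF kl]) (simp add: algebra_simps del: wact.simps)
    qed
    also have "(\<Sum>(k, l)\<in>?N \<times> ?N. ?e l k / 2 * F (wd [l]) (wd [k])) = (\<Sum>(k, l)\<in>?N \<times> ?N. ?e k l / 2 * F (wd [k]) (wd [l]))"
      by (rule sum.reindex_bij_witness[of _ prod.swap prod.swap]) auto
    also have "(\<Sum>(k, l)\<in>?N \<times> ?N. ?e k l / 2 * F (wd [k]) (wd [l])) + (\<Sum>(k, l)\<in>?N \<times> ?N. ?e k l / 2 * F (wd [k]) (wd [l]))
      = (\<Sum>(k, l)\<in>?N \<times> ?N. ?e k l * F (wd [k]) (wd [l]))"
      unfolding sum.distrib[symmetric] by (intro sum.cong refl) (auto simp del: wact.simps)
    finally show ?thesis by (simp only: sum.cartesian_product)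
  qed
  moreover have "L (kappaR k l \<otimes>\<^sub>R \<gamma> g) = K k l h" for k l
  proof -
    have "(kappaR k l \<otimes>\<^sub>R \<gamma> g) (h \<cdot> g) = kappaR k l h"
      using g h by (simp add: \<gamma>_def R.mult_single_apply G.m_assoc)
    thus ?thesis using h const_closed by (simp add: L_def coeffR_def kappaR_apply low_coeff_proj)
  qed
  moreover have "L (\<gamma> g \<otimes>\<^sub>R kappaR i j) = K i j (inv\<^bsub>G\<^esub> g \<cdot> h \<cdot> g)"
  proof -
    let ?k = "inv\<^bsub>G\<^esub> g \<cdot> h \<cdot> g"
    have "(\<gamma> g \<otimes>\<^sub>R kappaR i j) (h \<cdot> g) = \<alpha> g (kappaR i j ?k)"
      using g h by (simp add: \<gamma>_def R.single_mult_apply G.m_assoc)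
    also have "kappaR i j ?k = K i j ?k \<odot>\<^bsub>S.Q\<^esub> \<one>\<^bsub>S.Q\<^esub>" using g h by (simp add: kappaR_def group_algebra_incl_def)
    also have "\<alpha> g \<dots> = kappaR i j ?k" using g h by (simp add: R.act_smult) (simp add: kappaR_def group_algebra_incl_def)
    finally show ?thesis using g h const_closed by (simp add: L_def coeffR_def kappaR_apply low_coeff_proj)
  qed
  ultimately show ?thesis by simp
qed

text \<open>
  With the cocycle identity for letters \<open>a, b, c\<close> written as \<open>p + u = v + r\<close>, the six identities for
  the permutations of \<open>i, j, k\<close> are added with the coefficients of
  \<open>r\<^sub>i\<^sub>j v\<^sub>k - q\<^sub>j\<^sub>k r\<^sub>i\<^sub>k v\<^sub>j + q\<^sub>i\<^sub>j q\<^sub>i\<^sub>k r\<^sub>j\<^sub>k v\<^sub>i = v\<^sub>i r\<^sub>j\<^sub>k - q\<^sub>i\<^sub>j v\<^sub>j r\<^sub>i\<^sub>k + q\<^sub>j\<^sub>k q\<^sub>i\<^sub>k v\<^sub>k r\<^sub>i\<^sub>j\<close>,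
  where \<open>r\<^sub>i\<^sub>j\<close> is the relation of \<open>v\<^sub>i\<close> and \<open>v\<^sub>j\<close>.  The first form makes the terms \<open>u\<close> cancel and
  the second one the terms \<open>v\<close>.  What remains are the products of \<open>\<kappa>\<close> with letters.
\<close>

lemma K_jacobi_identity:
  assumes ijk: "i \<in> {1..n}" "j \<in> {1..n}" "k \<in> {1..n}" and h: "h \<in> carrier G"
  shows "K i j h * act h (wd [k]) w + q i j * K i k h * wd [j] w + q i j * q i k * K j k h * act h (wd [i]) w
      = K j k h * wd [i] w + q j k * K i k h * act h (wd [j]) w + q j k * q i k * K i j h * wd [k] w"
\<comment> \<open>Both sides are homogeneous of degree 1.\<close>
proof (cases "length w = 1")
  case False
  have "act h (wd [a]) w = 0" "wd [a] w = 0" for a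
    using False wd_length[of "[a]" w] act_length[of "wd [a]" 1 h w] wd_length[of "[a]"] by auto
  thus ?thesis by simp
next
  case w: True
  define L where "L = coeffR h w"
  define p where "p a b c = L (\<mu> (emb (wd [a])) (emb (wd [b])) \<otimes>\<^sub>R emb (wd [c]))" for a b c
  define r where "r a b c = L (emb (wd [a]) \<otimes>\<^sub>R \<mu> (emb (wd [b])) (emb (wd [c])))" for a b c
  define u where "u a b c = L (\<mu> (emb (wd [a, b])) (emb (wd [c])))" for a b c
  define v where "v a b c = L (\<mu> (emb (wd [a])) (emb (wd [b, c])))" for a b c
  have X2: "emb (wd [a, b]) = emb (wd [a]) \<otimes>\<^sub>R emb (wd [b])" if "a \<in> {1..n}" "b \<in> {1..n}" for a b
    using emb_conv[of "wd [a]" "wd [b]"] that by (simp add: conv_wd_wd)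
  have swap: "emb (wd [a, b]) = q a b \<odot>\<^sub>R emb (wd [b, a])" if ab: "a \<in> {1..n}" "b \<in> {1..n}" for a b
    using rel_in_J[OF ab] ab unfolding rel_alt by (auto intro!: emb_eq_smult)
  have eq: "p a b c + u a b c = v a b c + r a b c"
    if "a \<in> {1..n}" "b \<in> {1..n}" "c \<in> {1..n}" for a b c
    unfolding p_def u_def v_def r_def L_def X2[OF that(1,2)] X2[OF that(2,3)]
    using that h w by (intro coeffR_cocycle) auto
  have us: "u a b c = q a b * u b a c" if "a \<in> {1..n}" "b \<in> {1..n}" "c \<in> {1..n}" for a b c
    unfolding u_def L_def swap[OF that(1,2)] using that h w by (simp add: \<mu>_smult coeffR_smult)
  have vs: "v a b c = q b c * v a c b" if "a \<in> {1..n}" "b \<in> {1..n}" "c \<in> {1..n}" for a b c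
    unfolding v_def L_def swap[OF that(2,3)] using that h w by (simp add: \<mu>_smult coeffR_smult)
  have P: "p a b c - q a b * p b a c = K a b h * act h (wd [c]) w"
    if abc: "a \<in> {1..n}" "b \<in> {1..n}" "c \<in> {1..n}" for a b c
  proof -
    have cc: "wd [c] \<in> carrier T" using abc by auto
    have "(kappaR a b \<otimes>\<^sub>R emb (wd [c])) h = kappaR a b h \<otimes>\<^bsub>S.Q\<^esub> S.proj (act h (wd [c]))"
      using h cc by (simp add: emb_def R.mult_single_apply \<alpha>_proj)
    also have "\<dots> = S.proj (conv (\<lambda>w. K a b h * (if w = [] then 1 else 0)) (act h (wd [c])))"
      using h cc const_closed S.proj_mult by (simp add: kappaR_apply)
    also have "conv (\<lambda>w. K a b h * (if w = [] then 1 else 0)) (act h (wd [c]))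
        = (\<lambda>w. K a b h * act h (wd [c]) w)"
      by (rule ext) (simp only: conv_smult_left conv_one_left)
    finally have "coeffR h w (kappaR a b \<otimes>\<^sub>R emb (wd [c])) = K a b h * act h (wd [c]) w"
      using cc w by (simp add: coeffR_def low_coeff_proj free_smult_closed)
    thus ?thesis
      using coeffR_linear_kappaR(2)[OF h _ abc(1,2), of w "emb (wd [c])"] w cc by (simp add: p_def L_def)
  qed
  have R: "r a b c - q b c * r a c b = K b c h * wd [a] w"
    if abc: "a \<in> {1..n}" "b \<in> {1..n}" "c \<in> {1..n}" for a b c
  proof -
    have cc: "wd [a] \<in> carrier T" using abc by auto
    have "(emb (wd [a]) \<otimes>\<^sub>R kappaR b c) h = S.proj (wd [a]) \<otimes>\<^bsub>S.Q\<^esub> kappaR b c h"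
      using h cc by (simp add: emb_def R.single_mult_apply)
    also have "\<dots> = S.proj (conv (wd [a]) (\<lambda>w. K b c h * (if w = [] then 1 else 0)))"
      using h cc const_closed S.proj_mult by (simp add: kappaR_apply)
    also have "conv (wd [a]) (\<lambda>w. K b c h * (if w = [] then 1 else 0)) = (\<lambda>w. K b c h * wd [a] w)"
      by (rule ext) (simp only: conv_smult_right conv_one_right)
    finally have "coeffR h w (emb (wd [a]) \<otimes>\<^sub>R kappaR b c) = K b c h * wd [a] w"
      using cc w by (simp add: coeffR_def low_coeff_proj free_smult_closed)
    thus ?thesis
      using coeffR_linear_kappaR(3)[OF h _ abc(2,3), of w "emb (wd [a])"] w cc by (simp add: r_def L_def)
  qed
  have "(p i j k - q i j * p j i k) + q i j * (r j i k - q i k * r j k i)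
      + q i j * q i k * (p j k i - q j k * p k j i)
    = (r i j k - q j k * r i k j) + q j k * (p i k j - q i k * p k i j)
      + q j k * q i k * (r k i j - q i j * r k j i)"
  proof -
    have p0: "p i j k = q j k * v i k j + r i j k - q i j * u j i k"
      using eq[of i j k] us[of i j k] vs[of i j k] ijk by (simp add: eq_diff_eq)
    have p1: "p j i k = q i k * v j k i + r j i k - u j i k"
      using eq[of j i k] vs[of j i k] ijk by (simp add: eq_diff_eq)
    have p2: "p j k i = v j k i + r j k i - q j k * u k j i"
      using eq[of j k i] us[of j k i] ijk by (simp add: eq_diff_eq)
    have p3: "p k j i = v k j i + r k j i - u k j i" using eq[of k j i] ijk by (simp add: eq_diff_eq)
    have p4: "p i k j = v i k j + r i k j - q i k * u k i j"
      using eq[of i k j] us[of i k j] ijk by (simp add: eq_diff_eq)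
    have p5: "p k i j = q i j * v k j i + r k i j - u k i j"
      using eq[of k i j] vs[of k i j] ijk by (simp add: eq_diff_eq)
    show ?thesis unfolding p0 p1 p2 p3 p4 p5 by (simp add: algebra_simps)
  qed
  thus ?thesis using P R ijk by (simp add: mult.assoc del: wact.simps)
qed

sublocale pbw_data n q G M \<alpha> K
  by unfold_locales (fact K_antisymmetric K_equivariance K_jacobi_identity)+

end

section \<open>Drinfeld Hecke algebras of constant cocycles\<close>

lemma coord_basis:
  assumes "vector_space scale" "is_basis scale n v" "i \<in> {1..n}" "k \<in> {1..n}"
  shows "coord scale n v (v i) k = (if i = k then 1 else 0)"
proof -
  interpret vector_space scale by fact
  have "inj_on v {1..n}" "independent (v ` {1..n})" using assms(2) by (auto simp: is_basis_def)
  moreover have "v k = v i \<longleftrightarrow> i = k" using inj_on_eq_iff[OF calculation(1)] assms(3,4) by blast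
  ultimately show ?thesis
    using representation_basis[of "v ` {1..n}" "v i"] assms(3) by (auto simp: coord_def)
qed

lemma coord_linear_map:
  assumes vs: "vector_space scale" and b: "is_basis scale n v" and f: "Vector_Spaces.linear scale scale f"
  shows "coord scale n v (f x) k = (\<Sum>i=1..n. coord scale n v x i * coord scale n v (f (v i)) k)"
proof -
  interpret vector_space scale by fact
  interpret f: Vector_Spaces.linear scale scale f by fact
  have inj: "inj_on v {1..n}" and ind: "independent (v ` {1..n})" and sp: "span (v ` {1..n}) = UNIV"
    using b by (auto simp: is_basis_def)
  have "x = (\<Sum>b\<in>v ` {1..n}. scale (representation (v ` {1..n}) x b) b)"
    using ind sp by (intro sum_representation_eq[symmetric]) auto
  also have "\<dots> = (\<Sum>i=1..n. scale (coord scale n v x i) (v i))"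
    unfolding coord_def by (subst sum.reindex[OF inj]) simp
  finally have x: "x = (\<Sum>i=1..n. scale (coord scale n v x i) (v i))" .
  have "f x = (\<Sum>i=1..n. scale (coord scale n v x i) (f (v i)))"
    by (subst x) (simp add: f.sum f.scale)
  hence "coord scale n v (f x) k
      = representation (v ` {1..n}) (\<Sum>i=1..n. scale (coord scale n v x i) (f (v i))) (v k)"
    by (simp add: coord_def)
  also have "\<dots> = (\<Sum>i=1..n. representation (v ` {1..n}) (scale (coord scale n v x i) (f (v i))) (v k))"
    using ind sp by (subst representation_sum) auto
  also have "\<dots> = (\<Sum>i=1..n. coord scale n v x i * coord scale n v (f (v i)) k)"
    using ind sp by (simp add: representation_scale coord_def)
  finally show ?thesis .
qed

text \<open>
  The diagonal action on tensors is the substitution by the matrix of \<open>\<rho> g\<close>.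
\<close>

lemma tensor_action_eq:
  "tensor_action scale n v \<rho> g
    = (\<lambda>f\<in>carrier (free_algebra n). wact n (\<lambda>i k. coord scale n v (\<rho> g (v i)) k) f)"
proof -
  let ?M = "\<lambda>i k. coord scale n v (\<rho> g (v i)) k"
  have "(if set u \<subseteq> {1..n} then \<Sum>w | set w \<subseteq> {1..n} \<and> length w = length u.
           (\<Prod>k<length u. ?M (w ! k) (u ! k)) * f w else 0) = wact n ?M f u" for f u
    using wact_eq_sum[of u n ?M f] wact_nonzero[of n ?M f u] by auto
  thus ?thesis by (simp only: tensor_action_def)
qed

lemma tensor_incl_eq: "tensor_incl scale n v x = (\<lambda>w. \<Sum>k=1..n. coord scale n v x k * wd [k] w)"
  by (simp add: tensor_incl_def free_gen_eq_wd)

theorem theorem4p4: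
  fixes G :: "('g, 'h) monoid_scheme"
    and scale :: "complex \<Rightarrow> 'v::ab_group_add \<Rightarrow> 'v"
    and n :: nat
    and v :: "nat \<Rightarrow> 'v"
    and \<rho> :: "'g \<Rightarrow> 'v \<Rightarrow> 'v"
    and q :: "nat \<Rightarrow> nat \<Rightarrow> complex"
    and \<alpha> :: "'g \<Rightarrow> (nat list \<Rightarrow> complex) set \<Rightarrow> (nat list \<Rightarrow> complex) set"
    and \<mu> :: "('g \<Rightarrow> (nat list \<Rightarrow> complex) set) \<Rightarrow> ('g \<Rightarrow> (nat list \<Rightarrow> complex) set)
               \<Rightarrow> 'g \<Rightarrow> (nat list \<Rightarrow> complex) set"
    and \<kappa> :: "'v \<Rightarrow> 'v \<Rightarrow> 'g \<Rightarrow> complex"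
  assumes "group G" and "finite (carrier G)"
    and "vector_space scale" and "is_basis scale n v"
    and "group_action G (UNIV :: 'v set) \<rho>"
    and "\<And>g. g \<in> carrier G \<Longrightarrow> Vector_Spaces.linear scale scale (\<rho> g)"
    and "\<And>i j. i \<in> {1..n} \<Longrightarrow> j \<in> {1..n} \<Longrightarrow> q i j \<noteq> 0"
    and "\<And>i. i \<in> {1..n} \<Longrightarrow> q i i = 1"
    and "\<And>i j. i \<in> {1..n} \<Longrightarrow> j \<in> {1..n} \<Longrightarrow> q j i = inverse (q i j)"
    and "extends_action G scale n v \<rho> q \<alpha>"
    and "\<exists>\<beta>. extends_action G scale n v \<rho> (\<lambda>i j. - q i j) \<beta>"
    and "constant_hochschild_2_cocycle (quantum_symmetric_skew G n q \<alpha>) (skew_part G (q_grade n q)) \<mu>"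
    and "bilinear_from scale (group_algebra G) \<kappa>"
    and "\<And>i j. i \<in> {1..n} \<Longrightarrow> j \<in> {1..n} \<Longrightarrow>
           group_algebra_incl (quantum_symmetric n q) G (\<kappa> (v i) (v j))
           = \<mu> (skew_gen G n q i) (skew_gen G n q j)
             \<ominus>\<^bsub>quantum_symmetric_skew G n q \<alpha>\<^esub>
               q i j \<odot>\<^bsub>quantum_symmetric_skew G n q \<alpha>\<^esub> \<mu> (skew_gen G n q j) (skew_gen G n q i)"
  shows "quantum_drinfeld_hecke G scale n v \<rho> q \<alpha> \<kappa>"
proof -
  define M where "M g i k = coord scale n v (\<rho> g (v i)) k" for g i k
  define K where "K i j = \<kappa> (v i) (v j)" for i j
  interpret \<rho>: group_action G "UNIV :: 'v set" \<rho> by fact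
  note vs = assms(3) and basis = assms(4) and lin = assms(6)
  have \<alpha>_gen: "\<alpha> g (q_gen n q i) = q_ideal n q +>\<^bsub>free_algebra n\<^esub> wact n (M g) (free_gen i)"
    if g: "g \<in> carrier G" and i: "i \<in> {1..n}" for g i
  proof -
    have "tensor_incl scale n v (v i) w = wd [i] w" for w
    proof -
      have "tensor_incl scale n v (v i) w = (\<Sum>k=1..n. if k = i then wd [i] w else 0)"
        unfolding tensor_incl_eq by (intro sum.cong) (use i coord_basis[OF vs basis i] in auto)
      thus ?thesis using i by simp
    qed
    hence "tensor_incl scale n v (v i) = free_gen i" by (auto simp: free_gen_eq_wd)
    moreover have "tensor_incl scale n v (\<rho> g (v i)) = wact n (M g) (free_gen i)"
      using i by (simp only: tensor_incl_eq free_gen_eq_wd wact_letter M_def)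
    ultimately show ?thesis using assms(10) g by (metis extends_action_def q_gen_def)
  qed
  interpret D: q_action n q G M \<alpha>
  proof (intro q_action.intro q_action_axioms.intro)
    show "q_system n q" by (rule q_system.intro) (fact assms(7-9))+
    show "group G" "finite (carrier G)" by fact+
    show "M \<one>\<^bsub>G\<^esub> i k = (if i = k then 1 else 0)" if "i \<in> {1..n}" "k \<in> {1..n}" for i k
    proof -
      have "\<rho> \<one>\<^bsub>G\<^esub> (v i) = v i" using \<rho>.id_eq_one by (metis UNIV_I restrict_apply')
      thus ?thesis using coord_basis[OF vs basis that] by (simp add: M_def)
    qed
    show "M (g \<otimes>\<^bsub>G\<^esub> h) j k = (\<Sum>i=1..n. M h j i * M g i k)"
      if "g \<in> carrier G" "h \<in> carrier G" for g h j k
      using coord_linear_map[OF vs basis lin[OF that(1)], of "\<rho> h (v j)" k]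
        \<rho>.composition_rule[of "v j" g h] that by (simp add: M_def)
    show "acts_by_automorphisms G (q_algebra n q) \<alpha>" using assms(10) by (simp add: extends_action_def)
    show "\<alpha> g (q_gen n q i) = q_ideal n q +>\<^bsub>free_algebra n\<^esub> wact n (M g) (free_gen i)"
      if "g \<in> carrier G" "i \<in> {1..n}" for g i using that by (rule \<alpha>_gen)
  qed
  have letter: "skew_gen G n q i = D.emb (wd [i])" for i
  proof -
    have "D.emb (wd [i]) = skew_incl D.S.Q G (D.S.proj (wd [i]))"
      by (simp only: D.emb_def D.R.skew_incl_eq_single)
    thus ?thesis by (simp only: D.S_Q q_gen_def free_gen_eq_wd)
  qed
  interpret D: q_cocycle n q G M \<alpha> \<mu> K
  proof (intro q_cocycle.intro q_cocycle_axioms.intro D.q_action_axioms)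
    show "constant_hochschild_2_cocycle D.R.B (skew_part G (q_grade n q)) \<mu>"
      using assms(12) by (simp only: D.S_Q)
    show "group_algebra_incl D.S.Q G (K i j) = \<mu> (D.emb (wd [i])) (D.emb (wd [j]))
        \<ominus>\<^bsub>D.R.B\<^esub> q i j \<odot>\<^bsub>D.R.B\<^esub> \<mu> (D.emb (wd [j])) (D.emb (wd [i]))"
      if "i \<in> {1..n}" "j \<in> {1..n}" for i j
      using assms(14)[OF that] by (simp only: D.S_Q letter K_def)
  qed
  have act: "tensor_action scale n v \<rho> = D.\<tau>"
  proof
    fix g
    have "(\<lambda>i k. coord scale n v (\<rho> g (v i)) k) = M g" by (intro ext) (simp add: M_def)
    thus "tensor_action scale n v \<rho> g = D.\<tau> g" by (simp only: tensor_action_eq D.\<tau>_def)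
  qed
  hence skew: "tensor_skew G scale n v \<rho> = D.E.B" by (simp add: tensor_skew_def)
  have ideal: "hecke_ideal G scale n v \<rho> q \<kappa> = D.hecke"
  proof -
    let ?x = "\<lambda>i. skew_incl (free_algebra n) G (free_gen i)"
    have im: "{f i j | i j. i \<in> {1..n} \<and> j \<in> {1..n}} = (\<lambda>(i, j). f i j) ` ({1..n} \<times> {1..n})"
      for f :: "nat \<Rightarrow> nat \<Rightarrow> 'g \<Rightarrow> nat list \<Rightarrow> complex" by (auto, metis)
    have gen: "?x i \<otimes>\<^bsub>D.E.B\<^esub> ?x j \<ominus>\<^bsub>D.E.B\<^esub> q i j \<odot>\<^bsub>D.E.B\<^esub> (?x j \<otimes>\<^bsub>D.E.B\<^esub> ?x i)
        \<ominus>\<^bsub>D.E.B\<^esub> group_algebra_incl (free_algebra n) G (\<kappa> (v i) (v j)) = D.hecke_rel i j"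
      if ij: "i \<in> {1..n}" "j \<in> {1..n}" for i j
    proof -
      let ?g = free_gen
      have mult: "?x i \<otimes>\<^bsub>D.E.B\<^esub> ?x j = D.E.single (?g i \<otimes>\<^bsub>free_algebra n\<^esub> ?g j) \<one>\<^bsub>G\<^esub>"
        if "i \<in> {1..n}" "j \<in> {1..n}" for i j
        using that by (simp add: D.E.skew_incl_eq_single free_gen_eq_wd D.E.single_mult_single)
      have c: "?g i \<otimes>\<^bsub>free_algebra n\<^esub> ?g j \<in> carrier (free_algebra n)"
        if "i \<in> {1..n}" "j \<in> {1..n}" for i j
        using that by (simp add: free_gen_eq_wd conv_wd_wd)
      have "D.E.single (rel q i j) \<one>\<^bsub>G\<^esub>
          = ?x i \<otimes>\<^bsub>D.E.B\<^esub> ?x j \<ominus>\<^bsub>D.E.B\<^esub> q i j \<odot>\<^bsub>D.E.B\<^esub> (?x j \<otimes>\<^bsub>D.E.B\<^esub> ?x i)"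
        unfolding mult[OF ij] mult[OF ij(2,1)]
        by (simp only: D.E.single_a_minus D.E.single_smult c[OF ij] c[OF ij(2,1)]
            D.T.smult_closed flip: rel_eq[OF ij])
      thus ?thesis by (simp only: D.hecke_rel_def D.kappaE_def K_def)
    qed
    have "{?x i \<otimes>\<^bsub>D.E.B\<^esub> ?x j \<ominus>\<^bsub>D.E.B\<^esub> q i j \<odot>\<^bsub>D.E.B\<^esub> (?x j \<otimes>\<^bsub>D.E.B\<^esub> ?x i)
        \<ominus>\<^bsub>D.E.B\<^esub> group_algebra_incl (free_algebra n) G (\<kappa> (v i) (v j)) | i j. i \<in> {1..n} \<and> j \<in> {1..n}}
      = {D.hecke_rel i j | i j. i \<in> {1..n} \<and> j \<in> {1..n}}"
      unfolding im by (intro image_cong refl, clarify, rule gen)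
    thus ?thesis by (simp only: hecke_ideal_def Let_def skew D.hecke_def)
  qed
  have antisym: "\<kappa> (v i) (v j) = (- q i j) \<odot>\<^bsub>group_algebra G\<^esub> \<kappa> (v j) (v i)"
    if ij: "i \<in> {1..n}" "j \<in> {1..n}" for i j
  proof
    fix h
    have "\<kappa> (v i) (v j) \<in> carrier G \<rightarrow>\<^sub>E UNIV"
      using assms(13) by (simp add: bilinear_from_def group_algebra_def skew_group_algebra_def complex_alg_def)
    thus "\<kappa> (v i) (v j) h = ((- q i j) \<odot>\<^bsub>group_algebra G\<^esub> \<kappa> (v j) (v i)) h"
      using D.K_antisym[OF ij, of h]
      by (auto simp: K_def group_algebra_def skew_group_algebra_def complex_alg_def PiE_def extensional_def)
  qed
  have alg: "hecke_algebra G scale n v \<rho> q \<kappa> = quotient_algebra D.E.B D.hecke"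
    by (simp only: hecke_algebra_def skew ideal)
  have filt: "hecke_filtration G scale n v \<rho> q \<kappa>
      = quotient_part D.E.B D.hecke (skew_part G (free_filtration n))"
    by (simp only: hecke_filtration_def skew ideal)
  show ?thesis
    unfolding quantum_drinfeld_hecke_def alg filt
    by (intro conjI ballI assms(13) antisym D.pbw)
qed

end
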